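(* There exist positive constants $B$, $C$, $C_1$ and $c$ (independent of $h$, $\tau$, $K$) such that, for all sufficiently small $h>0$ and $\tau>0$ and all sufficiently large $K$ (how large possibly depending on $h$), the following holds. If $\psi_0\in V_{h,K}$ is real, satisfies $N_h(\psi_0)=1$ and $$\|i_h\psi_0-\eta\|_{H^1}\le B,$$ then the sequence $(\psi_n)_{n\ge0}$ in $V_{h,K}$ defined from $\psi_0$ by the fully discrete algorithm $$\psi_n^{*,\ell} = \psi_n^\ell+\tau\Big(\tfrac12(\Delta_h\psi_n^* )^\ell+|\psi_n^\ell|^2\psi_n^{*,\ell}\Big)\ \text{ for } |\ell|\le K,\qquad \psi_n^{*,\ell}=0 \ \text{ for } |\ell|\ge K+1,$$ $$\psi_{n+1}^\ell=\frac{\psi_n^{*,\ell}}{N_h(\psi_n^* )^{1/2}},\qquad \ell\in\mathbb{Z},$$ satisfies, for all $n\ge0$, $$\|i_h\psi_n-\eta\|_{H^1}\le C\Big(e^{-cn\tau}+h+\frac1{h^2}e^{-C_1hK}\Big).$$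
   Context: Here $h>0$ is the space mesh size, $K$ a positive integer (Dirichlet cut-off index) and $\tau>0$ the time step. For a sequence $\psi=(\psi^\ell)_{\ell\in\mathbb{Z}}$, put $(\Delta_h\psi)^\ell=\dfrac{\psi^{\ell+1}+\psi^{\ell-1}-2\psi^\ell}{h^2}$ and $N_h(\psi)=h\sum_{j\in\mathbb{Z}}|\psi^j|^2$ (the square of the discrete $L^2$ norm). The discrete function space is $V_{h,K}=\{(\psi^j)_{j\in\mathbb{Z}} : \psi^j=\psi^{-j}\ \text{for all } j,\ \psi^j=0 \text{ for } |j|>K\}$. The embedding $i_h:V_{h,K}\to H^1(\mathbb{R})$ is $(i_h\psi)(x)=\sum_{j\in\mathbb{Z}}\psi^j\,s\!\left(\frac{x}{h}-j\right)$, where $s(x)=\max(1-|x|,0)$ is the hat function (piecewise linear interpolation). The continuous ground state is $\eta(x)=\frac12\,\mathrm{sech}(x/2)$, the unique real symmetric minimizer in $H^1(\mathbb{R})$ of $\frac14\int_{\mathbb{R}}(|\partial_x\psi|^2-|\psi|^4)\,dx$ under $\|\psi\|_{L^2}=1$. The norm is $\|\phi\|_{H^1}^2=\|\phi\|_{L^2}^2+\|\partial_x\phi\|_{L^2}^2$. *)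

theory Defs
  imports "HOL-Analysis.Analysis"
begin

definition L2 :: "(real \<Rightarrow> complex) set" where
  "L2 = {f. f \<in> borel_measurable lborel \<and> integrable lborel (\<lambda>x. (cmod (f x))\<^sup>2)}"

definition L2_norm :: "(real \<Rightarrow> complex) \<Rightarrow> real" where
  "L2_norm f = sqrt (LINT x|lborel. (cmod (f x))\<^sup>2)"

text \<open>Test functions are taken to be compactly supported and of class \<open>C\<^sup>1\<close>, as in Brezis'
  treatment of Sobolev spaces in dimension one.\<close>

definition test_fun :: "(real \<Rightarrow> real) \<Rightarrow> bool" where
  "test_fun \<phi> \<longleftrightarrow> \<phi> C1_differentiable_on UNIV \<and> compact (closure {x. \<phi> x \<noteq> 0})"

definition weak_deriv :: "(real \<Rightarrow> complex) \<Rightarrow> (real \<Rightarrow> complex) \<Rightarrow> bool" where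
  "weak_deriv f g \<longleftrightarrow> (\<forall>\<phi>. test_fun \<phi> \<longrightarrow>
     (LINT x|lborel. deriv \<phi> x *\<^sub>R f x) = - (LINT x|lborel. \<phi> x *\<^sub>R g x))"

definition H1 :: "(real \<Rightarrow> complex) set" where
  "H1 = {f \<in> L2. \<exists>g \<in> L2. weak_deriv f g}"

text \<open>The norm is only meaningful on \<open>H1\<close>. The weak derivative is determined up to a null set,
  which does not affect its \<open>L2\<close> norm.\<close>

definition H1_norm :: "(real \<Rightarrow> complex) \<Rightarrow> real" where
  "H1_norm f = sqrt ((L2_norm f)\<^sup>2 + (L2_norm (SOME g. g \<in> L2 \<and> weak_deriv f g))\<^sup>2)"

definition ground_state :: "real \<Rightarrow> complex" where
  "ground_state x = of_real (1 / 2 * (1 / cosh (x / 2)))"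

definition discrete_laplacian :: "real \<Rightarrow> (int \<Rightarrow> complex) \<Rightarrow> int \<Rightarrow> complex" where
  "discrete_laplacian h \<psi> l = (\<psi> (l + 1) + \<psi> (l - 1) - 2 * \<psi> l) / of_real (h\<^sup>2)"

text \<open>The square of the discrete \<open>L2\<close> norm.\<close>

definition discrete_mass :: "real \<Rightarrow> (int \<Rightarrow> complex) \<Rightarrow> real" where
  "discrete_mass h \<psi> = h * (\<Sum>\<^sub>\<infinity>j. (cmod (\<psi> j))\<^sup>2)"

definition discrete_space :: "nat \<Rightarrow> (int \<Rightarrow> complex) set" where
  "discrete_space K = {\<psi>. (\<forall>j. \<psi> j = \<psi> (- j)) \<and> (\<forall>j. \<bar>j\<bar> > int K \<longrightarrow> \<psi> j = 0)}"

definition hat :: "real \<Rightarrow> real" where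
  "hat x = max (1 - \<bar>x\<bar>) 0"

definition interpolant :: "real \<Rightarrow> (int \<Rightarrow> complex) \<Rightarrow> real \<Rightarrow> complex" where
  "interpolant h \<psi> x = (\<Sum>\<^sub>\<infinity>j. \<psi> j * of_real (hat (x / h - of_int j)))"

text \<open>\<open>\<psi> n\<close> are the iterates and \<open>\<psi>s n\<close> the intermediate states (starred in the usual
  notation). The condition that the mass is nonzero says that the normalization step is a
  genuine division.\<close>

definition gradient_scheme ::
  "real \<Rightarrow> nat \<Rightarrow> real \<Rightarrow> (int \<Rightarrow> complex) \<Rightarrow> (nat \<Rightarrow> int \<Rightarrow> complex) \<Rightarrow> (nat \<Rightarrow> int \<Rightarrow> complex) \<Rightarrow> bool"
where
  "gradient_scheme h K \<tau> \<psi>0 \<psi> \<psi>s \<longleftrightarrow>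
     \<psi> 0 = \<psi>0 \<and>
     (\<forall>n.
       (\<forall>l. \<bar>l\<bar> \<le> int K \<longrightarrow>
          \<psi>s n l = \<psi> n l + of_real \<tau> *
            (1 / 2 * discrete_laplacian h (\<psi>s n) l + of_real ((cmod (\<psi> n l))\<^sup>2) * \<psi>s n l)) \<and>
       (\<forall>l. \<bar>l\<bar> \<ge> int K + 1 \<longrightarrow> \<psi>s n l = 0) \<and>
       discrete_mass h (\<psi>s n) \<noteq> 0 \<and>
       (\<forall>l. \<psi> (Suc n) l = \<psi>s n l / of_real (sqrt (discrete_mass h (\<psi>s n)))))"

end

theory Submission
  imports Defs
begin

text \<open>For a function \<open>v\<close> of unit mass let \<open>m(x)\<close> be the mass to the left of \<open>x\<close>, minus \<open>1/2\<close>. Since \<open>m' = v\<^sup>2\<close>, the energy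
  is a complete square up to a constant: \<open>\<integral>v'\<^sup>2 - \<integral>v\<^sup>4 + 1/12 = \<integral>(v' + m v)\<^sup>2\<close>, and the ground state is the even solution
  of \<open>v' = - m v\<close>. If the square is small, then \<open>v\<^sup>2 + m\<^sup>2\<close> is nearly conserved, \<open>m\<close> nearly solves a Riccati equation
  with the stable solution \<open>tanh (x/2) / 2\<close>, and \<open>v\<close> is \<open>H\<^sup>1\<close>-close to the ground state. So the energy excess
  controls the squared distance, and the same argument works on the grid with errors of order \<open>h\<^sup>2\<close>.

  One step of the scheme is an inverse iteration for \<open>A - |\<psi>\<^sub>n|\<^sup>2\<close>, which decreases the Rayleigh quotient; by concavity
  of \<open>- \<integral>\<rho>\<^sup>2\<close> in the density it decreases the energy, by at least \<open>|z|\<^sup>2/\<tau>\<close>, where \<open>z\<close> is the component of the old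
  iterate orthogonal to the new one. Testing the equation for the new iterate with its distance to the ground
  state, and using coercivity again, bounds the energy excess by a multiple of \<open>|z|\<^sup>2/\<tau>\<^sup>2 + h\<^sup>2\<close>. Hence the excess decays
  geometrically down to the size \<open>h\<^sup>2\<close>.\<close>

section \<open>Even grid functions\<close>

text \<open>The constants must not depend on \<open>h\<close>, \<open>K\<close> or \<tau>. The
  completed square supplies this: it gives coercivity with an explicit number, without linearization
  and without the spectral gap of a discrete operator. The two estimates for a step scale as
  |z|^2/\<tau> and |z|^2/\<tau>^2; their quotient is a contraction factor 1 + c \<tau> for the
  energy excess, so the rate is uniform in \<tau>. As the excess controls a squared distance, a
  remainder of order h^2 in the energy is one of order h in the norm, the order of the interpolation
  error. The energy does not distinguish a state from its negative, so the sign at the origin is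
  carried along. The cut-off enters only through exp (- h K / 4) \<le> h^4, which keeps all boundary
  terms below the discretization errors. Radii as tiny as 10^-24 serve to absorb terms of higher
  order despite a large coercivity constant. A separate issue: \<open>H1_norm\<close> takes some
  weak derivative by choice, so uniqueness almost everywhere is needed before any norm can be
  evaluated.\<close>

text \<open>An even sequence is represented by its values at the indices \<open>j \<ge> 0\<close>; the weight counts \<open>j\<close> and \<open>-j\<close>.
  Sums of squared differences over \<open>j \<ge> 0\<close> are half of those over the whole grid, so \<open>dform u u\<close> below
  corresponds to \<open>1/2 \<integral>u'\<^sup>2\<close> and \<open>half_lap\<close> to \<open>- 1/2 \<Delta>\<^sub>h\<close>.\<close>

definition weight :: "nat \<Rightarrow> real" where
  "weight j = (if j = 0 then 1 else 2)"

lemma weight_ge_1: "weight j \<ge> 1" and weight_le_2: "weight j \<le> 2"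
  by (auto simp: weight_def)

locale grid =
  fixes h :: real and K :: nat
  assumes h_pos: "0 < h" and h_le: "h \<le> 1/2"
begin

definition S :: "(nat \<Rightarrow> real) \<Rightarrow> real" where
  "S g = h * (\<Sum>j\<le>K. weight j * g j)"

definition dform :: "(nat \<Rightarrow> real) \<Rightarrow> (nat \<Rightarrow> real) \<Rightarrow> real" where
  "dform u v = (\<Sum>j\<le>K. (u (Suc j) - u j) * (v (Suc j) - v j)) / h"

definition half_lap :: "(nat \<Rightarrow> real) \<Rightarrow> nat \<Rightarrow> real" where
  "half_lap u j = (if j = 0 then (u 0 - u 1) / h\<^sup>2 else (2 * u j - u (j - 1) - u (Suc j)) / (2 * h\<^sup>2))"

definition supported :: "(nat \<Rightarrow> real) \<Rightarrow> bool" where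
  "supported u \<longleftrightarrow> (\<forall>j>K. u j = 0)"

lemma h_nonneg: "0 \<le> h" using h_pos by simp

lemma S_add: "S (\<lambda>j. f j + g j) = S f + S g"
  by (simp add: S_def sum.distrib algebra_simps)
lemma S_diff: "S (\<lambda>j. f j - g j) = S f - S g"
  by (simp add: S_def sum_subtractf algebra_simps)
lemma S_cmult: "S (\<lambda>j. c * f j) = c * S f"
  by (simp add: S_def sum_distrib_left algebra_simps)
lemma S_mono: "(\<And>j. j \<le> K \<Longrightarrow> f j \<le> g j) \<Longrightarrow> S f \<le> S g"
  unfolding S_def using h_pos weight_ge_1
  by (intro mult_left_mono sum_mono) (auto intro!: mult_left_mono order.trans[OF zero_le_one])

lemma S_cong: "(\<And>j. j \<le> K \<Longrightarrow> f j = g j) \<Longrightarrow> S f = S g"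
  unfolding S_def by simp

lemma S_nonneg: "(\<And>j. j \<le> K \<Longrightarrow> 0 \<le> f j) \<Longrightarrow> 0 \<le> S f"
  using S_mono[of "\<lambda>_. 0" f] by (simp add: S_def)

lemma S_Cauchy_Schwarz: "(S (\<lambda>j. u j * v j))\<^sup>2 \<le> S (\<lambda>j. (u j)\<^sup>2) * S (\<lambda>j. (v j)\<^sup>2)"
proof -
  have *: "weight j * (x * y) = (sqrt (weight j) * x) * (sqrt (weight j) * y)"
       "weight j * x\<^sup>2 = (sqrt (weight j) * x)\<^sup>2" for j x y
    using weight_ge_1[of j] by (auto simp: power_mult_distrib algebra_simps simp flip: power2_eq_square)
  have "(\<Sum>j\<le>K. weight j * (u j * v j))\<^sup>2
      \<le> (\<Sum>j\<le>K. weight j * (u j)\<^sup>2) * (\<Sum>j\<le>K. weight j * (v j)\<^sup>2)"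
    unfolding * by (rule Cauchy_Schwarz_ineq_sum)
  then show ?thesis
    unfolding S_def using h_pos
    by (simp add: power_mult_distrib power2_eq_square algebra_simps)
qed

lemma S_Cauchy_Schwarz_sqrt:
  "\<bar>S (\<lambda>j. u j * v j)\<bar> \<le> sqrt (S (\<lambda>j. (u j)\<^sup>2)) * sqrt (S (\<lambda>j. (v j)\<^sup>2))"
  using real_sqrt_le_mono[OF S_Cauchy_Schwarz[of u v]] by (simp add: real_sqrt_mult)

lemma dform_sym: "dform u v = dform v u"
  by (simp add: dform_def mult.commute)
lemma dform_add: "dform (\<lambda>j. u j + v j) w = dform u w + dform v w"
  by (simp add: dform_def add_divide_distrib[symmetric] sum.distrib[symmetric] algebra_simps)
lemma dform_cmult: "dform (\<lambda>j. c * u j) w = c * dform u w"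
  by (simp add: dform_def sum_distrib_left algebra_simps)
lemma dform_diff: "dform (\<lambda>j. u j - v j) w = dform u w - dform v w"
  by (simp add: dform_def diff_divide_distrib[symmetric] sum_subtractf[symmetric] algebra_simps)
lemma dform_add2: "dform w (\<lambda>j. u j + v j) = dform w u + dform w v"
  using dform_add dform_sym by metis
lemma dform_nonneg: "0 \<le> dform u u"
  using h_pos by (auto simp: dform_def intro!: sum_nonneg divide_nonneg_nonneg)

lemma dform_Cauchy_Schwarz: "(dform u v)\<^sup>2 \<le> dform u u * dform v v"
  using Cauchy_Schwarz_ineq_sum[of "\<lambda>j. u (Suc j) - u j" "\<lambda>j. v (Suc j) - v j" "{..K}"] h_pos
  unfolding dform_def by (simp add: power_divide power2_eq_square[symmetric] divide_right_mono)

text \<open>Stated for any upper limit, with the boundary term at \<open>Suc n\<close>, so that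
  induction applies; the term vanishes once \<open>v (Suc n) = 0\<close>. The origin contributes no
  boundary term, since evenness (the value at -1 equals that at 1) is built into
  \<open>half_lap u 0\<close> and \<open>weight 0\<close>.\<close>

lemma summation_by_parts:
  "h * (\<Sum>j\<le>n. weight j * (half_lap u j * v j))
     = (\<Sum>j\<le>n. (u (Suc j) - u j) * (v (Suc j) - v j)) / h - (u (Suc n) - u n) * v (Suc n) / h"
proof (induction n)
  case 0
  show ?case using h_pos by (simp add: weight_def half_lap_def field_simps power2_eq_square)
next
  case (Suc n)
  have "h * (weight (Suc n) * (half_lap u (Suc n) * v (Suc n)))
     = (u (Suc (Suc n)) - u (Suc n)) * (v (Suc (Suc n)) - v (Suc n)) / h
       - (u (Suc (Suc n)) - u (Suc n)) * v (Suc (Suc n)) / h + (u (Suc n) - u n) * v (Suc n) / h"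
    using h_pos by (simp add: weight_def half_lap_def field_simps power2_eq_square)
  moreover have "A + c = B + p - q" if "c = p - q + r" "A = B - r" for A B c p q r :: real
    using that by simp
  ultimately show ?case using Suc.IH
    unfolding sum.atMost_Suc distrib_left add_divide_distrib by blast
qed

lemma S_half_lap: "v (Suc K) = 0 \<Longrightarrow> S (\<lambda>j. half_lap u j * v j) = dform u v"
  unfolding S_def dform_def using summation_by_parts[of u v K] by simp

lemma sum_sq_pairs: "(\<Sum>j\<le>n. (v j)\<^sup>2 + (v (Suc j))\<^sup>2) = (\<Sum>j\<le>n. weight j * (v j)\<^sup>2) + (v (Suc n))\<^sup>2"
  by (induction n) (auto simp: weight_def algebra_simps)

text \<open>Discrete form of v(x)^2 \<le> 2 \<integral> |v v'| \<le> \<integral> (v'^2 + v^2) over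
  the half line beyond x. An integral over the positive half line is half of the one over the line,
  which is \<open>dform v v\<close> for the first term and half of \<open>S\<close> for the
  second.\<close>

lemma sup_bound:
  assumes "v (Suc K) = 0" "j \<le> K"
  shows "(v j)\<^sup>2 \<le> dform v v + S (\<lambda>j. (v j)\<^sup>2) / 2"
proof -
  have tele: "(v j)\<^sup>2 - (v (Suc K))\<^sup>2 = (\<Sum>i=j..K. (v i)\<^sup>2 - (v (Suc i))\<^sup>2)"
    using assms(2) sum_Suc_diff[of j K "\<lambda>i. - (v i)\<^sup>2"] by (simp add: algebra_simps)
  have le: "(v i)\<^sup>2 - (v (Suc i))\<^sup>2 \<le> (v (Suc i) - v i)\<^sup>2 / h + h / 2 * ((v i)\<^sup>2 + (v (Suc i))\<^sup>2)" for i
  proof -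
    let ?x = "v (Suc i) - v i" and ?y = "v (Suc i) + v i"
    have "0 \<le> (?x + h/2 * ?y)\<^sup>2 / h" using h_pos by simp
    also have "\<dots> = ?x\<^sup>2 / h + ?x * ?y + h/4 * ?y\<^sup>2"
      using h_pos by (simp add: field_simps power2_eq_square)
    finally have 1: "- (?x * ?y) \<le> ?x\<^sup>2 / h + h/4 * ?y\<^sup>2" by simp
    have "?y\<^sup>2 \<le> 2 * ((v i)\<^sup>2 + (v (Suc i))\<^sup>2)"
      using zero_le_power2[of ?x] by (simp add: power2_eq_square algebra_simps)
    then have "h/4 * ?y\<^sup>2 \<le> h/4 * (2 * ((v i)\<^sup>2 + (v (Suc i))\<^sup>2))"
      using h_pos by (intro mult_left_mono) auto
    then show ?thesis using 1 by (simp add: power2_eq_square algebra_simps)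
  qed
  have "(v j)\<^sup>2 = (\<Sum>i=j..K. (v i)\<^sup>2 - (v (Suc i))\<^sup>2)" using tele assms(1) by simp
  also have "\<dots> \<le> (\<Sum>i=j..K. (v (Suc i) - v i)\<^sup>2 / h + h / 2 * ((v i)\<^sup>2 + (v (Suc i))\<^sup>2))"
    by (intro sum_mono le)
  also have "\<dots> \<le> (\<Sum>i\<le>K. (v (Suc i) - v i)\<^sup>2 / h + h / 2 * ((v i)\<^sup>2 + (v (Suc i))\<^sup>2))"
    using h_pos by (intro sum_mono2) auto
  also have "\<dots> = dform v v + h / 2 * (\<Sum>j\<le>K. (v j)\<^sup>2 + (v (Suc j))\<^sup>2)"
    unfolding dform_def sum.distrib sum_divide_distrib[symmetric] sum_distrib_left[symmetric]
    by (simp add: power2_eq_square)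
  also have "\<dots> = dform v v + S (\<lambda>j. (v j)\<^sup>2) / 2"
    unfolding sum_sq_pairs using assms(1) by (simp add: S_def)
  finally show ?thesis .
qed

section \<open>Energy, cumulative mass and the completed square on the grid\<close>

definition energy :: "(nat \<Rightarrow> real) \<Rightarrow> real" where
  "energy u = dform u u - S (\<lambda>j. (u j)^4) / 2"

text \<open>Mass between the origin and the point j + 1/2; the node 0 counts half because its cell
  is cut by the origin. For an even profile of unit mass this is the mass to the left of j + 1/2,
  minus 1/2.\<close>

primrec cmass :: "(nat \<Rightarrow> real) \<Rightarrow> nat \<Rightarrow> real" where
  "cmass u 0 = h * (u 0)\<^sup>2 / 2"
| "cmass u (Suc j) = cmass u j + h * (u (Suc j))\<^sup>2"

definition defect :: "(nat \<Rightarrow> real) \<Rightarrow> nat \<Rightarrow> real" where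
  "defect u j = (u (Suc j) - u j) / h + cmass u j * ((u (Suc j) + u j) / 2)"

lemma cmass_nonneg: "0 \<le> cmass u j"
  using h_pos by (induction j) auto

lemma cmass_mono: "i \<le> j \<Longrightarrow> cmass u i \<le> cmass u j"
  using h_pos by (induction j) (auto simp: le_Suc_eq intro: order.trans)

lemma cmass_sum: "2 * cmass u n = h * (\<Sum>j\<le>n. weight j * (u j)\<^sup>2)"
  by (induction n) (auto simp: weight_def algebra_simps)

lemma cmass_K: "cmass u K = S (\<lambda>j. (u j)\<^sup>2) / 2"
  using cmass_sum[of u K] by (simp add: S_def)

text \<open>When the square is expanded, the cross term combines with the increments of
  \<open>cmass\<close> into the quartic sum, and the terms m^2 u^2 form a trapezoidal sum for 2/3
  m^3. For unit mass the latter ends at 2/3 (1/2)^3 = 1/12, the constant in the energy excess. The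
  terms with \<open>(cmass u 0)^3\<close>, with \<open>(h * (u j)^2)^3\<close> and with the squared
  differences are pure discretization errors.\<close>

lemma defect_identity_aux:
  "2 * h * (\<Sum>j\<le>n. (defect u j)\<^sup>2) = 2 / h * (\<Sum>j\<le>n. (u (Suc j) - u j)\<^sup>2)
     - h * (\<Sum>j\<le>n. weight j * (u j)^4) + 2 * cmass u n * (u (Suc n))\<^sup>2 + h * (cmass u n)\<^sup>2 * (u (Suc n))\<^sup>2
     + 2/3 * (cmass u n)^3 + 4/3 * (cmass u 0)^3 + (\<Sum>j=1..n. (h * (u j)\<^sup>2)^3) / 3
     - h / 2 * (\<Sum>j\<le>n. (cmass u j)\<^sup>2 * (u (Suc j) - u j)\<^sup>2)"
proof -
  have sq: "2 * h * (defect u j)\<^sup>2 = 2 / h * (u (Suc j) - u j)\<^sup>2 + 2 * cmass u j * ((u (Suc j))\<^sup>2 - (u j)\<^sup>2)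
     + h * (cmass u j)\<^sup>2 * ((u (Suc j))\<^sup>2 + (u j)\<^sup>2) - h / 2 * ((cmass u j)\<^sup>2 * (u (Suc j) - u j)\<^sup>2)" for j
  proof -
    define a b m where "a = u (Suc j) - u j" and "b = u (Suc j) + u j" and "m = cmass u j"
    have "2 * h * (defect u j)\<^sup>2 = 2 * h * (a / h + m * (b / 2))\<^sup>2"
      by (simp add: defect_def a_def b_def m_def)
    also have "\<dots> = 2 / h * a\<^sup>2 + 2 * m * (a * b) + h * m\<^sup>2 * (b\<^sup>2 / 2)"
      using h_pos by (simp add: power2_eq_square field_simps)
    also have "a * b = (u (Suc j))\<^sup>2 - (u j)\<^sup>2"
      by (simp add: a_def b_def power2_eq_square algebra_simps)
    also have "b\<^sup>2 / 2 = (u (Suc j))\<^sup>2 + (u j)\<^sup>2 - a\<^sup>2 / 2"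
      by (simp add: a_def b_def power2_eq_square field_simps)
    finally show ?thesis by (simp add: a_def m_def algebra_simps)
  qed
  show ?thesis
  proof (induction n)
    case 0
    have m: "h * (u 0)\<^sup>2 = 2 * cmass u 0" by simp
    show ?case
    proof -
      have q: "h * (u 0)^4 = 2 * cmass u 0 * (u 0)\<^sup>2" using m by (simp add: power4_eq_xxxx power2_eq_square algebra_simps)
      have r: "h * (cmass u 0)\<^sup>2 * (u 0)\<^sup>2 = 2 * (cmass u 0)^3" unfolding power3_eq_cube power2_eq_square[of "cmass u 0"] using m by (metis mult.assoc mult.commute)
      show ?thesis using sq[of 0] q r by (simp add: weight_def algebra_simps del: cmass.simps)
    qed
  next
    case (Suc n)
    define m U V where "m = cmass u n" and "U = (u (Suc n))\<^sup>2" and "V = (u (Suc (Suc n)))\<^sup>2"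
    define m' where "m' = cmass u (Suc n)"
    have m': "m' = m + h * U" by (simp add: m'_def m_def U_def)
    have w: "h * (weight (Suc n) * (u (Suc n))^4) = 2 * h * U\<^sup>2"
      by (simp add: weight_def U_def)
    \<comment> \<open>The term \<open>(h * U)^3 / 3\<close> is the exact error of the trapezoidal
      rule, h U (m'^2 + m^2) - 2/3 (m'^3 - m^3), where m' - m = h U.\<close>
    have key: "2 * m' * (V - U) + h * m'\<^sup>2 * (V + U)
      = - (2 * h * U\<^sup>2) + (2 * m' * V - 2 * m * U) + (h * m'\<^sup>2 * V - h * m\<^sup>2 * U)
        + 2/3 * (m'^3 - m^3) + (h * U)^3 / 3"
      unfolding m' by (simp add: field_simps power2_eq_square power3_eq_cube)
    have c: "(\<Sum>j=1..Suc n. (h * (u j)\<^sup>2)^3) = (\<Sum>j=1..n. (h * (u j)\<^sup>2)^3) + (h * U)^3"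
      by (simp add: U_def)
    have IH: "2 * h * (\<Sum>j\<le>n. (defect u j)\<^sup>2) = 2 / h * (\<Sum>j\<le>n. (u (Suc j) - u j)\<^sup>2)
     - h * (\<Sum>j\<le>n. weight j * (u j)^4) + 2 * m * U + h * m\<^sup>2 * U
     + 2/3 * m^3 + 4/3 * (cmass u 0)^3 + (\<Sum>j=1..n. (h * (u j)\<^sup>2)^3) / 3
     - h / 2 * (\<Sum>j\<le>n. (cmass u j)\<^sup>2 * (u (Suc j) - u j)\<^sup>2)"
      using Suc.IH unfolding m_def U_def .
    have sq': "2 * h * (defect u (Suc n))\<^sup>2 = 2 / h * (u (Suc (Suc n)) - u (Suc n))\<^sup>2 + 2 * m' * (V - U)
     + h * m'\<^sup>2 * (V + U) - h / 2 * ((cmass u (Suc n))\<^sup>2 * (u (Suc (Suc n)) - u (Suc n))\<^sup>2)"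
      using sq[of "Suc n"] unfolding m'_def U_def V_def .
    have lin: "F + f = P + p - (W + ww) + v1 + v2 + 2/3 * c' + D + (Sg + g) / 3 - (T + t)"
      if "F = P - W + a1 + a2 + 2/3 * c + D + Sg / 3 - T" "f = p + k1 + k2 - t"
        "k1 + k2 = - w + (v1 - a1) + (v2 - a2) + 2/3 * (c' - c) + g / 3" "ww = w"
      for F f P p W ww w v1 v2 c c' D Sg g T t a1 a2 k1 k2 :: real
      using that by (simp add: field_simps)
    show ?case
      unfolding c sum.atMost_Suc distrib_left m'_def[symmetric] V_def[symmetric]
      by (rule lin[OF IH sq'[unfolded m'_def[symmetric]] key w])
  qed
qed
end

section \<open>The sampled ground state\<close>

lemma tanh_le_self: "0 \<le> y \<Longrightarrow> tanh y \<le> (y::real)"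
proof -
  assume y: "0 \<le> y"
  have "(\<lambda>t. t - tanh t) 0 \<le> (\<lambda>t. t - tanh t) y"
  proof (rule DERIV_nonneg_imp_nondecreasing[OF y])
    fix x :: real assume "0 \<le> x" "x \<le> y"
    have "((\<lambda>t. t - tanh t) has_real_derivative (1 - (1 - tanh x ^ 2))) (at x)"
      by (auto intro!: derivative_eq_intros)
    then show "\<exists>d. ((\<lambda>t. t - tanh t) has_real_derivative d) (at x) \<and> 0 \<le> d"
      by (intro exI[of _ "tanh x ^ 2"]) auto
  qed
  then show ?thesis by simp
qed

lemma sinh_le_mult_cosh: "0 \<le> y \<Longrightarrow> sinh y \<le> y * cosh (y::real)"
  using tanh_le_self[of y] by (simp add: tanh_def field_simps)

text \<open>From cosh y = 1 + 2 sinh (y/2)^2 and sinh t \<le> t cosh t; the bound cosh (y/2)^2 \<le>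
  2 that this needs follows from cosh 1 \<le> 3 by the double angle formula.\<close>

lemma cosh_le_quadratic:
  assumes "0 \<le> y" "y \<le> 1" shows "cosh (y::real) \<le> 1 + y\<^sup>2"
proof -
  have "exp (1::real) \<le> 3" by (rule exp_le)
  moreover have "exp (- (1::real)) \<le> 1" by simp
  ultimately have c1: "cosh (1::real) \<le> 3" unfolding cosh_field_def by (simp add: field_simps del: exp_le_one_iff)
  have "2 * (cosh (1/2::real))\<^sup>2 - 1 \<le> 3"
    using cosh_double_cosh[of "1/2::real"] c1 by simp
  moreover have "cosh (y/2) \<le> cosh (1/2)" using assms by (simp add: cosh_real_nonneg_le_iff)
  then have "(cosh (y/2))\<^sup>2 \<le> (cosh (1/2))\<^sup>2" by (intro power_mono) auto
  ultimately have c2: "(cosh (y/2))\<^sup>2 \<le> 2" by linarith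
  have "cosh y = 1 + 2 * (sinh (y/2))\<^sup>2"
    using cosh_double_cosh[of "y/2"] by (simp add: sinh_square_eq)
  also have "(sinh (y/2))\<^sup>2 \<le> (y/2 * cosh (y/2))\<^sup>2"
    using assms sinh_le_mult_cosh[of "y/2"] by (intro power_mono) auto
  also have "\<dots> \<le> (y/2)\<^sup>2 * 2"
    unfolding power_mult_distrib using c2 by (intro mult_left_mono) auto
  finally show ?thesis by (simp add: power2_eq_square)
qed

lemma sinh_ge_self: "0 \<le> y \<Longrightarrow> y \<le> sinh (y::real)"
  by (rule real_le_x_sinh[unfolded sinh_field_def[symmetric], THEN order.trans]) (auto simp: sinh_field_def exp_minus)

lemma sinh_le_cubic: "0 \<le> y \<Longrightarrow> y \<le> 1 \<Longrightarrow> sinh (y::real) \<le> y * (1 + y\<^sup>2)"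
  using sinh_le_mult_cosh[of y] cosh_le_quadratic[of y]
  by (meson mult_left_mono order.trans)

lemma cosh_ge_quadratic: "0 \<le> y \<Longrightarrow> 1 + y\<^sup>2 / 2 \<le> cosh (y::real)"
proof -
  assume y: "0 \<le> y"
  have "cosh y = 1 + 2 * (sinh (y/2))\<^sup>2"
    using cosh_double_cosh[of "y/2"] by (simp add: sinh_square_eq)
  moreover have "(y/2)\<^sup>2 \<le> (sinh (y/2))\<^sup>2" using sinh_ge_self[of "y/2"] y by (intro power_mono) auto
  ultimately show ?thesis by (simp add: power2_eq_square)
qed

lemma tanh_ge_cubic:
  assumes "0 \<le> y" "y \<le> 1" shows "y * (1 - y\<^sup>2) \<le> tanh (y::real)"
proof -
  have "y * (1 - y\<^sup>2) * cosh y \<le> y * (1 - y\<^sup>2) * (1 + y\<^sup>2)"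
    using assms cosh_le_quadratic[of y] by (intro mult_left_mono mult_nonneg_nonneg) (auto simp: power_le_one)
  also have "\<dots> = y * (1 - (y\<^sup>2)\<^sup>2)" by (simp add: algebra_simps power2_eq_square)
  also have "\<dots> \<le> y * 1" using assms by (intro mult_left_mono) auto
  also have "\<dots> \<le> sinh y" using sinh_ge_self assms by simp
  finally show ?thesis by (simp add: tanh_def pos_le_divide_eq)
qed

lemma tanh_diff_identity:
  "tanh x - tanh y = tanh (x - y) * (1 - tanh x * tanh (y::real))"
proof -
  have "cosh (x - y) * (tanh x - tanh y) = sinh (x - y) * (1 - tanh x * tanh y)"
  proof -
    have "cosh x * cosh y * (tanh x - tanh y) = sinh (x - y)"
      by (simp add: sinh_diff tanh_def field_simps)
    moreover have "cosh x * cosh y * (1 - tanh x * tanh y) = cosh (x - y)"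
      by (simp add: cosh_diff tanh_def field_simps)
    ultimately have "cosh (x - y) * (cosh x * cosh y * (tanh x - tanh y))
        = sinh (x - y) * (cosh x * cosh y * (1 - tanh x * tanh y))" by simp
    then have "(cosh x * cosh y) * (cosh (x - y) * (tanh x - tanh y))
        = (cosh x * cosh y) * (sinh (x - y) * (1 - tanh x * tanh y))"
      by (simp only: mult.assoc mult.left_commute)
    then show ?thesis by (subst (asm) mult_cancel_left) simp
  qed
  then show ?thesis by (simp add: tanh_def[of "x - y"] field_simps)
qed

lemma sech_diff_identity:
  "1 / cosh (x + b) - 1 / cosh (x - b) = - tanh b * tanh x * (1 / cosh (x + b) + 1 / cosh (x - b :: real))"
proof -
  have "cosh (x - b) - cosh (x + b) = - tanh b * tanh x * (cosh (x - b) + cosh (x + b))"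
    by (simp add: cosh_add cosh_diff tanh_def field_simps)
  then show ?thesis by (simp add: field_simps)
qed

lemma cosh_mult_cosh: "cosh (x + b) * cosh (x - b) = (cosh x)\<^sup>2 + (sinh (b::real))\<^sup>2"
proof -
  have "cosh (x + b) * cosh (x - b) = (cosh x)\<^sup>2 * (cosh b)\<^sup>2 - (sinh x)\<^sup>2 * (sinh b)\<^sup>2"
    by (simp add: cosh_add cosh_diff algebra_simps power2_eq_square)
  also have "\<dots> = (cosh x)\<^sup>2 + (sinh b)\<^sup>2"
    by (simp add: cosh_square_eq algebra_simps)
  finally show ?thesis .
qed

lemma tanh_diff_cosh: "tanh (x + b) - tanh (x - b) = sinh (2 * b) / ((cosh x)\<^sup>2 + (sinh (b::real))\<^sup>2)"
proof -
  have "tanh (x + b) - tanh (x - b) = sinh ((x + b) - (x - b)) / (cosh (x + b) * cosh (x - b))"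
    unfolding sinh_diff[of "x + b" "x - b"] tanh_def by (simp add: diff_frac_eq)
  also have "(x + b) - (x - b) = 2 * b" by simp
  finally show ?thesis unfolding cosh_mult_cosh .
qed

lemma tanh_diff_bounds:
  assumes "0 \<le> b"
  shows "2 * tanh b / (cosh x)\<^sup>2 \<le> tanh (x + b) - tanh (x - b)"
    and "tanh (x + b) - tanh (x - b) \<le> sinh (2 * b) / (cosh (x::real))\<^sup>2"
proof -
  have c: "1 \<le> (cosh x)\<^sup>2" by (simp add: cosh_real_ge_1)
  have "(cosh x)\<^sup>2 + (sinh b)\<^sup>2 \<le> (cosh x)\<^sup>2 * (cosh b)\<^sup>2"
    using mult_right_mono[OF c, of "(sinh b)\<^sup>2"] by (simp add: cosh_square_eq[of b] algebra_simps)
  then have "sinh (2 * b) / ((cosh x)\<^sup>2 * (cosh b)\<^sup>2) \<le> sinh (2 * b) / ((cosh x)\<^sup>2 + (sinh b)\<^sup>2)"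
    using assms c by (intro divide_left_mono) (auto intro!: mult_pos_pos add_pos_nonneg)
  moreover have "sinh (2 * b) / ((cosh x)\<^sup>2 * (cosh b)\<^sup>2) = 2 * tanh b / (cosh x)\<^sup>2"
    by (simp add: sinh_double tanh_def power2_eq_square)
  ultimately show "2 * tanh b / (cosh x)\<^sup>2 \<le> tanh (x + b) - tanh (x - b)"
    unfolding tanh_diff_cosh by simp
  show "tanh (x + b) - tanh (x - b) \<le> sinh (2 * b) / (cosh x)\<^sup>2"
    unfolding tanh_diff_cosh using assms c by (intro divide_left_mono) (auto intro!: mult_pos_pos add_pos_nonneg)
qed

text \<open>A closed form from the addition theorems replaces a Taylor remainder with fourth
  derivatives. The common factor s survives, so the error below decays like the profile
  itself.\<close>

lemma sech_second_difference:
  fixes x a :: real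
  defines "s \<equiv> 1 / cosh x"
  shows "1 / cosh (x + a) + 1 / cosh (x - a) - 2 * s
     = 2 * s * ((cosh a - 1) - s\<^sup>2 * (sinh a)\<^sup>2) / (1 + s\<^sup>2 * (sinh a)\<^sup>2)"
proof -
  have pos: "0 < (cosh x)\<^sup>2 + (sinh a)\<^sup>2" by (simp add: add_pos_nonneg)
  have "1 / cosh (x + a) + 1 / cosh (x - a) = (cosh (x - a) + cosh (x + a)) / (cosh (x + a) * cosh (x - a))"
    by (simp add: field_simps)
  also have "\<dots> = 2 * cosh x * cosh a / ((cosh x)\<^sup>2 + (sinh a)\<^sup>2)"
    unfolding cosh_mult_cosh by (simp add: cosh_add cosh_diff)
  finally have 1: "1 / cosh (x + a) + 1 / cosh (x - a) - 2 * s
     = 2 * (cosh x * cosh a / ((cosh x)\<^sup>2 + (sinh a)\<^sup>2) - 1 / cosh x)"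
    by (simp add: s_def)
  have 2: "1 + s\<^sup>2 * (sinh a)\<^sup>2 = ((cosh x)\<^sup>2 + (sinh a)\<^sup>2) / (cosh x)\<^sup>2"
    by (simp add: s_def field_simps)
  show ?thesis unfolding 1 2 using pos unfolding s_def
    by (simp add: divide_simps) (simp add: power2_eq_square algebra_simps)
qed

text \<open>The function s = sech solves s'' = s - 2 s^3. A step h/2 in its argument turns the
  quotient into an approximation of - s''/8 = s^3/4 - s/8. The factor s on the right makes the error
  square summable on the grid.\<close>

lemma sech_discrete_residual:
  fixes x h :: real
  assumes h: "0 < h" "h \<le> 1/2"
  defines "s \<equiv> 1 / cosh x"
  shows "\<bar>(2 * s - 1 / cosh (x + h/2) - 1 / cosh (x - h/2)) / (2 * h\<^sup>2) - s^3 / 4 + s / 8\<bar> \<le> h\<^sup>2 * s"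
proof -
  define a where "a = h / 2"
  \<comment> \<open>As h tends to 0, \<alpha> and \<beta> tend to 1/8 and 1/4; \<open>q\<close> is
    the relative perturbation of the denominator. All three deviations are of order h^2.\<close>
  define \<alpha> where "\<alpha> = (cosh a - 1) / h\<^sup>2"
  define \<beta> where "\<beta> = (sinh a)\<^sup>2 / h\<^sup>2"
  define q where "q = s\<^sup>2 * \<beta> * h\<^sup>2"
  have a: "0 < a" "a \<le> 1" "a\<^sup>2 = h\<^sup>2 / 4" using h by (auto simp: a_def power2_eq_square)
  have s: "0 < s" "s \<le> 1" using cosh_real_ge_1[of x] by (auto simp: s_def divide_simps)
  have s2: "0 \<le> s\<^sup>2" "s\<^sup>2 \<le> 1" using s by (auto simp: power_le_one)
  have h2: "h\<^sup>2 \<le> 1/4" using power_mono[of h "1/2" 2] h by (simp add: power2_eq_square)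
  have h2': "0 < h\<^sup>2" using h by simp
  have "a \<le> sinh a" using a sinh_ge_self by simp
  then have sl: "a\<^sup>2 \<le> (sinh a)\<^sup>2" using a by (intro power_mono) auto
  have "sinh a \<le> a * (1 + a\<^sup>2)" using sinh_le_cubic[of a] a(1,2) by simp
  then have "(sinh a)\<^sup>2 \<le> (a * (1 + a\<^sup>2))\<^sup>2" using a(1) by (intro power_mono) auto
  also have "\<dots> = a\<^sup>2 * (1 + 2 * a\<^sup>2 + a\<^sup>2 * a\<^sup>2)" by (simp add: power2_eq_square algebra_simps)
  also have "\<dots> \<le> a\<^sup>2 * (1 + 3 * a\<^sup>2)"
    using a mult_mono[of "a\<^sup>2" 1 "a\<^sup>2" "a\<^sup>2"] by (intro mult_left_mono) (auto simp: power_le_one)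
  finally have su: "(sinh a)\<^sup>2 \<le> a\<^sup>2 * (1 + 3 * a\<^sup>2)" .
  have \<beta>: "1/4 \<le> \<beta>" "\<beta> \<le> 1/4 + 3/16 * h\<^sup>2"
    using sl su h2' unfolding \<beta>_def a by (auto simp: divide_simps) (simp add: algebra_simps)
  have ch: "cosh a - 1 = 2 * (sinh (a/2))\<^sup>2"
    using cosh_double_cosh[of "a/2"] by (simp add: sinh_square_eq)
  have "sinh (a/2) \<le> a/2 * (1 + (a/2)\<^sup>2)" using sinh_le_cubic[of "a/2"] a by simp
  then have "(sinh (a/2))\<^sup>2 \<le> (a/2 * (1 + (a/2)\<^sup>2))\<^sup>2" using a by (intro power_mono) auto
  also have "\<dots> = a\<^sup>2/4 * (1 + a\<^sup>2/2 + a\<^sup>2 * a\<^sup>2 / 16)" by (simp add: power2_eq_square field_simps)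
  also have "\<dots> \<le> a\<^sup>2/4 * (1 + a\<^sup>2)"
  proof -
    have "a\<^sup>2 * a\<^sup>2 \<le> 1 * a\<^sup>2" using a(1,2) by (intro mult_right_mono) (auto simp: power_le_one)
    then have "1 + a\<^sup>2/2 + a\<^sup>2 * a\<^sup>2 / 16 \<le> 1 + a\<^sup>2" using zero_le_power2[of a] by linarith
    then show ?thesis by (intro mult_left_mono) auto
  qed
  finally have "cosh a - 1 \<le> a\<^sup>2/2 * (1 + a\<^sup>2)" unfolding ch by simp
  moreover have "a\<^sup>2/2 \<le> cosh a - 1" using cosh_ge_quadratic[of a] a by simp
  ultimately have \<alpha>: "1/8 \<le> \<alpha>" "\<alpha> \<le> 1/8 + h\<^sup>2 / 32"
    using h2' unfolding \<alpha>_def a by (auto simp: divide_simps) (simp add: algebra_simps)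
  have q0: "0 \<le> q" using \<beta> s2 by (simp add: q_def)
  have "q \<le> 1 * (1/4 + 3/16 * h\<^sup>2) * h\<^sup>2"
    unfolding q_def using \<beta> s2 h2' by (intro mult_mono) auto
  also have "\<dots> \<le> (1/3) * h\<^sup>2" using h2 by (intro mult_right_mono) auto
  finally have q1: "q \<le> h\<^sup>2 / 3" by simp
  have ca: "cosh a - 1 = \<alpha> * h\<^sup>2" "(sinh a)\<^sup>2 = \<beta> * h\<^sup>2" using h2' by (simp_all add: \<alpha>_def \<beta>_def)
  have "1 / cosh (x + a) + 1 / cosh (x - a) - 2 * s = 2 * s * h\<^sup>2 * (\<alpha> - s\<^sup>2 * \<beta>) / (1 + q)"
    using sech_second_difference[of x a, folded s_def] unfolding ca q_def by (simp add: algebra_simps)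
  then have lap: "(2 * s - 1 / cosh (x + a) - 1 / cosh (x - a)) / (2 * h\<^sup>2) = - s * ((\<alpha> - s\<^sup>2 * \<beta>) / (1 + q))"
    using h2' q0 by (simp add: divide_simps) (simp add: algebra_simps)
  define D where "D = \<alpha> - s\<^sup>2 * \<beta>"
  have sb: "s\<^sup>2 * (1/4) \<le> s\<^sup>2 * \<beta>" "s\<^sup>2 * \<beta> \<le> s\<^sup>2 * (1/4 + 3/16 * h\<^sup>2)"
    by (fact mult_left_mono[OF \<beta>(1) s2(1)], fact mult_left_mono[OF \<beta>(2) s2(1)])
  have "s\<^sup>2 * (3/16 * h\<^sup>2) \<le> 3/16 * h\<^sup>2" using s2 h2' mult_right_mono[of "s\<^sup>2" 1 "3/16 * h\<^sup>2"] by simp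
  then have D1: "\<bar>D - (1/8 - s\<^sup>2/4)\<bar> \<le> 3/16 * h\<^sup>2" 
  proof -
    have "s\<^sup>2 * (1/4 + 3/16 * h\<^sup>2) = s\<^sup>2 / 4 + s\<^sup>2 * (3/16 * h\<^sup>2)" by (simp add: algebra_simps)
    then show ?thesis
      unfolding D_def using sb \<alpha> h2' \<open>s\<^sup>2 * (3/16 * h\<^sup>2) \<le> 3/16 * h\<^sup>2\<close> by linarith
  qed
  have D2: "\<bar>D\<bar> \<le> 1" using D1 s2 h2 by linarith
  have "D / (1 + q) - D = - D * q / (1 + q)" using q0 by (simp add: field_simps)
  then have "\<bar>D / (1 + q) - D\<bar> = \<bar>D\<bar> * q / (1 + q)" using q0 by (simp add: abs_mult)
  also have "\<dots> \<le> \<bar>D\<bar> * q / 1" using q0 by (intro divide_left_mono) auto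
  also have "\<dots> \<le> 1 * (h\<^sup>2/3)" unfolding div_by_1 using D2 q0 q1 by (intro mult_mono) auto
  finally have "\<bar>D / (1 + q) - (1/8 - s\<^sup>2/4)\<bar> \<le> h\<^sup>2" using D1 h2' by linarith
  then have "s * \<bar>(1/8 - s\<^sup>2/4) - D / (1 + q)\<bar> \<le> s * h\<^sup>2"
    using s by (intro mult_left_mono) (auto simp: abs_minus_commute)
  then have *: "\<bar>s * ((1/8 - s\<^sup>2/4) - D / (1 + q))\<bar> \<le> h\<^sup>2 * s"
    using s by (simp add: abs_mult mult.commute)
  have "s * ((1/8 - s\<^sup>2/4) - D / (1 + q)) = - s * (D / (1 + q)) - s^3/4 + s/8"
    by (simp add: algebra_simps power2_eq_square power3_eq_cube)
  then show ?thesis using * lap by (simp add: D_def a_def)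
qed

section \<open>Exact difference relations for the sampled ground state\<close>

context grid
begin

definition sech_sample :: "nat \<Rightarrow> real" where
  "sech_sample j = 1 / (2 * cosh (real j * h / 2))"

definition soliton :: "nat \<Rightarrow> real" where
  "soliton j = (if j \<le> K then sech_sample j else 0)"

text \<open>The integral of the squared ground state from 0 to (j + 1/2) h, that is, the continuous
  counterpart of \<open>cmass\<close> at the same staggered point.\<close>

definition kink :: "nat \<Rightarrow> real" where
  "kink j = tanh ((real j + 1/2) * h / 2) / 2"

text \<open>Built with the exact mass \<open>kink\<close> and not with \<open>cmass soliton\<close>.
  It then has a closed form away from the cut-off, and the comparison with \<open>defect u\<close>
  isolates the mass difference \<open>cmass_error\<close>.\<close>

definition soliton_defect :: "nat \<Rightarrow> real" where
  "soliton_defect j = (soliton (Suc j) - soliton j) / h + kink j * ((soliton (Suc j) + soliton j) / 2)"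

text \<open>By the addition theorem for tanh the sequence \<open>kink\<close> solves the discrete
  Riccati equation exactly, but with this step in place of h. The two steps differ by order
  h^3.\<close>

definition kink_step :: real where "kink_step = 2 * tanh (h / 2)"

lemma kink_step_le: "kink_step \<le> h" using tanh_le_self[of "h/2"] h_pos by (simp add: kink_step_def)

lemma h_sq_le: "h\<^sup>2 \<le> 1/4" using power_mono[OF h_le h_nonneg, of 2] by (simp add: power2_eq_square)

lemma kink_step_ge: "h - h * (h\<^sup>2 / 4) \<le> kink_step"
  using tanh_ge_cubic[of "h/2"] h_pos h_le by (simp add: kink_step_def power2_eq_square algebra_simps)

lemma kink_step_ge_half: "h / 2 \<le> kink_step"
proof -
  have "h * (h\<^sup>2 / 4) \<le> h * (1/2)" using h_pos h_sq_le by (intro mult_left_mono) auto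
  then show ?thesis using kink_step_ge by simp
qed

lemma kink_nonneg: "0 \<le> kink j" using h_pos by (simp add: kink_def)
lemma kink_le_half: "kink j \<le> 1/2" using tanh_real_lt_1[of "(real j + 1/2) * h / 2"] by (simp add: kink_def)
lemma kink_mono: "kink j \<le> kink (Suc j)" using h_pos by (simp add: kink_def)

lemma kink_step: "kink (Suc j) - kink j = kink_step * (1/4 - kink (Suc j) * kink j)"
proof -
  have halve: "a / 2 - b / 2 = 2 * t * (1/4 - a / 2 * (b / 2))" if "a - b = t * (1 - a * b)" for a b t :: real
    using that by (simp add: field_simps)
  have "(real (Suc j) + 1/2) * h / 2 - (real j + 1/2) * h / 2 = h / 2" by (simp add: field_simps)
  then show ?thesis
    using tanh_diff_identity[of "(real (Suc j) + 1/2) * h / 2" "(real j + 1/2) * h / 2"]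
    unfolding kink_def kink_step_def using halve by metis
qed

text \<open>The addition theorem across the central cell, whose left end carries the mirrored value
  - \<open>kink 0\<close>.\<close>

lemma kink_0: "2 * kink 0 = kink_step * (1/4 + (kink 0)\<^sup>2)"
  using tanh_diff_identity[of "h/4" "- (h/4)"]
  by (simp add: kink_def kink_step_def power2_eq_square)

lemma tanh_quarter: "h / 4 * (1 - h\<^sup>2 / 16) \<le> tanh (h / 4)" "tanh (h / 4) \<le> h / 4"
  using tanh_ge_cubic[of "h/4"] tanh_le_self[of "h/4"] h_pos h_le
  by (simp_all add: power2_eq_square)

lemma kink_0_ge: "h / 12 \<le> kink 0"
proof -
  have "h / 4 * (2/3) \<le> h / 4 * (1 - h\<^sup>2 / 16)" using h_pos h_sq_le by (intro mult_left_mono) auto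
  moreover have "kink 0 = tanh (h / 4) / 2" by (simp add: kink_def)
  ultimately show ?thesis using tanh_quarter(1) by linarith
qed

lemma sech_sample_pos: "0 < sech_sample j" by (simp add: sech_sample_def)
lemma sech_sample_le_half: "sech_sample j \<le> 1/2" using cosh_real_ge_1[of "real j * h / 2"] by (simp add: sech_sample_def field_simps)
lemma sech_sample_0: "sech_sample 0 = 1/2" by (simp add: sech_sample_def)

lemma sech_sample_anti: "i \<le> j \<Longrightarrow> sech_sample j \<le> sech_sample i"
  using h_pos unfolding sech_sample_def
  by (intro divide_left_mono) (auto simp: cosh_real_nonneg_le_iff)

lemma sech_sample_le_exp: "sech_sample j \<le> exp (- (real j * h / 2))"
proof -
  have "exp (real j * h / 2) \<le> 2 * cosh (real j * h / 2)" by (simp add: cosh_field_def)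
  then have "inverse (2 * cosh (real j * h / 2)) \<le> inverse (exp (real j * h / 2))"
    by (intro le_imp_inverse_le) auto
  then show ?thesis by (simp add: sech_sample_def exp_minus inverse_eq_divide)
qed

text \<open>Exact discrete version of \<eta>' = - M \<eta>, in which 2 tanh (h/4) takes the place of
  h/2. Only this mismatch, a relative error of order h^2, remains as the defect of the
  samples.\<close>

lemma sech_sample_step: "sech_sample (Suc j) - sech_sample j = - 2 * tanh (h / 4) * kink j * (sech_sample (Suc j) + sech_sample j)"
proof -
  define x where "x = (real j + 1/2) * h / 2"
  have a: "real (Suc j) * h / 2 = x + h / 4" "real j * h / 2 = x - h / 4" by (simp_all add: x_def field_simps)
  have "sech_sample (Suc j) - sech_sample j = (1 / cosh (x + h/4) - 1 / cosh (x - h/4)) / 2"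
    unfolding sech_sample_def a by (simp add: diff_divide_distrib)
  also have "\<dots> = - tanh (h/4) * tanh x * (sech_sample (Suc j) + sech_sample j)"
    unfolding sech_diff_identity unfolding sech_sample_def a by (simp add: add_divide_distrib)
  finally show ?thesis by (simp add: kink_def x_def)
qed

lemma kink_diff_bounds:
  "4 * tanh (h / 4) * (sech_sample (Suc j))\<^sup>2 \<le> kink (Suc j) - kink j"
  "kink (Suc j) - kink j \<le> 2 * sinh (h / 2) * (sech_sample (Suc j))\<^sup>2"
proof -
  define x where "x = real (Suc j) * h / 2"
  have a: "(real (Suc j) + 1/2) * h / 2 = x + h / 4" "(real j + 1/2) * h / 2 = x - h / 4"
    by (simp_all add: x_def field_simps)
  have s: "(sech_sample (Suc j))\<^sup>2 = 1 / (cosh x)\<^sup>2 / 4"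
    by (simp add: sech_sample_def x_def power_divide power_mult_distrib)
  show "4 * tanh (h / 4) * (sech_sample (Suc j))\<^sup>2 \<le> kink (Suc j) - kink j"
    "kink (Suc j) - kink j \<le> 2 * sinh (h / 2) * (sech_sample (Suc j))\<^sup>2"
    unfolding kink_def a s using tanh_diff_bounds[of "h/4" x] h_pos by (auto simp: field_simps)
qed

lemma soliton_Suc_K: "soliton (Suc K) = 0" by (simp add: soliton_def)
lemma soliton_nonneg: "0 \<le> soliton j" using sech_sample_pos[of j] by (simp add: soliton_def)
lemma soliton_le_half: "soliton j \<le> 1/2" using sech_sample_le_half by (simp add: soliton_def)
lemma soliton_0: "soliton 0 = 1/2" by (simp add: soliton_def sech_sample_0)

text \<open>Compared increment by increment by means of \<open>kink_diff_bounds\<close>. Together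
  with \<open>cmass_soliton_ge\<close> this confines the quotient of summed and exact mass between h
  / (2 sinh (h/2)) and h / (4 tanh (h/4)), hence to 1 + O(h^2).\<close>

lemma cmass_soliton_le: "j \<le> K \<Longrightarrow> 4 * tanh (h / 4) * cmass soliton j \<le> h * kink j"
proof (induction j)
  case 0
  show ?case using h_pos by (simp add: soliton_0 kink_def power2_eq_square)
next
  case (Suc j)
  have "h * (4 * tanh (h / 4) * (soliton (Suc j))\<^sup>2) \<le> h * (kink (Suc j) - kink j)"
    using Suc.prems kink_diff_bounds(1)[of j] h_pos by (intro mult_left_mono) (auto simp: soliton_def)
  then show ?case using Suc by (simp add: algebra_simps)
qed

lemma cmass_soliton_ge: "j \<le> K \<Longrightarrow> h * kink j \<le> 2 * sinh (h / 2) * cmass soliton j"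
proof (induction j)
  case 0
  have "tanh (h / 4) \<le> h / 4" using tanh_quarter by simp
  also have "h / 4 \<le> sinh (h / 2) / 2" using sinh_ge_self[of "h/2"] h_pos by simp
  finally have "h * (tanh (h / 4) / 2) \<le> h * (sinh (h / 2) / 4)" using h_pos by (intro mult_left_mono) auto
  then show ?case by (simp add: soliton_0 kink_def power2_eq_square)
next
  case (Suc j)
  have "h * (kink (Suc j) - kink j) \<le> h * (2 * sinh (h / 2) * (soliton (Suc j))\<^sup>2)"
    using Suc.prems kink_diff_bounds(2)[of j] h_pos by (intro mult_left_mono) (auto simp: soliton_def)
  then show ?case using Suc by (simp add: algebra_simps)
qed

lemma cmass_soliton_close:
  assumes "j \<le> K" shows "\<bar>cmass soliton j - kink j\<bar> \<le> h\<^sup>2 / 4"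
proof -
  define m M where "m = cmass soliton j" and "M = kink j"
  have m0: "0 \<le> m" using cmass_nonneg by (simp add: m_def)
  have M: "0 \<le> M" "M \<le> 1/2" using kink_nonneg kink_le_half by (auto simp: M_def)
  have "h * (1 - h\<^sup>2 / 16) * m \<le> 4 * tanh (h / 4) * m"
    using tanh_quarter(1) m0 by (intro mult_right_mono) auto
  also have "\<dots> \<le> h * M" using cmass_soliton_le[OF assms] by (simp add: m_def M_def)
  finally have 1: "(1 - h\<^sup>2 / 16) * m \<le> M" using h_pos by simp
  have "h * M \<le> 2 * sinh (h / 2) * m" using cmass_soliton_ge[OF assms] by (simp add: m_def M_def)
  also have "\<dots> \<le> 2 * (h / 2 * (1 + (h / 2)\<^sup>2)) * m"
    using sinh_le_cubic[of "h/2"] h_pos h_le m0 by (intro mult_right_mono mult_left_mono) auto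
  also have "\<dots> = h * ((1 + h\<^sup>2 / 4) * m)" by (simp add: power_divide)
  finally have 2: "M \<le> (1 + h\<^sup>2 / 4) * m" using h_pos by simp
  have "(1 - 1/2) * m \<le> (1 - h\<^sup>2 / 16) * m" using h_sq_le m0 by (intro mult_right_mono) auto
  then have m1: "m \<le> 1" using 1 M by simp
  have "h\<^sup>2 * m \<le> h\<^sup>2 * 1" using m1 by (intro mult_left_mono) auto
  moreover define q where "q = h\<^sup>2 * m"
  ultimately have q: "q \<le> h\<^sup>2" "0 \<le> q" using m0 by simp_all
  have "(1 - h\<^sup>2 / 16) * m = m - q / 16" "(1 + h\<^sup>2 / 4) * m = m + q / 4"
    by (simp_all add: q_def algebra_simps)
  then have "m - q / 16 \<le> M" "M \<le> m + q / 4" using 1 2 by simp_all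
  then show ?thesis using q unfolding m_def[symmetric] M_def[symmetric] by linarith
qed

lemma soliton_mass_le: "S (\<lambda>j. (soliton j)\<^sup>2) \<le> 2"
  using cmass_soliton_close[of K] kink_le_half[of K] h_sq_le cmass_K[of soliton] by linarith

lemma half_lap_sech_sample: "\<bar>half_lap sech_sample j - (sech_sample j)^3 + sech_sample j / 8\<bar> \<le> h\<^sup>2 * sech_sample j"
proof -
  define x where "x = real j * h / 2"
  have c: "half_lap sech_sample j = (2 * (1 / cosh x) - 1 / cosh (x + h/2) - 1 / cosh (x - h/2)) / (2 * h\<^sup>2) / 2"
  proof (cases j)
    case 0
    define c where "c = 1 / cosh (h / 2)"
    have "sech_sample 0 = 1/2" "sech_sample 1 = c / 2" by (simp_all add: sech_sample_def c_def)
    then have n: "half_lap sech_sample j = (1/2 - c / 2) / h\<^sup>2" by (simp add: half_lap_def 0)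
    have e: "1 / cosh x = 1" "1 / cosh (x + h/2) = c" "1 / cosh (x - h/2) = c" by (simp_all add: x_def 0 c_def)
    show ?thesis unfolding n e using h_pos by (simp add: field_simps)
  next
    case (Suc i)
    have a: "real (Suc j) * h / 2 = x + h/2" "real i * h / 2 = x - h/2" "real j * h / 2 = x"
      by (simp_all add: x_def Suc field_simps)
    have n: "sech_sample (Suc j) = 1 / cosh (x + h/2) / 2" "sech_sample i = 1 / cosh (x - h/2) / 2" "sech_sample j = 1 / cosh x / 2"
      unfolding sech_sample_def a by simp_all
    have "half_lap sech_sample j = (2 * sech_sample j - sech_sample i - sech_sample (Suc j)) / (2 * h\<^sup>2)" by (simp add: half_lap_def Suc)
    then show ?thesis unfolding n by (simp add: diff_divide_distrib)
  qed
  define t L where "t = 1 / cosh x"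
    and "L = (2 * (1 / cosh x) - 1 / cosh (x + h/2) - 1 / cosh (x - h/2)) / (2 * h\<^sup>2)"
  have s: "sech_sample j = t / 2" by (simp add: sech_sample_def x_def t_def)
  have "half_lap sech_sample j - (sech_sample j)^3 + sech_sample j / 8 = (L - t^3 / 4 + t / 8) / 2"
    unfolding c s L_def[symmetric] by (simp add: power_divide)
  moreover have "\<bar>L - t^3 / 4 + t / 8\<bar> \<le> h\<^sup>2 * t"
    using sech_discrete_residual[OF h_pos h_le, of x] unfolding t_def L_def .
  ultimately have "\<bar>half_lap sech_sample j - (sech_sample j)^3 + sech_sample j / 8\<bar> \<le> h\<^sup>2 * t / 2" by (simp only: abs_divide) simp
  moreover have "h\<^sup>2 * t / 2 = h\<^sup>2 * sech_sample j" by (simp add: s)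
  ultimately show ?thesis by linarith
qed

end

text \<open>The fourth power leaves order h^2 after the division by h^2 in the discrete Laplacian at
  the cut-off. The rate 1/4 is half the decay rate of the ground state, so that the other half is
  still available as a weight in the interpolation estimate.\<close>

locale truncated_grid = grid +
  assumes trunc: "exp (- (h * real K / 4)) \<le> h^4"
begin

lemma h4_le: "h^4 \<le> h\<^sup>2 / 4" "h^4 \<le> 1/16"
proof -
  have "h^4 = h\<^sup>2 * h\<^sup>2" by (simp add: power4_eq_xxxx power2_eq_square)
  moreover have "h\<^sup>2 * h\<^sup>2 \<le> h\<^sup>2 * (1/4)" using h_sq_le by (intro mult_left_mono) auto
  ultimately show "h^4 \<le> h\<^sup>2 / 4" by simp
  then show "h^4 \<le> 1/16" using h_sq_le by simp
qed

lemma K_pos: "0 < K"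
proof (rule ccontr)
  assume "\<not> 0 < K"
  then have "(1::real) \<le> h^4" using trunc by simp
  then show False using h4_le by simp
qed

lemma exp_half_K: "exp (- (h * real K / 2)) \<le> h^4 * h^4"
proof -
  have "exp (- (h * real K / 2)) = exp (- (h * real K / 4)) * exp (- (h * real K / 4))"
    by (simp add: exp_add[symmetric])
  also have "\<dots> \<le> h^4 * h^4" using trunc by (intro mult_mono) auto
  finally show ?thesis .
qed

lemma sech_sample_K: "sech_sample K \<le> h^4 * h^4"
  using sech_sample_le_exp[of K] exp_half_K by (simp add: mult.commute)

lemma h8_le: "h^4 * h^4 \<le> h^4"
  using mult_left_le[of "h^4" "h^4"] h4_le(2) h_pos by simp

lemma sech_sample_K': "sech_sample K \<le> h^4" "sech_sample (Suc K) \<le> h^4"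
  using sech_sample_K h8_le sech_sample_anti[of K "Suc K"] by auto

lemma kink_K: "1/2 - h\<^sup>2 / 4 \<le> kink K"
proof -
  define z where "z = (real K + 1/2) * h / 2"
  have "1 - tanh z = 2 * exp (- 2 * z) / (1 + exp (- 2 * z))"
    by (simp add: tanh_real_altdef field_simps add_pos_pos less_imp_neq[symmetric])
  also have "\<dots> \<le> 2 * exp (- 2 * z) / 1" by (intro divide_left_mono) (auto simp: add_pos_pos)
  also have "exp (- 2 * z) \<le> exp (- (h * real K / 2))"
  proof -
    have "2 * z = h * real K + h / 2" "0 \<le> h * real K" using h_pos by (simp_all add: z_def field_simps)
    then show ?thesis using h_pos unfolding exp_le_cancel_iff by linarith
  qed
  also have "\<dots> \<le> h^4" using exp_half_K h8_le by simp
  finally show ?thesis using h4_le by (simp add: kink_def z_def[symmetric])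
qed

lemma soliton_mass: "\<bar>S (\<lambda>j. (soliton j)\<^sup>2) - 1\<bar> \<le> h\<^sup>2"
  using cmass_soliton_close[of K] kink_le_half[of K] kink_K cmass_K[of soliton] by linarith

text \<open>Before the last edge only the mismatch between h/2 and 2 tanh (h/4) is left. On the last
  edge the truncated soliton jumps from its sample at \<open>K\<close> to 0, and the cut-off
  condition pays for the quotient by h.\<close>

lemma soliton_defect_bound:
  assumes "j \<le> K" shows "(soliton_defect j)\<^sup>2 \<le> h\<^sup>2 / 16 * ((soliton j)\<^sup>2 + (soliton (Suc j))\<^sup>2) + (if j = K then h^4 * h\<^sup>2 else 0)"
proof (cases "j < K")
  case True
  define r where "r = 1/2 - 2 * tanh (h / 4) / h"
  have "h * (1/2 - 2 * tanh (h / 4) / h) = h / 2 - 2 * tanh (h/4)" using h_pos by (simp add: field_simps)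
  then have r: "0 \<le> r" "r \<le> h\<^sup>2 / 32"
    using tanh_quarter h_pos by (auto simp: r_def field_simps power2_eq_square)
  have "(soliton (Suc j) - soliton j) / h = - (2 * tanh (h / 4) / h) * kink j * (soliton (Suc j) + soliton j)"
    using True sech_sample_step[of j] by (simp add: soliton_def)
  then have f: "soliton_defect j = r * kink j * (soliton (Suc j) + soliton j)" by (simp add: soliton_defect_def r_def algebra_simps)
  have "r * kink j \<le> h\<^sup>2 / 32 * (1/2)" using r kink_nonneg kink_le_half by (intro mult_mono) auto
  moreover have "h\<^sup>2 \<le> 1 * h" unfolding power2_eq_square using h_pos h_le by (intro mult_right_mono) auto
  ultimately have "r * kink j \<le> h / 8" using h_pos by simp
  then have "(r * kink j)\<^sup>2 \<le> (h / 8)\<^sup>2" using r kink_nonneg by (intro power_mono) auto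
  then have "(soliton_defect j)\<^sup>2 \<le> (h/8)\<^sup>2 * (soliton (Suc j) + soliton j)\<^sup>2"
    unfolding f power_mult_distrib by (intro mult_right_mono) auto
  also have "\<dots> \<le> (h/8)\<^sup>2 * (2 * ((soliton j)\<^sup>2 + (soliton (Suc j))\<^sup>2))"
    using zero_le_power2[of "soliton (Suc j) - soliton j"]
    by (intro mult_left_mono) (auto simp: power2_eq_square algebra_simps)
  also have "\<dots> \<le> h\<^sup>2 / 16 * ((soliton j)\<^sup>2 + (soliton (Suc j))\<^sup>2)"
    by (simp add: power_divide field_simps)
  finally show ?thesis using True by simp
next
  case False
  then have j: "j = K" using assms by simp
  have f: "soliton_defect j = - sech_sample K * (1 / h - kink K / 2)" by (simp add: soliton_defect_def j soliton_def field_simps)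
  have "1 \<le> 1 / h" using h_pos h_le by simp
  then have b: "0 \<le> 1 / h - kink K / 2" "1 / h - kink K / 2 \<le> 1 / h"
    using kink_nonneg[of K] kink_le_half[of K] by linarith+
  have "sech_sample K * (1 / h - kink K / 2) \<le> h^4 * (1 / h)"
    using b sech_sample_K' sech_sample_pos[of K] by (intro mult_mono) auto
  also have "h^4 * (1 / h) = h^3" using h_pos by (simp add: power4_eq_xxxx power3_eq_cube)
  finally have "(sech_sample K * (1 / h - kink K / 2))\<^sup>2 \<le> (h^3)\<^sup>2"
    using b sech_sample_pos[of K] by (intro power_mono) auto
  also have "(h^3)\<^sup>2 = h^4 * h\<^sup>2" by (simp flip: power_mult power_add)
  finally have "(soliton_defect j)\<^sup>2 \<le> h^4 * h\<^sup>2" by (simp add: f)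
  then show ?thesis using j by (simp add: add_increasing)
qed

lemma sum_pairs_soliton: "h * (\<Sum>j\<le>K. (soliton j)\<^sup>2 + (soliton (Suc j))\<^sup>2) \<le> 2"
  unfolding sum_sq_pairs using soliton_mass_le by (simp add: S_def soliton_Suc_K)

lemma sum_soliton_defect: "h * (\<Sum>j\<le>K. (soliton_defect j)\<^sup>2) \<le> h\<^sup>2"
proof -
  have "(\<Sum>j\<le>K. (soliton_defect j)\<^sup>2) \<le> (\<Sum>j\<le>K. h\<^sup>2 / 16 * ((soliton j)\<^sup>2 + (soliton (Suc j))\<^sup>2) + (if j = K then h^4 * h\<^sup>2 else 0))"
    by (intro sum_mono soliton_defect_bound) simp
  also have "\<dots> = h\<^sup>2 / 16 * (\<Sum>j\<le>K. (soliton j)\<^sup>2 + (soliton (Suc j))\<^sup>2) + h^4 * h\<^sup>2"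
    unfolding sum.distrib[of "\<lambda>j. h\<^sup>2 / 16 * ((soliton j)\<^sup>2 + (soliton (Suc j))\<^sup>2)"]
    by (simp only: sum_distrib_left[symmetric]) simp
  finally have "h * (\<Sum>j\<le>K. (soliton_defect j)\<^sup>2) \<le> h * (h\<^sup>2 / 16 * (\<Sum>j\<le>K. (soliton j)\<^sup>2 + (soliton (Suc j))\<^sup>2) + h^4 * h\<^sup>2)"
    using h_pos by (intro mult_left_mono) auto
  also have "\<dots> = h\<^sup>2 / 16 * (h * (\<Sum>j\<le>K. (soliton j)\<^sup>2 + (soliton (Suc j))\<^sup>2)) + h * h^4 * h\<^sup>2"
    by (simp add: algebra_simps)
  also have "\<dots> \<le> h\<^sup>2 / 16 * 2 + (1/2 * (1/16)) * h\<^sup>2"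
    using h_pos h_le h4_le sum_pairs_soliton by (intro add_mono mult_left_mono mult_right_mono mult_mono) auto
  also have "\<dots> \<le> h\<^sup>2" by simp
  finally show ?thesis .
qed

end

section \<open>Coercivity of the energy\<close>

locale unit_profile = truncated_grid +
  fixes u :: "nat \<Rightarrow> real"
  assumes u_supp: "supported u" and u_mass: "S (\<lambda>j. (u j)\<^sup>2) = 1"
    and u_dform: "dform u u \<le> 1/2"
begin

text \<open>The squared norm of v' + m v over the whole grid; the factor 2 accounts for the mirrored
  edges.\<close>

definition defect_norm :: real where "defect_norm = 2 * h * (\<Sum>j\<le>K. (defect u j)\<^sup>2)"
text \<open>Common scale of the perturbations: the conserved quantity, the mass error and the
  difference at the origin are each bounded by a multiple of it.\<close>

definition \<Gamma> :: real where "\<Gamma> = sqrt defect_norm + h"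

lemma defect_norm_nonneg: "0 \<le> defect_norm" using h_pos by (auto simp: defect_norm_def intro!: sum_nonneg mult_nonneg_nonneg)
lemma \<Gamma>_pos: "0 < \<Gamma>" using h_pos defect_norm_nonneg by (simp add: \<Gamma>_def add_nonneg_pos)
lemma u_Suc_K: "u (Suc K) = 0" using u_supp by (simp add: supported_def)
lemma cmass_u_K: "cmass u K = 1/2" using cmass_K[of u] u_mass by simp
lemma cmass_u_le: "j \<le> K \<Longrightarrow> cmass u j \<le> 1/2" using cmass_mono[of j K u] cmass_u_K by simp

text \<open>The bound 1/2 on the Dirichlet form in the locale is such that \<open>sup_bound\<close>
  yields exactly 1.\<close>

lemma u_sq_le: "(u j)\<^sup>2 \<le> 1"
proof (cases "j \<le> K")
  case True
  then show ?thesis using sup_bound[of u j] u_Suc_K u_dform u_mass by simp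
next
  case False
  then show ?thesis using u_supp by (simp add: supported_def)
qed

text \<open>Discrete version of the nearly conserved quantity \<open>v\<^sup>2 + m\<^sup>2 - 1/4\<close>, with \<open>m\<close> taken at the half-integer points
  \<open>j \<plusminus> 1/2\<close>; by evenness \<open>m\<close> at \<open>- 1/2\<close> is \<open>- cmass u 0\<close>.\<close>

definition flux :: "nat \<Rightarrow> real" where
  "flux j = (u j)\<^sup>2 + cmass u j * (if j = 0 then - cmass u 0 else cmass u (j - 1)) - 1/4"

lemma flux_step: "flux (Suc j) - flux j = h * (defect u j * (u (Suc j) + u j)) + h * cmass u j * (u (Suc j) - u j)\<^sup>2 / 2"
proof -
  define m where "m = cmass u j"
  have 1: "flux (Suc j) - flux j = (u (Suc j))\<^sup>2 - (u j)\<^sup>2 + m * (h * (u (Suc j))\<^sup>2 + h * (u j)\<^sup>2)"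
  proof (cases j)
    case 0
    have "m = h * (u j)\<^sup>2 / 2" by (simp add: m_def 0)
    moreover have "flux (Suc j) - flux j = (u (Suc j))\<^sup>2 + (m + h * (u (Suc j))\<^sup>2) * m - ((u j)\<^sup>2 + m * (- m))"
      by (simp add: flux_def m_def 0)
    ultimately show ?thesis by (simp add: algebra_simps)
  next
    case (Suc i)
    have "flux (Suc j) - flux j = (u (Suc j))\<^sup>2 + (m + h * (u (Suc j))\<^sup>2) * m - ((u j)\<^sup>2 + m * (m - h * (u j)\<^sup>2))"
      by (simp add: flux_def m_def Suc)
    then show ?thesis by (simp add: algebra_simps)
  qed
  have "h * (defect u j * (u (Suc j) + u j)) = h * (((u (Suc j) - u j) / h + m * ((u (Suc j) + u j) / 2)) * (u (Suc j) + u j))"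
    by (simp add: defect_def m_def)
  also have "\<dots> = (u (Suc j))\<^sup>2 - (u j)\<^sup>2 + h * m * (u (Suc j) + u j)\<^sup>2 / 2"
    using h_pos by (simp add: field_simps power2_eq_square)
  finally have 2: "h * (defect u j * (u (Suc j) + u j)) = (u (Suc j))\<^sup>2 - (u j)\<^sup>2 + h * m * (u (Suc j) + u j)\<^sup>2 / 2" .
  show ?thesis unfolding 1 2 m_def[symmetric] by (simp add: power2_eq_square field_simps)
qed

lemma flux_Suc_K: "flux (Suc K) = 0"
  by (simp add: flux_def u_Suc_K cmass_u_K)

lemma sum_pairs_u: "h * (\<Sum>j\<le>K. (u j)\<^sup>2 + (u (Suc j))\<^sup>2) = 1"
  unfolding sum_sq_pairs using u_mass by (simp add: S_def u_Suc_K)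

lemma sum_abs_defect: "h * (\<Sum>j\<le>K. \<bar>defect u j\<bar> * \<bar>u (Suc j) + u j\<bar>) \<le> sqrt defect_norm"
proof (rule real_le_rsqrt)
  have "(\<Sum>j\<le>K. \<bar>defect u j\<bar> * \<bar>u (Suc j) + u j\<bar>)\<^sup>2 \<le> (\<Sum>j\<le>K. \<bar>defect u j\<bar>\<^sup>2) * (\<Sum>j\<le>K. \<bar>u (Suc j) + u j\<bar>\<^sup>2)"
    by (rule Cauchy_Schwarz_ineq_sum)
  also have "\<dots> \<le> (\<Sum>j\<le>K. (defect u j)\<^sup>2) * (2 * (\<Sum>j\<le>K. (u j)\<^sup>2 + (u (Suc j))\<^sup>2))"
  proof (intro mult_mono)
    have "\<bar>u (Suc j) + u j\<bar>\<^sup>2 \<le> 2 * ((u j)\<^sup>2 + (u (Suc j))\<^sup>2)" for j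
      using zero_le_power2[of "u (Suc j) - u j"] by (simp add: power2_eq_square algebra_simps)
    then show "(\<Sum>j\<le>K. \<bar>u (Suc j) + u j\<bar>\<^sup>2) \<le> 2 * (\<Sum>j\<le>K. (u j)\<^sup>2 + (u (Suc j))\<^sup>2)"
      unfolding sum_distrib_left by (rule sum_mono)
  qed (auto intro!: sum_nonneg)
  finally have "h\<^sup>2 * (\<Sum>j\<le>K. \<bar>defect u j\<bar> * \<bar>u (Suc j) + u j\<bar>)\<^sup>2
      \<le> h\<^sup>2 * ((\<Sum>j\<le>K. (defect u j)\<^sup>2) * (2 * (\<Sum>j\<le>K. (u j)\<^sup>2 + (u (Suc j))\<^sup>2)))"
    by (rule mult_left_mono) simp
  also have "\<dots> = defect_norm * (h * (\<Sum>j\<le>K. (u j)\<^sup>2 + (u (Suc j))\<^sup>2))"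
    by (simp add: defect_norm_def power2_eq_square)
  also have "\<dots> = defect_norm" unfolding sum_pairs_u by simp
  finally show "(h * (\<Sum>j\<le>K. \<bar>defect u j\<bar> * \<bar>u (Suc j) + u j\<bar>))\<^sup>2 \<le> defect_norm"
    by (simp add: power_mult_distrib)
qed

text \<open>\<open>flux_step\<close> is summed from the outer end, where the quantity is exactly 0:
  beyond the support u vanishes and both masses are 1/2. The defect enters through Cauchy-Schwarz,
  and the squared differences cost only h^2 times the Dirichlet form.\<close>

lemma flux_bound:
  assumes "j \<le> K" shows "\<bar>flux j\<bar> \<le> sqrt defect_norm + h\<^sup>2 / 8"
proof -
  have "flux (Suc K) - flux j = (\<Sum>i=j..K. flux (Suc i) - flux i)"
    using assms sum_Suc_diff[of j K flux] by simp
  then have "\<bar>flux j\<bar> = \<bar>\<Sum>i=j..K. flux (Suc i) - flux i\<bar>" by (simp add: flux_Suc_K)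
  also have "\<dots> \<le> (\<Sum>i=j..K. \<bar>flux (Suc i) - flux i\<bar>)" by (rule sum_abs)
  also have "\<dots> \<le> (\<Sum>i=j..K. h * (\<bar>defect u i\<bar> * \<bar>u (Suc i) + u i\<bar>) + h / 4 * (u (Suc i) - u i)\<^sup>2)"
  proof (rule sum_mono)
    fix i assume i: "i \<in> {j..K}"
    have "h * cmass u i * (u (Suc i) - u i)\<^sup>2 / 2 \<le> h * (1/2) * (u (Suc i) - u i)\<^sup>2 / 2"
      using i cmass_u_le[of i] h_pos by (intro divide_right_mono mult_right_mono mult_left_mono) auto
    moreover have "0 \<le> h * cmass u i * (u (Suc i) - u i)\<^sup>2 / 2" using h_pos cmass_nonneg[of u i] by simp
    moreover have "\<bar>h * (defect u i * (u (Suc i) + u i))\<bar> = h * (\<bar>defect u i\<bar> * \<bar>u (Suc i) + u i\<bar>)"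
      using h_pos by (simp add: abs_mult)
    ultimately show "\<bar>flux (Suc i) - flux i\<bar> \<le> h * (\<bar>defect u i\<bar> * \<bar>u (Suc i) + u i\<bar>) + h / 4 * (u (Suc i) - u i)\<^sup>2"
      unfolding flux_step by linarith
  qed
  also have "\<dots> \<le> (\<Sum>i\<le>K. h * (\<bar>defect u i\<bar> * \<bar>u (Suc i) + u i\<bar>) + h / 4 * (u (Suc i) - u i)\<^sup>2)"
    using h_pos by (intro sum_mono2) auto
  also have "\<dots> = h * (\<Sum>j\<le>K. \<bar>defect u j\<bar> * \<bar>u (Suc j) + u j\<bar>) + h\<^sup>2 / 4 * dform u u"
  proof -
    have "h\<^sup>2 / 4 * dform u u = h / 4 * (\<Sum>i\<le>K. (u (Suc i) - u i)\<^sup>2)"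
      using h_pos by (simp add: dform_def power2_eq_square)
    then show ?thesis by (simp only: sum.distrib sum_distrib_left)
  qed
  also have "\<dots> \<le> sqrt defect_norm + h\<^sup>2 / 4 * (1/2)"
    using u_dform by (intro add_mono sum_abs_defect mult_left_mono) auto
  finally show ?thesis by simp
qed

section \<open>Stability of the discrete Riccati equation for the mass\<close>

definition cmass_error :: "nat \<Rightarrow> real" where "cmass_error j = cmass u j - kink j"

text \<open>Difference of two Riccati recursions, with m' m - M' M split as (m' - M') m + (m - M)
  M'. The factor on the left is then at least 1 and that on the right at most 1, so errors are not
  amplified. The unequal steps h and \<open>kink_step\<close> cause the second source term.\<close>

lemma cmass_error_step: "cmass_error (Suc j) * (1 + h * cmass u j)
   = cmass_error j * (1 - h * kink (Suc j)) + (h * flux (Suc j) + (h - kink_step) * (1/4 - kink (Suc j) * kink j))"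
proof -
  define m m' M M' g where "m = cmass u j" and "m' = cmass u (Suc j)" and "M = kink j" and "M' = kink (Suc j)"
    and "g = flux (Suc j)"
  have "h * (u (Suc j))\<^sup>2 = h * (1/4 + g - m' * m)" by (simp add: g_def flux_def m_def m'_def)
  then have 1: "m' - m = h * (1/4 + g - m' * m)" by (simp add: m'_def m_def)
  have 2: "M' - M = kink_step * (1/4 - M' * M)" using kink_step[of j] by (simp add: M_def M'_def)
  have "(m' - M') * (1 + h * m) - (m - M) * (1 - h * M')
      = (m' - m) - (M' - M) + h * (m' * m - M' * M)" by (simp add: algebra_simps)
  also have "\<dots> = h * g + (h - kink_step) * (1/4 - M' * M)" unfolding 1 2 by (simp add: field_simps)
  finally show ?thesis unfolding cmass_error_def m_def[symmetric] m'_def[symmetric] M_def[symmetric] M'_def[symmetric] g_def[symmetric]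
    by linarith
qed

text \<open>The bound to be propagated is itself of order h in the first cell, so the base case has
  to gain a factor h. Oddness of the mass provides it: the equation across the central cell
  expresses 2 (m - M) as h times small quantities.\<close>

lemma cmass_error_0: "\<bar>cmass_error 0\<bar> \<le> 8 * kink 0 * \<Gamma>"
proof -
  define m M g where "m = cmass u 0" and "M = kink 0" and "g = flux 0"
  have m: "0 \<le> m" "m \<le> 1/2" using cmass_nonneg[of u 0] cmass_u_le[of 0] by (simp_all add: m_def del: cmass.simps)
  have M: "0 \<le> M" "M \<le> 1/2" using kink_nonneg kink_le_half by (auto simp: M_def)
  have "h * (u 0)\<^sup>2 = h * (1/4 + g + m * m)" by (simp add: g_def flux_def m_def)
  then have 1: "2 * m = h * (1/4 + g + m * m)" by (simp add: m_def)
  have 2: "2 * M = kink_step * (1/4 + M\<^sup>2)" using kink_0 by (simp add: M_def)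
  have "2 * (m - M) = h * g + (h - kink_step) * (1/4 + M\<^sup>2) + h * ((m - M) * (m + M))"
  proof -
    have "2 * m = h / 4 + h * g + h * m\<^sup>2" "2 * M = kink_step / 4 + kink_step * M\<^sup>2"
      unfolding 1 2 by (simp_all add: algebra_simps power2_eq_square)
    moreover have "(h - kink_step) * (1/4 + M\<^sup>2) = h / 4 + h * M\<^sup>2 - kink_step / 4 - kink_step * M\<^sup>2"
      by (simp add: field_simps)
    moreover have "h * ((m - M) * (m + M)) = h * m\<^sup>2 - h * M\<^sup>2"
      by (simp add: power2_eq_square algebra_simps)
    moreover have "2 * (m - M) = c + X + Y" if "2 * m = a + c + d" "2 * M = b + e" "X = a + k - b - e" "Y = d - k"
      for a b c d e k X Y using that by simp
    ultimately show ?thesis by blast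
  qed
  then have "2 * \<bar>m - M\<bar> = \<bar>h * g + (h - kink_step) * (1/4 + M\<^sup>2) + h * ((m - M) * (m + M))\<bar>"
    by (metis abs_mult abs_numeral)
  also have "\<dots> \<le> \<bar>h * g\<bar> + \<bar>(h - kink_step) * (1/4 + M\<^sup>2)\<bar> + \<bar>h * ((m - M) * (m + M))\<bar>" by linarith
  also have "\<bar>h * g\<bar> \<le> h * (sqrt defect_norm + h\<^sup>2 / 8)"
    using flux_bound[of 0] h_pos unfolding abs_mult g_def by (intro mult_mono) auto
  also have "\<bar>(h - kink_step) * (1/4 + M\<^sup>2)\<bar> \<le> (h * (h\<^sup>2/4)) * (1/2)"
    unfolding abs_mult using kink_step_le kink_step_ge M power_mono[of M "1/2" 2]
    by (intro mult_mono) (auto simp: power2_eq_square)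
  also have "\<bar>h * ((m - M) * (m + M))\<bar> \<le> h * (\<bar>m - M\<bar> * 1)"
    unfolding abs_mult using h_pos m M by (intro mult_mono) auto
  also have "h * (\<bar>m - M\<bar> * 1) \<le> 1/2 * \<bar>m - M\<bar>" using mult_right_mono[OF h_le, of "\<bar>m - M\<bar>"] by simp
  finally have "3/2 * \<bar>m - M\<bar> \<le> h * (sqrt defect_norm + h\<^sup>2 / 4)" by (simp add: algebra_simps)
  also have "\<dots> \<le> h * \<Gamma>"
  proof -
    have "h\<^sup>2 \<le> 1 * h" unfolding power2_eq_square using h_pos h_le by (intro mult_right_mono) auto
    then show ?thesis unfolding \<Gamma>_def using h_pos by (intro mult_left_mono) auto
  qed
  finally have a: "\<bar>m - M\<bar> \<le> 8 * (h / 12) * \<Gamma>" by simp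
  have "8 * (h / 12) * \<Gamma> \<le> 8 * M * \<Gamma>" using kink_0_ge \<Gamma>_pos by (intro mult_right_mono) (auto simp: M_def)
  then show ?thesis using a by (simp add: cmass_error_def m_def M_def)
qed

text \<open>\<open>4 M\<close> is a supersolution of the linearized Riccati equation: \<open>(4 M)' + M (4 M) = 1\<close> for \<open>M' = 1/4 - M\<^sup>2\<close>.\<close>

lemma cmass_error_bound_kink: "j \<le> K \<Longrightarrow> \<bar>cmass_error j\<bar> \<le> 8 * kink j * \<Gamma>"
proof (induction j)
  case 0
  show ?case by (rule cmass_error_0)
next
  case (Suc j)
  define M M' where "M = kink j" and "M' = kink (Suc j)"
  have M: "0 \<le> M" "M \<le> 1/2" "0 \<le> M'" "M' \<le> 1/2" using kink_nonneg kink_le_half by (auto simp: M_def M'_def)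
  have hM: "h * M' \<le> 1" using h_pos h_le M by (intro mult_le_one) auto
  have kink': "0 \<le> M' * M" "M' * M \<le> 1/2 * (1/2)" using M by simp (use M in \<open>intro mult_mono, auto\<close>)
  have "\<bar>h * flux (Suc j) + (h - kink_step) * (1/4 - M' * M)\<bar> \<le> \<bar>h * flux (Suc j)\<bar> + \<bar>(h - kink_step) * (1/4 - M' * M)\<bar>"
    by linarith
  also have "\<bar>h * flux (Suc j)\<bar> \<le> h * (sqrt defect_norm + h\<^sup>2 / 8)"
    using flux_bound[of "Suc j"] Suc.prems h_pos unfolding abs_mult by (intro mult_mono) auto
  also have "\<bar>(h - kink_step) * (1/4 - M' * M)\<bar> \<le> (h * (h\<^sup>2/4)) * (1/4)"
  proof -
    have "\<bar>h - kink_step\<bar> \<le> h * (h\<^sup>2/4)" using kink_step_le kink_step_ge by linarith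
    moreover have "\<bar>1/4 - M' * M\<bar> \<le> 1/4" using kink' by linarith
    ultimately show ?thesis unfolding abs_mult using h_pos by (intro mult_mono) auto
  qed
  also have "h * (sqrt defect_norm + h\<^sup>2 / 8) + h * (h\<^sup>2 / 4) * (1/4) \<le> h * (sqrt defect_norm + h\<^sup>2)"
    using h_pos by (simp add: algebra_simps)
  also have "\<dots> \<le> h * \<Gamma>"
  proof -
    have "h\<^sup>2 \<le> 1 * h" unfolding power2_eq_square using h_pos h_le by (intro mult_right_mono) auto
    then show ?thesis unfolding \<Gamma>_def using h_pos by (intro mult_left_mono) auto
  qed
  finally have src: "\<bar>h * flux (Suc j) + (h - kink_step) * (1/4 - M' * M)\<bar> \<le> h * \<Gamma>" by simp
  have "\<bar>cmass_error (Suc j)\<bar> * 1 \<le> \<bar>cmass_error (Suc j)\<bar> * (1 + h * cmass u j)"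
    using h_pos cmass_nonneg[of u j] by (intro mult_left_mono) auto
  also have "\<dots> = \<bar>cmass_error (Suc j) * (1 + h * cmass u j)\<bar>"
    using h_pos cmass_nonneg[of u j] by (simp add: abs_mult)
  also have "\<dots> \<le> \<bar>cmass_error j * (1 - h * M')\<bar> + h * \<Gamma>"
    unfolding cmass_error_step M_def[symmetric] M'_def[symmetric] using src by linarith
  also have "\<bar>cmass_error j * (1 - h * M')\<bar> = \<bar>cmass_error j\<bar> * (1 - h * M')" using hM by (simp add: abs_mult)
  also have "\<dots> \<le> 8 * M * \<Gamma> * (1 - h * M')"
    using Suc hM by (intro mult_right_mono) (auto simp: M_def)
  finally have 1: "\<bar>cmass_error (Suc j)\<bar> \<le> (8 * M * (1 - h * M') + h) * \<Gamma>" by (simp add: algebra_simps)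
  \<comment> \<open>The factor 8, twice that of the continuous supersolution, gives room for
    \<open>kink_step\<close> being smaller than h: the margin is at least 2 \<open>kink_step\<close>
    - h, which is nonnegative.\<close>
  have "8 * M * (1 - h * M') + h \<le> 8 * M'"
  proof -
    have "M' - M = kink_step * (1/4 - M' * M)" using kink_step[of j] by (simp add: M_def M'_def)
    then have e: "8 * M' - (8 * M * (1 - h * M') + h) = (2 * kink_step - h) + 8 * ((h - kink_step) * (M' * M))"
      by (simp add: algebra_simps)
    have "0 \<le> (h - kink_step) * (M' * M)" using kink_step_le kink'(1) by (intro mult_nonneg_nonneg[OF _ kink'(1)]) simp
    then show ?thesis using e kink_step_ge_half by linarith
  qed
  then have "(8 * M * (1 - h * M') + h) * \<Gamma> \<le> 8 * M' * \<Gamma>" using \<Gamma>_pos by (intro mult_right_mono) auto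
  then show ?case using 1 by (simp add: M'_def)
qed

lemma cmass_error_bound: "j \<le> K \<Longrightarrow> \<bar>cmass_error j\<bar> \<le> 4 * \<Gamma>"
proof -
  assume "j \<le> K"
  then have "\<bar>cmass_error j\<bar> \<le> 8 * kink j * \<Gamma>" by (rule cmass_error_bound_kink)
  also have "\<dots> \<le> 8 * (1/2) * \<Gamma>" using kink_le_half \<Gamma>_pos by (intro mult_right_mono mult_left_mono) auto
  finally show ?thesis by simp
qed

section \<open>Weighted estimate for the difference to the soliton\<close>

definition diff_seq :: "nat \<Rightarrow> real" where "diff_seq j = u j - soliton j"
definition midpoint :: "nat \<Rightarrow> real" where "midpoint j = (diff_seq (Suc j) + diff_seq j) / 2"
definition source :: "nat \<Rightarrow> real" where "source j = defect u j - soliton_defect j - cmass_error j * ((soliton (Suc j) + soliton j) / 2)"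

text \<open>Both profiles nearly solve v' + m v = 0 with their own masses. Subtraction gives a
  linear equation with the mass of \<open>u\<close>; the mass mismatch multiplies the known soliton
  and is therefore a source.\<close>

lemma diff_seq_equation: "(diff_seq (Suc j) - diff_seq j) / h + cmass u j * midpoint j = source j"
  using h_pos by (simp add: source_def defect_def soliton_defect_def cmass_error_def diff_seq_def midpoint_def field_simps)

lemma diff_seq_Suc_K: "diff_seq (Suc K) = 0" by (simp add: diff_seq_def u_Suc_K soliton_Suc_K)

text \<open>The weight \<open>\<omega> = 1 - M\<close> satisfies \<open>M \<omega> - \<omega>'/2 \<ge> 1/8\<close> also near the origin, where the damping \<open>M\<close> alone vanishes.\<close>

lemma weighted_step:
  assumes j: "j \<le> K" and small: "\<Gamma> \<le> 1/128"
  shows "h / 32 * (midpoint j)\<^sup>2 - 32 * h * (source j)\<^sup>2 \<le> (1 - kink j) * (diff_seq j)\<^sup>2 - (1 - kink (Suc j)) * (diff_seq (Suc j))\<^sup>2"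
proof -
  define M M' m y z d d' where "M = kink j" and "M' = kink (Suc j)" and "m = cmass u j" and "y = midpoint j" and "z = source j"
    and "d = diff_seq j" and "d' = diff_seq (Suc j)"
  note defs = M_def M'_def m_def y_def z_def d_def d'_def
  have M: "0 \<le> M" "M \<le> 1/2" "0 \<le> M'" "M' \<le> 1/2" "M \<le> M'" using kink_nonneg kink_le_half kink_mono by (auto simp: defs)
  have m: "M - 1/32 \<le> m" using cmass_error_bound[OF j] small by (auto simp: cmass_error_def defs)
  define w where "w = 2 - M - M'"
  have w: "1 \<le> w" "w \<le> 2" using M by (auto simp: w_def)
  have e1: "d' - d = h * (z - m * y)" using diff_seq_equation[of j] h_pos by (simp add: defs field_simps)
  have e2: "y = (d' + d) / 2" by (simp add: defs midpoint_def)
  have "(1 - M) * d\<^sup>2 - (1 - M') * d'\<^sup>2 = - w * y * (d' - d) + (M' - M) * ((d\<^sup>2 + d'\<^sup>2) / 2)"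
    unfolding e2 w_def by (simp add: power2_eq_square field_simps)
  also have "\<dots> = h * (w * m * y\<^sup>2) - h * (w * (y * z)) + (M' - M) * ((d\<^sup>2 + d'\<^sup>2) / 2)"
    unfolding e1 by (simp add: power2_eq_square algebra_simps)
  finally have eq: "(1 - M) * d\<^sup>2 - (1 - M') * d'\<^sup>2
    = h * (w * m * y\<^sup>2) - h * (w * (y * z)) + (M' - M) * ((d\<^sup>2 + d'\<^sup>2) / 2)" .
  have "y\<^sup>2 \<le> (d\<^sup>2 + d'\<^sup>2) / 2" unfolding e2
    using zero_le_power2[of "d' - d"] by (simp add: power2_eq_square field_simps)
  moreover have MMge: "h / 2 * (1/4 - M' * M) \<le> M' - M"
  proof -
    have "M' * M \<le> 1/2 * (1/2)" using M by (intro mult_mono) auto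
    then have "h / 2 * (1/4 - M' * M) \<le> kink_step * (1/4 - M' * M)"
      using kink_step_ge_half by (intro mult_right_mono) auto
    then show ?thesis using kink_step[of j] by (simp add: defs)
  qed
  ultimately have "h / 2 * (1/4 - M' * M) * y\<^sup>2 \<le> (M' - M) * ((d\<^sup>2 + d'\<^sup>2) / 2)"
    using M by (intro mult_mono) auto
  moreover have "h * (w * (y * z)) \<le> h * (y\<^sup>2 / 32 + 32 * z\<^sup>2)"
  proof -
    have "w * (y * z) \<le> \<bar>w * (y * z)\<bar>" by simp
    also have "\<dots> = w * \<bar>y * z\<bar>" using w by (simp add: abs_mult)
    also have "\<dots> \<le> 2 * \<bar>y * z\<bar>" using w by (intro mult_right_mono) auto
    also have "2 * \<bar>y * z\<bar> \<le> y\<^sup>2 / 32 + 32 * z\<^sup>2"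
      using zero_le_power2[of "y / 8 - 8 * z"] zero_le_power2[of "y / 8 + 8 * z"]
      using zero_le_power2[of "\<bar>y\<bar> - 32 * \<bar>z\<bar>"] unfolding power2_diff power_mult_distrib power2_abs abs_mult
      by simp
    finally show ?thesis using h_pos by simp
  qed
  \<comment> \<open>The damping contributes at least M - 1/16 and the slope of the weight at least
    1/8 - M/4, so together at least 1/16 for every M \<ge> 0. Half of this pays for the cross term
    with \<open>z\<close>.\<close>
  moreover have "h / 16 * y\<^sup>2 \<le> h * (w * m * y\<^sup>2) + h / 2 * (1/4 - M' * M) * y\<^sup>2"
  proof -
    have "w * (M - 1/32) \<le> w * m" using m w by simp
    moreover have "w * (M - 1/32) \<ge> (3/2 - M) * M - 1/16"
    proof -
      have "w * (M - 1/32) = w * M - w / 32" by (simp add: algebra_simps)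
      moreover have "(3/2 - M) * M \<le> w * M" using M by (intro mult_right_mono) (auto simp: w_def)
      ultimately show ?thesis using w by linarith
    qed
    moreover have "M' * M \<le> M / 2" using M mult_right_mono[of M' "1/2" M] by simp
    moreover have "M * M \<le> M / 2" using M mult_right_mono[of M "1/2" M] by simp
    moreover have "(3/2 - M) * M = 3/2 * M - M * M" by (simp add: algebra_simps)
    moreover define A B Q R where "A = w * m" and "B = w * (M - 1/32)" and "Q = M' * M" and "R = M * M"
    ultimately have "B \<le> A" "3/2 * M - R - 1/16 \<le> B" "Q \<le> M / 2" "R \<le> M / 2" by simp_all
    then have "1/16 \<le> A + (1/4 - Q) / 2" using M by argo
    then have "1/16 \<le> w * m + (1/4 - M' * M) / 2" by (simp add: A_def Q_def)
    then have "1/16 * (h * y\<^sup>2) \<le> (w * m + (1/4 - M' * M) / 2) * (h * y\<^sup>2)"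
      using h_pos by (intro mult_right_mono) auto
    also have "\<dots> = h * (w * m * y\<^sup>2) + h / 2 * (1/4 - M' * M) * y\<^sup>2"
      unfolding distrib_right by simp
    finally show ?thesis by simp
  qed
  ultimately have "h / 16 * y\<^sup>2 - h * (y\<^sup>2 / 32 + 32 * z\<^sup>2) \<le> (1 - M) * d\<^sup>2 - (1 - M') * d'\<^sup>2"
    unfolding eq by linarith
  then show ?thesis by (simp add: algebra_simps defs)
qed

text \<open>At the origin the conserved quantity says that u(0)^2 is nearly 1/4. The sign condition
  selects the root 1/2 and excludes the negative of the ground state.\<close>

lemma diff_seq_0:
  assumes "0 \<le> u 0" shows "(diff_seq 0)\<^sup>2 \<le> 4 * \<Gamma>\<^sup>2"
proof -
  have m: "0 \<le> cmass u 0" "cmass u 0 \<le> h / 2"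
    using cmass_nonneg[of u 0] u_sq_le[of 0] h_pos by (auto simp: mult_left_le)
  have "(cmass u 0)\<^sup>2 \<le> (h/2)\<^sup>2" using m by (intro power_mono) auto
  then have cmass: "0 \<le> (cmass u 0)\<^sup>2" "(cmass u 0)\<^sup>2 \<le> h\<^sup>2 / 4" by (auto simp: power_divide)
  have "flux 0 = (u 0)\<^sup>2 - (cmass u 0)\<^sup>2 - 1/4" by (simp add: flux_def power2_eq_square)
  then have "\<bar>(u 0)\<^sup>2 - 1/4\<bar> \<le> sqrt defect_norm + h\<^sup>2 / 8 + h\<^sup>2 / 4" using flux_bound[of 0] cmass by linarith
  moreover have "h\<^sup>2 \<le> 1 * h" unfolding power2_eq_square using h_pos h_le by (intro mult_right_mono) auto
  ultimately have "\<bar>(u 0)\<^sup>2 - 1/4\<bar> \<le> \<Gamma>" unfolding \<Gamma>_def using h_pos by linarith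
  moreover have "(u 0)\<^sup>2 - 1/4 = (u 0 - 1/2) * (u 0 + 1/2)" by (simp add: power2_eq_square algebra_simps)
  then have "\<bar>(u 0)\<^sup>2 - 1/4\<bar> = \<bar>u 0 - 1/2\<bar> * (u 0 + 1/2)" using assms by (simp add: abs_mult)
  moreover have "\<bar>u 0 - 1/2\<bar> * (1/2) \<le> \<bar>u 0 - 1/2\<bar> * (u 0 + 1/2)" using assms by (intro mult_left_mono) auto
  ultimately have "\<bar>diff_seq 0\<bar> \<le> 2 * \<Gamma>" by (simp add: diff_seq_def soliton_0)
  then have "\<bar>diff_seq 0\<bar>\<^sup>2 \<le> (2 * \<Gamma>)\<^sup>2" by (intro power_mono) auto
  then show ?thesis by (simp add: power_mult_distrib)
qed

lemma \<Gamma>_sq: "\<Gamma>\<^sup>2 \<le> 2 * defect_norm + 2 * h\<^sup>2"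
  using zero_le_power2[of "sqrt defect_norm - h"] defect_norm_nonneg
  by (simp add: \<Gamma>_def power2_sum power2_diff)

lemma sum_source: "h * (\<Sum>j\<le>K. (source j)\<^sup>2) \<le> 100 * (defect_norm + h\<^sup>2)"
proof -
  have "(\<Sum>j\<le>K. (source j)\<^sup>2) \<le> (\<Sum>j\<le>K. 3 * (defect u j)\<^sup>2 + 3 * (soliton_defect j)\<^sup>2 + 24 * \<Gamma>\<^sup>2 * ((soliton j)\<^sup>2 + (soliton (Suc j))\<^sup>2))"
  proof (rule sum_mono)
    fix j assume "j \<in> {..K}"
    then have "\<bar>cmass_error j\<bar>\<^sup>2 \<le> (4 * \<Gamma>)\<^sup>2" by (intro power_mono cmass_error_bound) auto
    then have p: "(cmass_error j)\<^sup>2 \<le> 16 * \<Gamma>\<^sup>2" by (simp add: power_mult_distrib)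
    have a: "((soliton (Suc j) + soliton j) / 2)\<^sup>2 \<le> ((soliton j)\<^sup>2 + (soliton (Suc j))\<^sup>2) / 2"
      using zero_le_power2[of "soliton (Suc j) - soliton j"] by (simp add: power2_eq_square field_simps)
    have "(cmass_error j * ((soliton (Suc j) + soliton j) / 2))\<^sup>2 \<le> 16 * \<Gamma>\<^sup>2 * (((soliton j)\<^sup>2 + (soliton (Suc j))\<^sup>2) / 2)"
      unfolding power_mult_distrib using p a by (intro mult_mono) auto
    moreover have three: "(a - b - c)\<^sup>2 \<le> 3 * a\<^sup>2 + 3 * b\<^sup>2 + 3 * c\<^sup>2" for a b c :: real
      using zero_le_power2[of "a + b"] zero_le_power2[of "a + c"] zero_le_power2[of "b - c"]
      by (simp add: power2_eq_square algebra_simps)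
    ultimately show "(source j)\<^sup>2 \<le> 3 * (defect u j)\<^sup>2 + 3 * (soliton_defect j)\<^sup>2 + 24 * \<Gamma>\<^sup>2 * ((soliton j)\<^sup>2 + (soliton (Suc j))\<^sup>2)"
      unfolding source_def using three[of "defect u j" "soliton_defect j" "cmass_error j * ((soliton (Suc j) + soliton j) / 2)"] by linarith
  qed
  then have "h * (\<Sum>j\<le>K. (source j)\<^sup>2) \<le> h * (\<Sum>j\<le>K. 3 * (defect u j)\<^sup>2 + 3 * (soliton_defect j)\<^sup>2 + 24 * \<Gamma>\<^sup>2 * ((soliton j)\<^sup>2 + (soliton (Suc j))\<^sup>2))"
    using h_pos by (intro mult_left_mono) auto
  also have "\<dots> = 3/2 * defect_norm + 3 * (h * (\<Sum>j\<le>K. (soliton_defect j)\<^sup>2)) + 24 * \<Gamma>\<^sup>2 * (h * (\<Sum>j\<le>K. (soliton j)\<^sup>2 + (soliton (Suc j))\<^sup>2))"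
    by (simp only: sum.distrib sum_distrib_left[symmetric] defect_norm_def) (simp add: algebra_simps)
  also have "\<dots> \<le> 3/2 * defect_norm + 3 * h\<^sup>2 + 24 * \<Gamma>\<^sup>2 * 2"
    using sum_soliton_defect sum_pairs_soliton by (intro add_mono mult_left_mono) auto
  also have "\<dots> \<le> 100 * (defect_norm + h\<^sup>2)" using \<Gamma>_sq defect_norm_nonneg zero_le_power2[of h] unfolding distrib_left by linarith
  finally show ?thesis .
qed

text \<open>The weighted steps telescope. Nothing is left at the outer end, and the only other
  boundary value, at the origin, is controlled by the conserved quantity.\<close>

lemma sum_midpoint:
  assumes "0 \<le> u 0" and small: "\<Gamma> \<le> 1/128"
  shows "h * (\<Sum>j\<le>K. (midpoint j)\<^sup>2) \<le> 103000 * (defect_norm + h\<^sup>2)"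
proof -
  have "(\<Sum>j\<le>K. h / 32 * (midpoint j)\<^sup>2 - 32 * h * (source j)\<^sup>2)
    \<le> (\<Sum>j\<le>K. (1 - kink j) * (diff_seq j)\<^sup>2 - (1 - kink (Suc j)) * (diff_seq (Suc j))\<^sup>2)"
    by (intro sum_mono weighted_step small) auto
  also have "\<dots> = (1 - kink 0) * (diff_seq 0)\<^sup>2"
    using sum_telescope[of "\<lambda>j. (1 - kink j) * (diff_seq j)\<^sup>2" K] by (simp add: diff_seq_Suc_K)
  also have "\<dots> \<le> 1 * (diff_seq 0)\<^sup>2" using kink_nonneg by (intro mult_right_mono) auto
  also have "\<dots> \<le> 4 * \<Gamma>\<^sup>2" using diff_seq_0 assms by simp
  also have "\<dots> \<le> 8 * (defect_norm + h\<^sup>2)" using \<Gamma>_sq by simp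
  finally have "h / 32 * (\<Sum>j\<le>K. (midpoint j)\<^sup>2) - 32 * h * (\<Sum>j\<le>K. (source j)\<^sup>2) \<le> 8 * (defect_norm + h\<^sup>2)"
    unfolding sum_subtractf sum_distrib_left .
  moreover have "h / 32 * (\<Sum>j\<le>K. (midpoint j)\<^sup>2) - 32 * h * (\<Sum>j\<le>K. (source j)\<^sup>2)
    = (h * (\<Sum>j\<le>K. (midpoint j)\<^sup>2)) / 32 - 32 * (h * (\<Sum>j\<le>K. (source j)\<^sup>2))" by simp
  moreover have "0 \<le> defect_norm + h\<^sup>2" using defect_norm_nonneg by simp
  ultimately show ?thesis using sum_source by argo
qed

text \<open>Slopes come from the first-order equation, and node values from midpoints by half a
  slope. The constant covers 51700 for the slopes and 412000 + 51700/4 for the nodes.\<close>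

lemma coercivity_defect_norm:
  assumes "0 \<le> u 0" and small: "\<Gamma> \<le> 1/128"
  shows "dform diff_seq diff_seq + S (\<lambda>j. (diff_seq j)\<^sup>2) \<le> 500000 * (defect_norm + h\<^sup>2)"
proof -
  define D where "D j = (diff_seq (Suc j) - diff_seq j) / h" for j
  have dD: "diff_seq (Suc j) - diff_seq j = h * D j" for j using h_pos by (simp add: D_def)
  have df: "dform diff_seq diff_seq = h * (\<Sum>j\<le>K. (D j)\<^sup>2)"
    unfolding dform_def dD using h_pos by (simp add: sum_distrib_left sum_divide_distrib power2_eq_square algebra_simps)
  have "(\<Sum>j\<le>K. (D j)\<^sup>2) \<le> (\<Sum>j\<le>K. 2 * (source j)\<^sup>2 + (midpoint j)\<^sup>2 / 2)"
  proof (rule sum_mono)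
    fix j assume "j \<in> {..K}"
    then have "(cmass u j * midpoint j)\<^sup>2 \<le> (1/2)\<^sup>2 * (midpoint j)\<^sup>2"
      unfolding power_mult_distrib using cmass_nonneg[of u j] cmass_u_le[of j] by (intro mult_right_mono power_mono) auto
    then have 1: "2 * (cmass u j * midpoint j)\<^sup>2 \<le> (midpoint j)\<^sup>2 / 2" by (simp add: power_divide)
    have 2: "D j = source j - cmass u j * midpoint j" using diff_seq_equation[of j] by (simp add: D_def)
    have "(a - b)\<^sup>2 \<le> 2 * a\<^sup>2 + 2 * b\<^sup>2" for a b :: real
      using zero_le_power2[of "a + b"] by (simp add: power2_sum power2_diff)
    from this[of "source j" "cmass u j * midpoint j"] show "(D j)\<^sup>2 \<le> 2 * (source j)\<^sup>2 + (midpoint j)\<^sup>2 / 2"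
      unfolding 2[symmetric] using 1 by linarith
  qed
  then have "dform diff_seq diff_seq \<le> h * (\<Sum>j\<le>K. 2 * (source j)\<^sup>2 + (midpoint j)\<^sup>2 / 2)"
    unfolding df using h_pos by (intro mult_left_mono) auto
  also have "\<dots> = 2 * (h * (\<Sum>j\<le>K. (source j)\<^sup>2)) + (h * (\<Sum>j\<le>K. (midpoint j)\<^sup>2)) / 2"
    by (simp add: sum.distrib sum_distrib_left sum_divide_distrib algebra_simps)
  also have "\<dots> \<le> 2 * (100 * (defect_norm + h\<^sup>2)) + 103000 * (defect_norm + h\<^sup>2) / 2"
    using sum_source sum_midpoint[OF assms] by linarith
  finally have 1: "dform diff_seq diff_seq \<le> 51700 * (defect_norm + h\<^sup>2)" by argo
  have "(\<Sum>j\<le>K. weight j * (diff_seq j)\<^sup>2) \<le> (\<Sum>j\<le>K. 4 * (midpoint j)\<^sup>2 + h\<^sup>2 * (D j)\<^sup>2)"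
  proof (rule sum_mono)
    fix j
    have "diff_seq j = midpoint j - h / 2 * D j" using h_pos by (simp add: midpoint_def D_def field_simps)
    then have "(diff_seq j)\<^sup>2 \<le> 2 * (midpoint j)\<^sup>2 + 2 * (h / 2 * D j)\<^sup>2"
      using zero_le_power2[of "midpoint j + h / 2 * D j"] by (simp add: power2_sum power2_diff)
    then have "2 * (diff_seq j)\<^sup>2 \<le> 4 * (midpoint j)\<^sup>2 + h\<^sup>2 * (D j)\<^sup>2" by (simp add: power_mult_distrib power_divide)
    moreover have "weight j * (diff_seq j)\<^sup>2 \<le> 2 * (diff_seq j)\<^sup>2" using weight_le_2 by (intro mult_right_mono) auto
    ultimately show "weight j * (diff_seq j)\<^sup>2 \<le> 4 * (midpoint j)\<^sup>2 + h\<^sup>2 * (D j)\<^sup>2" by linarith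
  qed
  then have "S (\<lambda>j. (diff_seq j)\<^sup>2) \<le> h * (\<Sum>j\<le>K. 4 * (midpoint j)\<^sup>2 + h\<^sup>2 * (D j)\<^sup>2)"
    unfolding S_def using h_pos by (intro mult_left_mono) auto
  also have "\<dots> = 4 * (h * (\<Sum>j\<le>K. (midpoint j)\<^sup>2)) + h\<^sup>2 * dform diff_seq diff_seq"
    unfolding df by (simp only: sum.distrib sum_distrib_left[symmetric]) (simp add: algebra_simps)
  also have "\<dots> \<le> 4 * (103000 * (defect_norm + h\<^sup>2)) + 1/4 * dform diff_seq diff_seq"
    using sum_midpoint[OF assms] h_sq_le dform_nonneg by (intro add_mono mult_left_mono mult_right_mono) auto
  finally have "S (\<lambda>j. (diff_seq j)\<^sup>2) \<le> 412000 * (defect_norm + h\<^sup>2) + 1/4 * dform diff_seq diff_seq" by simp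
  moreover have "0 \<le> defect_norm + h\<^sup>2" using defect_norm_nonneg by simp
  ultimately show ?thesis using 1 by argo
qed

end

section \<open>From the energy to the defect\<close>

context grid
begin

text \<open>For unit mass the quartic term is at most sup v^2 \<le> \<open>dform v v\<close> + 1/2.
  It consumes only half of the Dirichlet form, so the energy is at least \<open>dform v v\<close> /
  2 - 1/4.\<close>

lemma dform_bound_of_energy:
  assumes "v (Suc K) = 0" "S (\<lambda>j. (v j)\<^sup>2) = 1" "energy v \<le> 0"
  shows "dform v v \<le> 1/2"
proof -
  have "S (\<lambda>j. (v j)^4) \<le> S (\<lambda>j. (dform v v + 1/2) * (v j)\<^sup>2)"
  proof (rule S_mono)
    fix j assume "j \<le> K"
    then have "(v j)\<^sup>2 \<le> dform v v + 1/2" using sup_bound[of v j] assms by simp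
    then have "(v j)\<^sup>2 * (v j)\<^sup>2 \<le> (dform v v + 1/2) * (v j)\<^sup>2" by (rule mult_right_mono) simp
    then show "(v j)^4 \<le> (dform v v + 1/2) * (v j)\<^sup>2" by (simp add: power2_eq_square power4_eq_xxxx)
  qed
  also have "\<dots> = dform v v + 1/2" unfolding S_cmult assms(2) by simp
  finally show ?thesis using assms(3) unfolding energy_def by linarith
qed

end

context unit_profile
begin

text \<open>At \<open>K\<close> the boundary values are u = 0 and m = 1/2, which leaves 2/3 (1/2)^3
  = 1/12. Of the error terms the sum of squared differences has the favourable sign, and the cubic
  ones are of order h^2 because u^2 \<le> 1.\<close>

lemma defect_norm_le_energy: "defect_norm \<le> 2 * energy u + 1/12 + h\<^sup>2"
proof -
  have A: "(cmass u 0)^3 \<le> h^3 / 8"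
  proof -
    have "cmass u 0 \<le> h / 2" using u_sq_le[of 0] h_pos by (simp add: mult_left_le)
    then have "(cmass u 0)^3 \<le> (h / 2)^3" using cmass_nonneg[of u 0] by (rule power_mono)
    then show ?thesis by (simp add: power_divide)
  qed
  have B: "(\<Sum>j=1..K. (h * (u j)\<^sup>2)^3) \<le> h\<^sup>2 / 2"
  proof -
    have "(\<Sum>j=1..K. (h * (u j)\<^sup>2)^3) \<le> (\<Sum>j=1..K. h\<^sup>2 * (h * (u j)\<^sup>2))"
    proof (rule sum_mono)
      fix j
      have "(h * (u j)\<^sup>2)\<^sup>2 \<le> (h * 1)\<^sup>2" using u_sq_le[of j] h_pos by (intro power_mono mult_left_mono) auto
      then have "(h * (u j)\<^sup>2)\<^sup>2 * (h * (u j)\<^sup>2) \<le> h\<^sup>2 * (h * (u j)\<^sup>2)"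
        using h_pos by (intro mult_right_mono) auto
      then show "(h * (u j)\<^sup>2)^3 \<le> h\<^sup>2 * (h * (u j)\<^sup>2)" by (simp add: power2_eq_square power3_eq_cube)
    qed
    also have "\<dots> = h\<^sup>2 * (h * (\<Sum>j=1..K. (u j)\<^sup>2))" by (simp add: sum_distrib_left)
    also have "h * (\<Sum>j=1..K. (u j)\<^sup>2) \<le> cmass u K"
    proof -
      have "h * (\<Sum>j=1..n. (u j)\<^sup>2) \<le> cmass u n" for n
        using h_pos by (induction n) (auto simp: algebra_simps)
      then show ?thesis .
    qed
    finally show ?thesis unfolding cmass_u_K by (simp add: mult_left_mono)
  qed
  have C: "0 \<le> h / 2 * (\<Sum>j\<le>K. (cmass u j)\<^sup>2 * (u (Suc j) - u j)\<^sup>2)"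
    using h_pos by (intro mult_nonneg_nonneg sum_nonneg) auto
  have D: "2 / h * (\<Sum>j\<le>K. (u (Suc j) - u j)\<^sup>2) - h * (\<Sum>j\<le>K. weight j * (u j)^4) = 2 * energy u"
    by (simp add: energy_def dform_def S_def power2_eq_square)
  have "defect_norm = 2 * energy u + 1/12 + 4/3 * (cmass u 0)^3 + (\<Sum>j=1..K. (h * (u j)\<^sup>2)^3) / 3
     - h / 2 * (\<Sum>j\<le>K. (cmass u j)\<^sup>2 * (u (Suc j) - u j)\<^sup>2)"
    unfolding defect_norm_def defect_identity_aux D u_Suc_K cmass_u_K by (simp add: power3_eq_cube del: cmass.simps)
  moreover have "h^3 \<le> h\<^sup>2" using power_decreasing[of 2 3 h] h_pos h_le by simp
  ultimately show ?thesis using A B C zero_le_power2[of h] by linarith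
qed

text \<open>On a fine grid a small energy excess alone forces \<Gamma> \<le> 1/128. Closeness to the
  soliton is thus a conclusion, and the iteration only has to preserve the energy bound and the sign
  at 0.\<close>

lemma coercivity:
  assumes "0 \<le> u 0" "2 * energy u + 1/12 \<le> 1/100000" "h \<le> 1/1000"
  shows "dform (\<lambda>j. u j - soliton j) (\<lambda>j. u j - soliton j) + S (\<lambda>j. (u j - soliton j)\<^sup>2)
     \<le> 500000 * (2 * energy u + 1/12 + 2 * h\<^sup>2)"
proof -
  have h2: "h\<^sup>2 \<le> (1/1000)\<^sup>2" using assms(3) h_pos by (intro power_mono) auto
  then have "defect_norm \<le> 1/100000 + (1/1000)\<^sup>2" using defect_norm_le_energy assms(2) by linarith
  also have "\<dots> \<le> (1/256)\<^sup>2" by (simp add: power2_eq_square)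
  finally have "sqrt defect_norm \<le> 1/256" by (intro real_le_lsqrt) auto
  then have "\<Gamma> \<le> 1/128" using assms(3) unfolding \<Gamma>_def by simp
  then have "dform diff_seq diff_seq + S (\<lambda>j. (diff_seq j)\<^sup>2) \<le> 500000 * (defect_norm + h\<^sup>2)" by (rule coercivity_defect_norm[OF assms(1)])
  then show ?thesis using defect_norm_le_energy unfolding diff_seq_def by simp
qed

end

section \<open>Energy and Euler-Lagrange residual of the truncated soliton\<close>

context truncated_grid
begin

lemma dform_soliton: "dform soliton soliton \<le> 1"
proof -
  have eq: "(soliton (Suc j) - soliton j)\<^sup>2 = h\<^sup>2 * (soliton_defect j - kink j * ((soliton (Suc j) + soliton j) / 2))\<^sup>2" for j
    using h_pos by (simp add: soliton_defect_def power2_eq_square)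
  have le: "(soliton_defect j - kink j * ((soliton (Suc j) + soliton j) / 2))\<^sup>2 \<le> 2 * (soliton_defect j)\<^sup>2 + 1/4 * ((soliton j)\<^sup>2 + (soliton (Suc j))\<^sup>2)" for j
  proof -
    have "((soliton (Suc j) + soliton j) / 2)\<^sup>2 \<le> ((soliton j)\<^sup>2 + (soliton (Suc j))\<^sup>2) / 2"
      using zero_le_power2[of "soliton (Suc j) - soliton j"] by (simp add: power2_eq_square field_simps)
    then have "(kink j * ((soliton (Suc j) + soliton j) / 2))\<^sup>2 \<le> (1/2)\<^sup>2 * (((soliton j)\<^sup>2 + (soliton (Suc j))\<^sup>2) / 2)"
      unfolding power_mult_distrib using kink_nonneg[of j] kink_le_half[of j]
      by (intro mult_mono power_mono) auto
    moreover have "(a - b)\<^sup>2 \<le> 2 * a\<^sup>2 + 2 * b\<^sup>2" for a b :: real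
      using zero_le_power2[of "a + b"] by (simp add: power2_sum power2_diff)
    note this[of "soliton_defect j" "kink j * ((soliton (Suc j) + soliton j) / 2)"]
    moreover have "(1/2)\<^sup>2 * (((soliton j)\<^sup>2 + (soliton (Suc j))\<^sup>2) / 2) = 1/8 * ((soliton j)\<^sup>2 + (soliton (Suc j))\<^sup>2)"
      by (simp add: power_divide)
    ultimately show ?thesis by argo
  qed
  have "dform soliton soliton = h * (\<Sum>j\<le>K. (soliton_defect j - kink j * ((soliton (Suc j) + soliton j) / 2))\<^sup>2)"
    unfolding dform_def power2_eq_square[symmetric] eq sum_distrib_left[symmetric]
    using h_pos by (simp add: power2_eq_square)
  also have "\<dots> \<le> h * (\<Sum>j\<le>K. 2 * (soliton_defect j)\<^sup>2 + 1/4 * ((soliton j)\<^sup>2 + (soliton (Suc j))\<^sup>2))"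
    using h_pos le by (intro mult_left_mono sum_mono) auto
  also have "\<dots> = 2 * (h * (\<Sum>j\<le>K. (soliton_defect j)\<^sup>2)) + 1/4 * (h * (\<Sum>j\<le>K. (soliton j)\<^sup>2 + (soliton (Suc j))\<^sup>2))"
    unfolding sum.distrib[of "\<lambda>j. 2 * (soliton_defect j)\<^sup>2"] sum_distrib_left[symmetric] by (simp add: distrib_left)
  also have "\<dots> \<le> 2 * h\<^sup>2 + 1/4 * 2" using sum_soliton_defect sum_pairs_soliton by linarith
  finally show ?thesis using h_sq_le by linarith
qed

text \<open>The completed square read in the other direction: the defect is known to be small, and
  this bounds the energy from above. The samples are not normalized, so the mass term is only close
  to 1/12.\<close>

lemma energy_soliton: "energy soliton \<le> - 1/24 + 4 * h\<^sup>2"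
proof -
  have defect_le: "(defect soliton j)\<^sup>2 \<le> 2 * (soliton_defect j)\<^sup>2 + h\<^sup>2 / 16 * ((soliton j)\<^sup>2 + (soliton (Suc j))\<^sup>2)" if "j \<le> K" for j
  proof -
    have e: "defect soliton j = soliton_defect j + (cmass soliton j - kink j) * ((soliton (Suc j) + soliton j) / 2)"
      by (simp add: defect_def soliton_defect_def field_simps)
    have "(cmass soliton j - kink j)\<^sup>2 \<le> (h\<^sup>2 / 4)\<^sup>2"
      using power_mono[OF cmass_soliton_close[OF that] abs_ge_zero, of 2] by simp
    also have "\<dots> = h\<^sup>2 * h\<^sup>2 / 16" by (simp add: power2_eq_square)
    also have "\<dots> \<le> h\<^sup>2 * 1 / 16" using h_sq_le by (intro divide_right_mono mult_left_mono) auto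
    finally have m: "(cmass soliton j - kink j)\<^sup>2 \<le> h\<^sup>2 / 16" by simp
    have "((soliton (Suc j) + soliton j) / 2)\<^sup>2 \<le> ((soliton j)\<^sup>2 + (soliton (Suc j))\<^sup>2) / 2"
      using zero_le_power2[of "soliton (Suc j) - soliton j"] by (simp add: power2_eq_square field_simps)
    then have "((cmass soliton j - kink j) * ((soliton (Suc j) + soliton j) / 2))\<^sup>2 \<le> h\<^sup>2 / 16 * (((soliton j)\<^sup>2 + (soliton (Suc j))\<^sup>2) / 2)"
      unfolding power_mult_distrib using m by (intro mult_mono) auto
    moreover have "(a + b)\<^sup>2 \<le> 2 * a\<^sup>2 + 2 * b\<^sup>2" for a b :: real
      using zero_le_power2[of "a - b"] by (simp add: power2_sum power2_diff)
    note this[of "soliton_defect j" "(cmass soliton j - kink j) * ((soliton (Suc j) + soliton j) / 2)"]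
    ultimately show ?thesis unfolding e by argo
  qed
  have "h * (\<Sum>j\<le>K. (defect soliton j)\<^sup>2) \<le> h * (\<Sum>j\<le>K. 2 * (soliton_defect j)\<^sup>2 + h\<^sup>2 / 16 * ((soliton j)\<^sup>2 + (soliton (Suc j))\<^sup>2))"
    using h_pos defect_le by (intro mult_left_mono sum_mono) auto
  also have "\<dots> = 2 * (h * (\<Sum>j\<le>K. (soliton_defect j)\<^sup>2)) + h\<^sup>2 / 16 * (h * (\<Sum>j\<le>K. (soliton j)\<^sup>2 + (soliton (Suc j))\<^sup>2))"
    unfolding sum.distrib[of "\<lambda>j. 2 * (soliton_defect j)\<^sup>2"] sum_distrib_left[symmetric] by (simp add: distrib_left)
  also have "\<dots> \<le> 2 * h\<^sup>2 + h\<^sup>2 / 16 * 2" using sum_soliton_defect sum_pairs_soliton by (intro add_mono mult_left_mono) auto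
  finally have "2 * (h * (\<Sum>j\<le>K. (defect soliton j)\<^sup>2)) \<le> 5 * h\<^sup>2" using zero_le_power2[of h] by argo
  then have A: "2 * h * (\<Sum>j\<le>K. (defect soliton j)\<^sup>2) \<le> 5 * h\<^sup>2" by simp
  \<comment> \<open>The cube lies above its tangent at 1/2, by (t - 1/2)^2 (t + 1) \<ge> 0, so a
    mass error of order h^2 costs only order h^2.\<close>
  have B: "1/12 - h\<^sup>2 / 4 \<le> 2/3 * (cmass soliton K)^3"
  proof -
    define t where "t = cmass soliton K"
    have t0: "0 \<le> t" using cmass_nonneg by (simp add: t_def)
    have t: "1/2 - h\<^sup>2 / 2 \<le> t" using soliton_mass cmass_K[of soliton] unfolding t_def by linarith
    have "0 \<le> (t - 1/2)\<^sup>2 * (t + 1)" using t0 by simp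
    also have "(t - 1/2)\<^sup>2 * (t + 1) = t^3 - 3/4 * t + 1/4" by (simp add: power2_eq_square power3_eq_cube field_simps)
    finally show ?thesis using t unfolding t_def[symmetric] by linarith
  qed
  have C: "h / 2 * (\<Sum>j\<le>K. (cmass soliton j)\<^sup>2 * (soliton (Suc j) - soliton j)\<^sup>2) \<le> h\<^sup>2 / 2"
  proof -
    have "(\<Sum>j\<le>K. (cmass soliton j)\<^sup>2 * (soliton (Suc j) - soliton j)\<^sup>2) \<le> (\<Sum>j\<le>K. (soliton (Suc j) - soliton j)\<^sup>2)"
    proof (rule sum_mono)
      fix j assume "j \<in> {..K}"
      then have "cmass soliton j \<le> cmass soliton K" by (intro cmass_mono) simp
      also have "\<dots> \<le> 1" using cmass_K[of soliton] soliton_mass_le by simp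
      finally have "(cmass soliton j)\<^sup>2 \<le> 1" using cmass_nonneg[of soliton j] by (simp add: power_le_one)
      then show "(cmass soliton j)\<^sup>2 * (soliton (Suc j) - soliton j)\<^sup>2 \<le> (soliton (Suc j) - soliton j)\<^sup>2"
        by (simp add: mult_left_le_one_le)
    qed
    also have "\<dots> = h * dform soliton soliton" using h_pos by (simp add: dform_def power2_eq_square)
    also have "\<dots> \<le> h * 1" using dform_soliton h_pos by (intro mult_left_mono) auto
    finally show ?thesis using mult_left_mono[of _ _ "h / 2"] h_pos by (fastforce simp: power2_eq_square)
  qed
  have D: "0 \<le> 4/3 * (cmass soliton 0)^3 + (\<Sum>j=1..K. (h * (soliton j)\<^sup>2)^3) / 3"
    using h_pos cmass_nonneg[of soliton 0] by (intro add_nonneg_nonneg divide_nonneg_nonneg sum_nonneg) auto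
  have E: "2 / h * (\<Sum>j\<le>K. (soliton (Suc j) - soliton j)\<^sup>2) - h * (\<Sum>j\<le>K. weight j * (soliton j)^4) = 2 * energy soliton"
    by (simp add: energy_def dform_def S_def power2_eq_square)
  have "2 * h * (\<Sum>j\<le>K. (defect soliton j)\<^sup>2) = 2 * energy soliton + 2/3 * (cmass soliton K)^3 + 4/3 * (cmass soliton 0)^3
     + (\<Sum>j=1..K. (h * (soliton j)\<^sup>2)^3) / 3 - h / 2 * (\<Sum>j\<le>K. (cmass soliton j)\<^sup>2 * (soliton (Suc j) - soliton j)\<^sup>2)"
    unfolding defect_identity_aux E soliton_Suc_K by (simp del: cmass.simps)
  then show ?thesis using A B C D zero_le_power2[of h] by linarith
qed

text \<open>Weak form of the stationary equation - \<eta>''/2 - \<eta>^3 + \<eta>/8 = 0, tested with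
  \<open>v\<close>; 1/8 is the Lagrange multiplier of the mass constraint.\<close>

definition residual :: "(nat \<Rightarrow> real) \<Rightarrow> real" where
  "residual v = dform soliton v - S (\<lambda>j. (soliton j)^3 * v j) + S (\<lambda>j. soliton j * v j) / 8"

lemma residual_bound:
  assumes "v (Suc K) = 0"
  shows "\<bar>residual v\<bar> \<le> 3 * h\<^sup>2 * sqrt (S (\<lambda>j. (v j)\<^sup>2))"
proof -
  define \<rho> where "\<rho> j = half_lap soliton j - (soliton j)^3 + soliton j / 8" for j
  have "residual v = S (\<lambda>j. half_lap soliton j * v j) - S (\<lambda>j. (soliton j)^3 * v j) + S (\<lambda>j. 1/8 * (soliton j * v j))"
    unfolding S_cmult residual_def S_half_lap[of v soliton, OF assms] by simp
  also have "\<dots> = S (\<lambda>j. \<rho> j * v j)"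
    unfolding S_diff[symmetric] S_add[symmetric] \<rho>_def by (intro S_cong) (simp add: algebra_simps)
  finally have r: "residual v = S (\<lambda>j. \<rho> j * v j)" .
  have rho: "(\<rho> j)\<^sup>2 \<le> 2 * h^4 * (soliton j)\<^sup>2 + (if j = K then h^4 / 2 else 0)" if "j \<le> K" for j
  proof -
    have e: "soliton j = sech_sample j" using that by (simp add: soliton_def)
    have b: "\<bar>half_lap sech_sample j - (sech_sample j)^3 + sech_sample j / 8\<bar> \<le> h\<^sup>2 * soliton j" using half_lap_sech_sample[of j] by (simp add: e)
    show ?thesis
    proof (cases "j = K")
      case False
      then have "half_lap soliton j = half_lap sech_sample j" using that by (auto simp: half_lap_def soliton_def)
      then have "\<bar>\<rho> j\<bar> \<le> h\<^sup>2 * soliton j" using b by (simp add: \<rho>_def e)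
      then have "\<bar>\<rho> j\<bar>\<^sup>2 \<le> (h\<^sup>2 * soliton j)\<^sup>2" by (intro power_mono) auto
      then have "(\<rho> j)\<^sup>2 \<le> h^4 * (soliton j)\<^sup>2" by (simp add: power_mult_distrib flip: power_mult)
      also have "\<dots> \<le> 2 * (h^4 * (soliton j)\<^sup>2)" by simp
      finally show ?thesis using False by simp
    next
      case True
      \<comment> \<open>At the last node the stencil misses the sample at \<open>Suc K\<close>.
        Divided by h^2, this sample is still of order h^2.\<close>
      have "half_lap soliton j = half_lap sech_sample j + sech_sample (Suc j) / (2 * h\<^sup>2)"
        using True K_pos by (auto simp: half_lap_def soliton_def diff_divide_distrib)
      moreover have "sech_sample (Suc j) / (2 * h\<^sup>2) \<le> h^4 / (2 * h\<^sup>2)"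
        using sech_sample_K' True h_pos by (intro divide_right_mono) auto
      moreover have "h^4 / (2 * h\<^sup>2) = h\<^sup>2 / 2" using h_pos by (simp add: power2_eq_square power4_eq_xxxx)
      moreover have "0 \<le> sech_sample (Suc j) / (2 * h\<^sup>2)" using sech_sample_pos[of "Suc j"] by simp
      ultimately have "\<bar>\<rho> j\<bar> \<le> h\<^sup>2 * soliton j + h\<^sup>2 / 2" using b unfolding \<rho>_def e by linarith
      then have "\<bar>\<rho> j\<bar>\<^sup>2 \<le> (h\<^sup>2 * soliton j + h\<^sup>2 / 2)\<^sup>2" by (intro power_mono) auto
      also have "\<dots> \<le> 2 * (h\<^sup>2 * soliton j)\<^sup>2 + 2 * (h\<^sup>2 / 2)\<^sup>2"
        using zero_le_power2[of "h\<^sup>2 * soliton j - h\<^sup>2 / 2"] by (simp add: power2_sum power2_diff)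
      also have "\<dots> = 2 * h^4 * (soliton j)\<^sup>2 + h^4 / 2"
        by (simp add: power_mult_distrib power_divide flip: power_mult)
      finally show ?thesis using True by simp
    qed
  qed
  have "S (\<lambda>j. (\<rho> j)\<^sup>2) \<le> S (\<lambda>j. 2 * h^4 * (soliton j)\<^sup>2 + (if j = K then h^4 / 2 else 0))"
    by (rule S_mono) (rule rho)
  also have "\<dots> = 2 * h^4 * S (\<lambda>j. (soliton j)\<^sup>2) + h * (weight K * (h^4 / 2))"
    unfolding S_add S_cmult by (simp add: S_def if_distrib[of "\<lambda>x. weight _ * x"] cong: if_cong)
  also have "\<dots> \<le> 2 * h^4 * 2 + 1 * (2 * (h^4 / 2))"
    using soliton_mass_le weight_le_2[of K] weight_ge_1[of K] h_pos h_le
    by (intro add_mono mult_left_mono mult_mono) auto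
  also have "\<dots> \<le> (3 * h\<^sup>2)\<^sup>2" by (simp add: power_mult_distrib flip: power_mult)
  finally have "sqrt (S (\<lambda>j. (\<rho> j)\<^sup>2)) \<le> 3 * h\<^sup>2" by (intro real_le_lsqrt) auto
  then have "sqrt (S (\<lambda>j. (\<rho> j)\<^sup>2)) * sqrt (S (\<lambda>j. (v j)\<^sup>2)) \<le> 3 * h\<^sup>2 * sqrt (S (\<lambda>j. (v j)\<^sup>2))"
    by (intro mult_right_mono) (auto intro!: S_nonneg)
  then show ?thesis using S_Cauchy_Schwarz_sqrt[of \<rho> v] unfolding r by linarith
qed

text \<open>Trapezoidal rule: the energy difference is the mean of the derivatives at the two states
  in direction \<open>d\<close>, up to terms of third and fourth order. The second-order terms
  cancel, so no information on the second variation at the soliton enters. The terms with \<mu> add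
  up to zero by the mass constraint, so \<mu> is free; the Rayleigh quotient of the step, with its
  sign changed, makes the derivative at \<open>u\<close> small and is itself close to 1/8.\<close>

lemma energy_expansion:
  fixes u :: "nat \<Rightarrow> real" and \<mu> :: real
  assumes mass: "S (\<lambda>j. (u j)\<^sup>2) = 1"
  defines "d \<equiv> \<lambda>j. u j - soliton j"
  shows "energy u - energy soliton = (dform u d - S (\<lambda>j. (u j)^3 * d j) + \<mu> * S (\<lambda>j. u j * d j)) + residual d
     - (1 - S (\<lambda>j. (soliton j)\<^sup>2)) * (1/8 + \<mu>) / 2 - (\<mu> - 1/8) / 2 * S (\<lambda>j. (d j)\<^sup>2)
     + S (\<lambda>j. soliton j * (d j)^3) + S (\<lambda>j. (d j)^4) / 2"
proof -
  have u: "u j = soliton j + d j" for j by (simp add: d_def)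
  have u': "u = (\<lambda>j. soliton j + d j)" by (simp add: d_def)
  define m2 e2 e1 where "m2 = S (\<lambda>j. (d j)\<^sup>2)" and "e2 = S (\<lambda>j. (soliton j)\<^sup>2)" and "e1 = S (\<lambda>j. soliton j * d j)"
  define a b c q where "a = S (\<lambda>j. (soliton j)^3 * d j)" and "b = S (\<lambda>j. (soliton j)\<^sup>2 * (d j)\<^sup>2)"
    and "c = S (\<lambda>j. soliton j * (d j)^3)" and "q = S (\<lambda>j. (d j)^4)"
  define p where "p = S (\<lambda>j. (soliton j)^4)"
  have "S (\<lambda>j. (u j)\<^sup>2) = S (\<lambda>j. ((soliton j)\<^sup>2 + 2 * (soliton j * d j)) + (d j)\<^sup>2)"
    by (rule S_cong) (simp add: u power2_eq_square algebra_simps)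
  then have 1: "1 = e2 + 2 * e1 + m2" unfolding mass S_add S_cmult e2_def e1_def m2_def .
  have "S (\<lambda>j. u j * d j) = S (\<lambda>j. soliton j * d j + (d j)\<^sup>2)"
    by (rule S_cong) (simp add: u power2_eq_square algebra_simps)
  then have 2: "S (\<lambda>j. u j * d j) = e1 + m2" unfolding S_add e1_def m2_def .
  have "S (\<lambda>j. (u j)^4) = S (\<lambda>j. (((soliton j)^4 + 4 * ((soliton j)^3 * d j)) + 6 * ((soliton j)\<^sup>2 * (d j)\<^sup>2)) + 4 * (soliton j * (d j)^3) + (d j)^4)"
    by (rule S_cong) (simp add: u power2_eq_square power3_eq_cube power4_eq_xxxx algebra_simps)
  then have 3: "S (\<lambda>j. (u j)^4) = p + 4 * a + 6 * b + 4 * c + q"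
    unfolding S_add S_cmult a_def b_def c_def q_def p_def .
  have "S (\<lambda>j. (u j)^3 * d j) = S (\<lambda>j. (((soliton j)^3 * d j + 3 * ((soliton j)\<^sup>2 * (d j)\<^sup>2)) + 3 * (soliton j * (d j)^3)) + (d j)^4)"
    by (rule S_cong) (simp add: u power2_eq_square power3_eq_cube power4_eq_xxxx algebra_simps)
  then have 4: "S (\<lambda>j. (u j)^3 * d j) = a + 3 * b + 3 * c + q"
    unfolding S_add S_cmult a_def b_def c_def q_def .
  define A B where "A = dform soliton d" and "B = dform d d"
  have 5: "dform u u = dform soliton soliton + 2 * A + B" "dform u d = A + B"
    unfolding u' dform_add dform_add2 A_def B_def by (simp_all add: dform_sym)
  have e1: "e1 = (1 - e2 - m2) / 2" using 1 by simp
  show ?thesis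
    unfolding energy_def residual_def 2 3 4 5 m2_def[symmetric] e2_def[symmetric] a_def[symmetric] b_def[symmetric]
      c_def[symmetric] q_def[symmetric] p_def[symmetric] A_def[symmetric] B_def[symmetric]
      e1_def[symmetric]
    unfolding e1 by (simp add: field_simps)
qed

end

section \<open>Dissipation in one step of the scheme\<close>

text \<open>Here \<open>N\<close> is the norm of the intermediate state, \<open>N\<close> times
  \<open>u'\<close> that state itself, and \<open>weak\<close> its linear equation in variational
  form.\<close>

locale flow_step = unit_profile +
  fixes \<tau> :: real and u' :: "nat \<Rightarrow> real" and N :: real
  assumes \<tau>_pos: "0 < \<tau>" and \<tau>_le: "\<tau> \<le> 1/4" and N_pos: "0 < N"
    and u'_supp: "supported u'" and u'_mass: "S (\<lambda>j. (u' j)\<^sup>2) = 1"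
    and weak: "\<And>v. v (Suc K) = 0 \<Longrightarrow>
      S (\<lambda>j. u j * v j) = N * (S (\<lambda>j. u' j * v j) + \<tau> * (dform u' v - S (\<lambda>j. (u j)\<^sup>2 * (u' j * v j))))"
begin

definition Q :: "(nat \<Rightarrow> real) \<Rightarrow> (nat \<Rightarrow> real) \<Rightarrow> real" where
  "Q v w = dform v w - S (\<lambda>j. (u j)\<^sup>2 * (v j * w j))"

lemma Q_sym: "Q v w = Q w v" by (simp add: Q_def dform_sym mult.commute)
lemma Q_add: "Q (\<lambda>j. v j + v' j) w = Q v w + Q v' w"
  unfolding Q_def dform_add by (simp add: algebra_simps S_add)
lemma Q_cmult: "Q (\<lambda>j. c * v j) w = c * Q v w"
  unfolding Q_def dform_cmult by (simp add: algebra_simps S_cmult[symmetric])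
lemma Q_diff: "Q (\<lambda>j. v j - v' j) w = Q v w - Q v' w"
  unfolding Q_def dform_diff by (simp add: algebra_simps S_diff)

lemma Q_add2: "Q w (\<lambda>j. v j + v' j) = Q w v + Q w v'" using Q_add Q_sym by metis
lemma Q_cmult2: "Q w (\<lambda>j. c * v j) = c * Q w v" using Q_cmult Q_sym by metis
lemma Q_diff2: "Q w (\<lambda>j. v j - v' j) = Q w v - Q w v'" using Q_diff Q_sym by metis

lemma Q_ge: "- S (\<lambda>j. (v j)\<^sup>2) \<le> Q v v"
proof -
  have "S (\<lambda>j. (u j)\<^sup>2 * (v j * v j)) \<le> S (\<lambda>j. (v j)\<^sup>2)"
  proof (rule S_mono)
    fix j show "(u j)\<^sup>2 * (v j * v j) \<le> (v j)\<^sup>2"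
      using mult_right_mono[OF u_sq_le[of j], of "(v j)\<^sup>2"] by (simp add: power2_eq_square)
  qed
  then show ?thesis using dform_nonneg[of v] by (simp add: Q_def)
qed

lemma weak_Q: "v (Suc K) = 0 \<Longrightarrow> S (\<lambda>j. u j * v j) = N * (S (\<lambda>j. u' j * v j) + \<tau> * Q u' v)"
  using weak by (simp add: Q_def)

definition q where "q = Q u' u'"
definition a where "a = S (\<lambda>j. u j * u' j)"
definition z :: "nat \<Rightarrow> real" where "z j = u j - a * u' j"
definition \<zeta> where "\<zeta> = S (\<lambda>j. (z j)\<^sup>2)"

lemma u'_Suc_K: "u' (Suc K) = 0" using u'_supp by (simp add: supported_def)
lemma z_Suc_K: "z (Suc K) = 0" by (simp add: z_def u_Suc_K u'_Suc_K)
lemma \<zeta>_nonneg: "0 \<le> \<zeta>" by (simp add: \<zeta>_def S_nonneg)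
lemma u'_mass': "S (\<lambda>j. u' j * u' j) = 1" using u'_mass by (simp add: power2_eq_square)
lemma q_ge: "-1 \<le> q" using Q_ge[of u'] u'_mass by (simp add: q_def)
lemma a_eq: "a = N * (1 + \<tau> * q)"
  using weak_Q[of u', OF u'_Suc_K] by (simp add: a_def q_def u'_mass')
lemma factor_pos: "0 < 1 + \<tau> * q"
  using mult_left_mono[OF q_ge, of \<tau>] \<tau>_pos \<tau>_le by simp
lemma a_pos: "0 < a" using a_eq factor_pos N_pos by simp

lemma z_u': "S (\<lambda>j. z j * u' j) = 0"
proof -
  have "S (\<lambda>j. z j * u' j) = S (\<lambda>j. u j * u' j - a * (u' j * u' j))"
    by (rule S_cong) (simp add: z_def algebra_simps)
  then show ?thesis unfolding S_diff S_cmult u'_mass' by (simp add: a_def)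
qed

lemma \<zeta>_eq: "\<zeta> = 1 - a\<^sup>2"
proof -
  have "\<zeta> = S (\<lambda>j. (u j)\<^sup>2 - 2 * a * (u j * u' j) + a\<^sup>2 * (u' j)\<^sup>2)"
    unfolding \<zeta>_def by (rule S_cong) (simp add: z_def power2_eq_square algebra_simps)
  then show ?thesis unfolding S_add S_diff S_cmult u_mass u'_mass a_def[symmetric] by (simp add: power2_eq_square)
qed

lemma a_le_1: "a \<le> 1"
proof -
  have "a\<^sup>2 \<le> 1" using \<zeta>_eq \<zeta>_nonneg by simp
  then show ?thesis using power2_le_imp_le[of a 1] by simp
qed

lemma u_decomp: "u j = a * u' j + z j" by (simp add: z_def)

text \<open>Tested with \<open>z\<close>, the new iterate drops out by orthogonality and the old one
  contributes |z|^2. So the mixed term in the expansion of the quadratic form is explicitly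
  known.\<close>

lemma Q_u'_z: "N * \<tau> * Q u' z = \<zeta>"
proof -
  have "S (\<lambda>j. u j * z j) = S (\<lambda>j. a * (z j * u' j) + (z j)\<^sup>2)"
    by (rule S_cong) (simp add: z_def power2_eq_square algebra_simps)
  then have "S (\<lambda>j. u j * z j) = \<zeta>" unfolding S_add S_cmult z_u' \<zeta>_def by simp
  moreover have "S (\<lambda>j. u' j * z j) = 0" using z_u' by (simp add: mult.commute)
  ultimately show ?thesis using weak_Q[of z, OF z_Suc_K] by simp
qed

text \<open>In the expansion at u = a u' + z the mixed term yields 2 |z|^2/\<tau>. The other
  contributions are at least -2 |z|^2 because Q is bounded below by -1, and one of the two copies of
  |z|^2/\<tau> pays for them.\<close>

lemma Q_decrease: "\<zeta> / \<tau> \<le> Q u u - q"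
proof -
  have "u = (\<lambda>j. a * u' j + z j)" using u_decomp by auto
  then have "Q u u = Q (\<lambda>j. a * u' j + z j) (\<lambda>j. a * u' j + z j)" by simp
  also have "\<dots> = a * Q u' (\<lambda>j. a * u' j + z j) + Q z (\<lambda>j. a * u' j + z j)"
    unfolding Q_add Q_cmult ..
  also have "Q u' (\<lambda>j. a * u' j + z j) = a * q + Q u' z"
    unfolding Q_add2 Q_cmult2 q_def ..
  also have "Q z (\<lambda>j. a * u' j + z j) = a * Q u' z + Q z z"
    unfolding Q_add2 Q_cmult2 Q_sym[of z u'] ..
  finally have 1: "Q u u = a\<^sup>2 * q + 2 * (a * Q u' z) + Q z z" by (simp add: algebra_simps power2_eq_square)
  have "a * Q u' z * \<tau> = (1 + \<tau> * q) * (N * \<tau> * Q u' z)" unfolding a_eq by (simp add: algebra_simps)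
  also have "\<dots> = (1 + \<tau> * q) * \<zeta>" unfolding Q_u'_z ..
  finally have 2: "a * Q u' z = \<zeta> / \<tau> + q * \<zeta>" using \<tau>_pos by (simp add: field_simps)
  have 3: "a\<^sup>2 * q = q - \<zeta> * q" unfolding \<zeta>_eq by (simp add: algebra_simps)
  have "Q u u - q = 2 * (\<zeta> / \<tau>) + q * \<zeta> + Q z z" unfolding 1 2 3 by (simp add: algebra_simps)
  moreover have "- \<zeta> \<le> Q z z" using Q_ge[of z] by (simp add: \<zeta>_def)
  moreover have "- 1 * \<zeta> \<le> q * \<zeta>" using q_ge \<zeta>_nonneg by (intro mult_right_mono) auto
  moreover have "2 * \<zeta> \<le> \<zeta> / \<tau>"
  proof -
    have "2 * \<zeta> * \<tau> \<le> 1 * \<zeta>" using \<tau>_le \<zeta>_nonneg mult_right_mono[of "2 * \<tau>" 1 \<zeta>] by (simp add: algebra_simps)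
    then show ?thesis using \<tau>_pos by (simp add: pos_le_divide_eq)
  qed
  ultimately show ?thesis by linarith
qed

text \<open>Replacing the Rayleigh quotient with frozen density u^2 by the energy costs nothing: the
  discrepancy is half the sum of (u^2 - u'^2)^2, with the favourable sign.\<close>

lemma energy_decrease: "energy u' + \<zeta> / \<tau> \<le> energy u"
proof -
  have "0 \<le> S (\<lambda>j. ((u j)\<^sup>2 - (u' j)\<^sup>2)\<^sup>2)" by (simp add: S_nonneg)
  also have "\<dots> = S (\<lambda>j. ((u j)^4 - 2 * ((u j)\<^sup>2 * (u' j * u' j))) + (u' j)^4)"
    by (rule S_cong) (simp add: power2_eq_square power4_eq_xxxx algebra_simps)
  also have "\<dots> = S (\<lambda>j. (u j)^4) - 2 * S (\<lambda>j. (u j)\<^sup>2 * (u' j * u' j)) + S (\<lambda>j. (u' j)^4)"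
    unfolding S_add S_diff S_cmult ..
  finally have 1: "0 \<le> S (\<lambda>j. (u j)^4) - 2 * S (\<lambda>j. (u j)\<^sup>2 * (u' j * u' j)) + S (\<lambda>j. (u' j)^4)" .
  have 2: "S (\<lambda>j. (u j)\<^sup>2 * (u j * u j)) = S (\<lambda>j. (u j)^4)"
    by (rule S_cong) (simp add: power2_eq_square power4_eq_xxxx algebra_simps)
  show ?thesis using Q_decrease 1 2 unfolding q_def Q_def energy_def by linarith
qed

text \<open>Positivity of the form I + \<tau> Q at u - u'. The equation tested with u and u'
  evaluates the mixed and the last term as 1/N and a/N, so that 2/N \<le> 1 + 1/8 + a/N with a \<le>
  1.\<close>

lemma N_ge: "1/2 \<le> N"
proof -
  define w where "w j = u j - u' j" for j
  have "0 \<le> (1 - \<tau>) * S (\<lambda>j. (w j)\<^sup>2)" using \<tau>_le by (simp add: S_nonneg)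
  also have "\<dots> = S (\<lambda>j. (w j)\<^sup>2) + \<tau> * (- S (\<lambda>j. (w j)\<^sup>2))" by (simp add: algebra_simps)
  also have "\<dots> \<le> S (\<lambda>j. (w j)\<^sup>2) + \<tau> * Q w w" using \<tau>_pos Q_ge[of w] by (intro add_left_mono mult_left_mono) auto
  also have "Q w w = Q u u - 2 * Q u' u + Q u' u'"
  proof -
    have w: "w = (\<lambda>j. u j - u' j)" by (simp add: w_def fun_eq_iff)
    show ?thesis unfolding w Q_diff Q_diff2 Q_sym[of u u'] by simp
  qed
  also have "S (\<lambda>j. (w j)\<^sup>2) = 1 - 2 * S (\<lambda>j. u' j * u j) + 1"
  proof -
    have "S (\<lambda>j. (w j)\<^sup>2) = S (\<lambda>j. (u j)\<^sup>2 - 2 * (u' j * u j) + (u' j)\<^sup>2)"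
      by (rule S_cong) (simp add: w_def power2_eq_square algebra_simps)
    then show ?thesis unfolding S_add S_diff S_cmult u_mass u'_mass .
  qed
  finally have 0: "0 \<le> (1 + \<tau> * Q u u) - 2 * (S (\<lambda>j. u' j * u j) + \<tau> * Q u' u) + (1 + \<tau> * q)"
    by (simp add: q_def algebra_simps)
  have "N * (S (\<lambda>j. u' j * u j) + \<tau> * Q u' u) = 1"
    using weak_Q[of u, OF u_Suc_K] u_mass by (simp add: power2_eq_square)
  then have 1: "S (\<lambda>j. u' j * u j) + \<tau> * Q u' u = 1 / N" using N_pos by (simp add: field_simps)
  have 2: "1 + \<tau> * q = a / N" using a_eq N_pos by simp
  have "Q u u \<le> dform u u" by (auto simp: Q_def intro!: S_nonneg)
  then have "\<tau> * Q u u \<le> 1/4 * (1/2)"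
    using \<tau>_pos \<tau>_le u_dform dform_nonneg[of u] mult_left_mono[of "Q u u" "1/2" \<tau>] by linarith
  moreover have "a / N \<le> 1 / N" using a_le_1 N_pos by (simp add: divide_right_mono)
  ultimately have "1 / N \<le> 2" using 0 unfolding 1 2 by linarith
  then show ?thesis using N_pos by (simp add: field_simps)
qed

lemma diff_sq: "S (\<lambda>j. (u j - u' j)\<^sup>2) \<le> 2 * \<zeta>"
proof -
  have "S (\<lambda>j. (u j - u' j)\<^sup>2) = S (\<lambda>j. (u j)\<^sup>2 - 2 * (u j * u' j) + (u' j)\<^sup>2)"
    by (rule S_cong) (simp add: power2_eq_square algebra_simps)
  also have "\<dots> = 2 - 2 * a" unfolding S_add S_diff S_cmult u_mass u'_mass a_def[symmetric] by simp
  also have "\<dots> \<le> 2 * (1 - a\<^sup>2)"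
    using a_pos a_le_1 mult_right_mono[of a 1 a] by (simp add: power2_eq_square)
  finally show ?thesis by (simp add: \<zeta>_eq)
qed

text \<open>Since a = N (1 + \<tau> q), subtracting a u' in the equation of the step leaves N \<tau>
  times the residual of the eigenvalue problem for u' on one side and z on the other. Unfreezing the
  density costs 4 |z| |d|, which fits into 1/\<tau> as \<tau> \<le> 1/4.\<close>

lemma gradient_bound:
  assumes u'_dform: "dform u' u' \<le> 1/2" and d: "d (Suc K) = 0"
  shows "\<bar>dform u' d - S (\<lambda>j. (u' j)^3 * d j) + (- q) * S (\<lambda>j. u' j * d j)\<bar>
     \<le> 3 / \<tau> * sqrt \<zeta> * sqrt (S (\<lambda>j. (d j)\<^sup>2))"
proof -
  interpret u': unit_profile h K u' using u'_supp u'_mass u'_dform by unfold_locales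
  have "S (\<lambda>j. z j * d j) = S (\<lambda>j. u j * d j - a * (u' j * d j))"
    by (rule S_cong) (simp add: z_def algebra_simps)
  then have "S (\<lambda>j. z j * d j) = N * \<tau> * (Q u' d - q * S (\<lambda>j. u' j * d j))"
    unfolding S_diff S_cmult weak_Q[of d, OF d] a_eq by (simp add: algebra_simps)
  then have 1: "Q u' d - q * S (\<lambda>j. u' j * d j) = S (\<lambda>j. z j * d j) / (N * \<tau>)"
    using N_pos \<tau>_pos by (simp add: field_simps)
  define e where "e j = (u j + u' j) * (u' j * d j)" for j
  have "S (\<lambda>j. (u j)\<^sup>2 * (u' j * d j)) - S (\<lambda>j. (u' j)^3 * d j) = S (\<lambda>j. (u j - u' j) * e j)"
    unfolding S_diff[symmetric] e_def by (rule S_cong) (simp add: power2_eq_square power3_eq_cube algebra_simps)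
  then have eq: "dform u' d - S (\<lambda>j. (u' j)^3 * d j) + (- q) * S (\<lambda>j. u' j * d j)
     = S (\<lambda>j. z j * d j) / (N * \<tau>) + S (\<lambda>j. (u j - u' j) * e j)"
    using 1 unfolding Q_def by linarith
  define D where "D = sqrt (S (\<lambda>j. (d j)\<^sup>2))"
  have D0: "0 \<le> D" by (simp add: D_def S_nonneg)
  have "\<bar>S (\<lambda>j. z j * d j)\<bar> \<le> sqrt \<zeta> * D" unfolding \<zeta>_def D_def by (rule S_Cauchy_Schwarz_sqrt)
  moreover have "1 / (N * \<tau>) \<le> 2 / \<tau>" using N_ge N_pos \<tau>_pos by (simp add: field_simps)
  ultimately have "1 / (N * \<tau>) * \<bar>S (\<lambda>j. z j * d j)\<bar> \<le> 2 / \<tau> * (sqrt \<zeta> * D)"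
    using \<tau>_pos N_pos by (intro mult_mono) auto
  then have A: "\<bar>S (\<lambda>j. z j * d j) / (N * \<tau>)\<bar> \<le> 2 / \<tau> * (sqrt \<zeta> * D)"
    using \<tau>_pos N_pos by (simp add: abs_divide)
  have "S (\<lambda>j. (e j)\<^sup>2) \<le> S (\<lambda>j. 4 * (d j)\<^sup>2)"
  proof (rule S_mono)
    fix j
    have "(u j + u' j)\<^sup>2 \<le> 2 * (u j)\<^sup>2 + 2 * (u' j)\<^sup>2"
      using zero_le_power2[of "u j - u' j"] by (simp add: power2_sum power2_diff)
    also have "\<dots> \<le> 4" using u_sq_le[of j] u'.u_sq_le[of j] by simp
    finally have "(u j + u' j)\<^sup>2 * ((u' j)\<^sup>2 * (d j)\<^sup>2) \<le> 4 * (1 * (d j)\<^sup>2)"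
      using u'.u_sq_le[of j] by (intro mult_mono) auto
    then show "(e j)\<^sup>2 \<le> 4 * (d j)\<^sup>2" by (simp add: e_def power_mult_distrib)
  qed
  then have "sqrt (S (\<lambda>j. (e j)\<^sup>2)) \<le> sqrt (4 * S (\<lambda>j. (d j)\<^sup>2))" unfolding S_cmult by simp
  then have e: "sqrt (S (\<lambda>j. (e j)\<^sup>2)) \<le> 2 * D" by (simp add: D_def real_sqrt_mult)
  have "sqrt (S (\<lambda>j. (u j - u' j)\<^sup>2)) \<le> sqrt (4 * \<zeta>)" using diff_sq \<zeta>_nonneg by (intro real_sqrt_le_mono) linarith
  then have "sqrt (S (\<lambda>j. (u j - u' j)\<^sup>2)) \<le> 2 * sqrt \<zeta>" by (simp add: real_sqrt_mult)
  then have "sqrt (S (\<lambda>j. (u j - u' j)\<^sup>2)) * sqrt (S (\<lambda>j. (e j)\<^sup>2)) \<le> 2 * sqrt \<zeta> * (2 * D)"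
    using e D0 by (intro mult_mono) (auto simp: S_nonneg \<zeta>_nonneg)
  then have B: "\<bar>S (\<lambda>j. (u j - u' j) * e j)\<bar> \<le> 4 * (sqrt \<zeta> * D)"
    using S_Cauchy_Schwarz_sqrt[of "\<lambda>j. u j - u' j" e] by simp
  have "4 \<le> 1 / \<tau>" using \<tau>_pos \<tau>_le by (simp add: field_simps)
  then have "4 * (sqrt \<zeta> * D) \<le> 1 / \<tau> * (sqrt \<zeta> * D)" using D0 \<zeta>_nonneg by (intro mult_right_mono) auto
  then have "2 / \<tau> * (sqrt \<zeta> * D) + 4 * (sqrt \<zeta> * D) \<le> 2 / \<tau> * (sqrt \<zeta> * D) + 1 / \<tau> * (sqrt \<zeta> * D)"
    by (rule add_left_mono)
  also have "\<dots> = (2 / \<tau> + 1 / \<tau>) * (sqrt \<zeta> * D)" by (simp only: distrib_right)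
  also have "2 / \<tau> + 1 / \<tau> = 3 / \<tau>" by (simp add: add_divide_distrib[symmetric])
  finally have "2 / \<tau> * (sqrt \<zeta> * D) + 4 * (sqrt \<zeta> * D) \<le> 3 / \<tau> * sqrt \<zeta> * D"
    by (simp only: mult.assoc)
  with order.trans[OF abs_triangle_ineq add_mono[OF A B]] show ?thesis
    unfolding eq D_def[symmetric] by (rule order.trans)
qed

end

text \<open>The choice of \<open>\<nu>\<close> makes all terms of third and higher order in the deviation from the soliton
  absorbable by the coercivity constant \<open>500000\<close>.\<close>

locale near_flow_step = flow_step +
  fixes \<nu> :: real
  assumes \<nu>: "\<nu> = 1 / 10^9" and h_small: "h \<le> 1 / 10^13" and energy_small: "2 * energy u + 1/12 \<le> 1 / 10^24"
    and u0: "0 \<le> u 0" and u'0: "0 \<le> u' 0"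
begin

definition d where "d j = u' j - soliton j"

lemma h2_small: "h\<^sup>2 \<le> 1 / 10^26"
proof -
  have "h\<^sup>2 \<le> (1 / 10^13)\<^sup>2" using h_small h_pos by (intro power_mono) auto
  then show ?thesis by (simp add: power2_eq_square)
qed

lemma energy_u'_le: "energy u' \<le> energy u"
proof -
  have "0 \<le> \<zeta> / \<tau>" using \<zeta>_nonneg \<tau>_pos by simp
  then show ?thesis using energy_decrease by linarith
qed

lemma u'_dform: "dform u' u' \<le> 1/2"
  using dform_bound_of_energy[of u'] u'_Suc_K u'_mass energy_u'_le energy_small by simp

sublocale u': unit_profile h K u' using u'_supp u'_mass u'_dform by unfold_locales

lemma near: "dform (\<lambda>j. u j - soliton j) (\<lambda>j. u j - soliton j) + S (\<lambda>j. (u j - soliton j)\<^sup>2) \<le> \<nu>\<^sup>2"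
proof -
  have "2 * energy u + 1/12 \<le> 1/100000" "h \<le> 1/1000" using energy_small h_small by simp_all
  then have "dform (\<lambda>j. u j - soliton j) (\<lambda>j. u j - soliton j) + S (\<lambda>j. (u j - soliton j)\<^sup>2)
     \<le> 500000 * (2 * energy u + 1/12 + 2 * h\<^sup>2)" by (rule coercivity[OF u0])
  also have "\<dots> \<le> 500000 * (1 / 10^24 + 2 * (1 / 10^26))" using energy_small h2_small by simp
  also have "\<dots> \<le> \<nu>\<^sup>2" by (simp add: \<nu> power2_eq_square)
  finally show ?thesis .
qed

lemma coercive_u': "dform d d + S (\<lambda>j. (d j)\<^sup>2) \<le> 500000 * (2 * energy u' + 1/12 + 2 * h\<^sup>2)"
proof -
  have "2 * energy u' + 1/12 \<le> 1/100000" "h \<le> 1/1000" using energy_u'_le energy_small h_small by simp_all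
  then show ?thesis unfolding d_def by (rule u'.coercivity[OF u'0])
qed

lemma near': "dform d d + S (\<lambda>j. (d j)\<^sup>2) \<le> \<nu>\<^sup>2"
proof -
  note coercive_u'
  also have "500000 * (2 * energy u' + 1/12 + 2 * h\<^sup>2) \<le> 500000 * (1 / 10^24 + 2 * (1 / 10^26))"
    using energy_u'_le energy_small h2_small by simp
  also have "\<dots> \<le> \<nu>\<^sup>2" by (simp add: \<nu> power2_eq_square)
  finally show ?thesis .
qed

lemma d_Suc_K: "d (Suc K) = 0" by (simp add: d_def u'_Suc_K soliton_Suc_K)

lemma d_sup: "j \<le> K \<Longrightarrow> \<bar>d j\<bar> \<le> \<nu>"
proof -
  assume "j \<le> K"
  then have "(d j)\<^sup>2 \<le> dform d d + S (\<lambda>j. (d j)\<^sup>2) / 2" using sup_bound[of d j] d_Suc_K by simp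
  also have "\<dots> \<le> \<nu>\<^sup>2" using near' S_nonneg[of "\<lambda>j. (d j)\<^sup>2"] by simp
  finally have "\<bar>d j\<bar> \<le> \<bar>\<nu>\<bar>" by (simp only: abs_le_square_iff)
  then show ?thesis by (simp add: \<nu>)
qed

lemma residual_soliton: "\<bar>residual soliton\<bar> \<le> 5 * h\<^sup>2"
proof -
  have "sqrt (S (\<lambda>j. (soliton j)\<^sup>2)) \<le> 3/2" using soliton_mass_le by (intro real_le_lsqrt) (auto simp: power2_eq_square)
  then have "3 * h\<^sup>2 * sqrt (S (\<lambda>j. (soliton j)\<^sup>2)) \<le> 3 * h\<^sup>2 * (3/2)" by (intro mult_left_mono) auto
  then show ?thesis using residual_bound[of soliton, OF soliton_Suc_K] zero_le_power2[of h] by linarith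
qed

lemma S_prod_diff_bound:
  assumes "S (\<lambda>j. (v j - soliton j)\<^sup>2) \<le> \<nu>\<^sup>2" "S (\<lambda>j. (v j)\<^sup>2) = 1" "\<And>j. (c j)\<^sup>2 \<le> 1"
  shows "\<bar>S (\<lambda>j. (c j)\<^sup>2 * ((v j)\<^sup>2 - (soliton j)\<^sup>2))\<bar> \<le> 3 * \<nu>"
proof -
  define w where "w j = (c j)\<^sup>2 * (v j + soliton j)" for j
  have "S (\<lambda>j. (c j)\<^sup>2 * ((v j)\<^sup>2 - (soliton j)\<^sup>2)) = S (\<lambda>j. (v j - soliton j) * w j)"
    unfolding w_def by (rule S_cong) (simp add: power2_eq_square algebra_simps)
  moreover have "S (\<lambda>j. (w j)\<^sup>2) \<le> S (\<lambda>j. 2 * (v j)\<^sup>2 + 2 * (soliton j)\<^sup>2)"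
  proof (rule S_mono)
    fix j
    have "((c j)\<^sup>2)\<^sup>2 * (v j + soliton j)\<^sup>2 \<le> 1 * (v j + soliton j)\<^sup>2"
      by (rule mult_right_mono[OF power_le_one[OF zero_le_power2 assms(3)]]) simp
    also have "\<dots> \<le> 2 * (v j)\<^sup>2 + 2 * (soliton j)\<^sup>2"
      using zero_le_power2[of "v j - soliton j"] by (simp add: power2_sum power2_diff)
    finally show "(w j)\<^sup>2 \<le> 2 * (v j)\<^sup>2 + 2 * (soliton j)\<^sup>2" by (simp add: w_def power_mult_distrib)
  qed
  then have "S (\<lambda>j. (w j)\<^sup>2) \<le> 3\<^sup>2" unfolding S_add S_cmult assms(2) using soliton_mass_le by simp
  then have "sqrt (S (\<lambda>j. (w j)\<^sup>2)) \<le> 3" by (intro real_le_lsqrt) auto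
  moreover have "sqrt (S (\<lambda>j. (v j - soliton j)\<^sup>2)) \<le> \<nu>" using assms(1) by (intro real_le_lsqrt) (auto simp: \<nu>)
  ultimately have "sqrt (S (\<lambda>j. (v j - soliton j)\<^sup>2)) * sqrt (S (\<lambda>j. (w j)\<^sup>2)) \<le> \<nu> * 3"
    by (intro mult_mono) (auto simp: S_nonneg \<nu>)
  then show ?thesis using S_Cauchy_Schwarz_sqrt[of "\<lambda>j. v j - soliton j" w]
    \<open>S (\<lambda>j. (c j)\<^sup>2 * ((v j)\<^sup>2 - (soliton j)\<^sup>2)) = S (\<lambda>j. (v j - soliton j) * w j)\<close> by simp
qed

text \<open>Replacing u and u' by the soliton moves the Rayleigh quotient by order \<nu>. At the
  soliton, \<open>residual\<close> tested with the soliton itself shows that it is -1/8 up to order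
  h^2.\<close>

lemma q_near: "\<bar>- q - 1/8\<bar> \<le> 10 * \<nu>"
proof -
  have 1: "\<bar>S (\<lambda>j. (u j)\<^sup>2 * ((u' j)\<^sup>2 - (soliton j)\<^sup>2))\<bar> \<le> 3 * \<nu>"
    using near' dform_nonneg[of d] u'_mass u_sq_le by (intro S_prod_diff_bound) (auto simp: d_def)
  have 2: "\<bar>S (\<lambda>j. (soliton j)\<^sup>2 * ((u j)\<^sup>2 - (soliton j)\<^sup>2))\<bar> \<le> 3 * \<nu>"
  proof (rule S_prod_diff_bound)
    show "S (\<lambda>j. (u j - soliton j)\<^sup>2) \<le> \<nu>\<^sup>2" using near dform_nonneg[of "\<lambda>j. u j - soliton j"] by linarith
    show "(soliton j)\<^sup>2 \<le> 1" for j using soliton_le_half[of j] soliton_nonneg[of j] by (intro power_le_one) auto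
  qed (rule u_mass)
  have e: "S (\<lambda>j. (u j)\<^sup>2 * (u' j * u' j)) = S (\<lambda>j. (u j)\<^sup>2 * ((u' j)\<^sup>2 - (soliton j)\<^sup>2))
      + S (\<lambda>j. (soliton j)\<^sup>2 * ((u j)\<^sup>2 - (soliton j)\<^sup>2)) + S (\<lambda>j. (soliton j)^3 * soliton j)"
    unfolding S_add[symmetric] by (rule S_cong) (simp add: power2_eq_square power3_eq_cube algebra_simps)
  have "u' = (\<lambda>j. soliton j + d j)" by (simp add: d_def)
  then have "dform u' u' = dform (\<lambda>j. soliton j + d j) (\<lambda>j. soliton j + d j)" by simp
  also have "\<dots> = dform soliton soliton + 2 * dform soliton d + dform d d"
    unfolding dform_add dform_add2 by (simp add: dform_sym)
  finally have f: "dform u' u' = dform soliton soliton + 2 * dform soliton d + dform d d" .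
  have diff_seq: "dform d d \<le> \<nu>\<^sup>2" using near' S_nonneg[of "\<lambda>j. (d j)\<^sup>2"] by simp
  have "(dform soliton d)\<^sup>2 \<le> 1 * \<nu>\<^sup>2"
    by (rule order.trans[OF dform_Cauchy_Schwarz mult_mono[OF dform_soliton diff_seq]]) (auto simp: dform_nonneg)
  then have "\<bar>dform soliton d\<bar> \<le> \<bar>\<nu>\<bar>" by (simp only: abs_le_square_iff mult_1)
  then have g: "\<bar>dform soliton d\<bar> \<le> \<nu>" by (simp add: \<nu>)
  have mass: "S (\<lambda>j. soliton j * soliton j) = S (\<lambda>j. (soliton j)\<^sup>2)" by (simp add: power2_eq_square)
  have r: "dform soliton soliton - S (\<lambda>j. (soliton j)^3 * soliton j) = residual soliton - S (\<lambda>j. (soliton j)\<^sup>2) / 8"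
    unfolding residual_def mass by simp
  define x y1 y2 where "x = (S (\<lambda>j. (soliton j)\<^sup>2) - 1) / 8"
    and "y1 = S (\<lambda>j. (u j)\<^sup>2 * ((u' j)\<^sup>2 - (soliton j)\<^sup>2))"
    and "y2 = S (\<lambda>j. (soliton j)\<^sup>2 * ((u j)\<^sup>2 - (soliton j)\<^sup>2))"
  have x: "\<bar>x\<bar> \<le> h\<^sup>2" using soliton_mass zero_le_power2[of h] unfolding x_def abs_divide by simp
  have "q + 1/8 = (residual soliton - x) + 2 * dform soliton d + dform d d - y1 - y2"
    using r unfolding q_def Q_def e f x_def y1_def y2_def by (simp add: diff_divide_distrib)
  moreover have "\<nu>\<^sup>2 \<le> \<nu> / 2" by (simp add: \<nu> power2_eq_square)
  moreover have "6 * h\<^sup>2 \<le> \<nu> / 2" using h2_small by (simp add: \<nu>)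
  ultimately show ?thesis
    using 1[folded y1_def] 2[folded y2_def] g diff_seq dform_nonneg[of d] residual_soliton x by linarith
qed

text \<open>A Lojasiewicz inequality with exponent 1/2: the excess is bounded by the square of the
  gradient, measured by |z|/\<tau>. \<open>energy_expansion\<close> bounds the excess by gradient
  times distance, and coercivity bounds the distance by the root of the excess.\<close>

lemma gradient_inequality: "2 * energy u' + 1/12 \<le> 100000000 * (\<zeta> / \<tau>\<^sup>2) + 100 * h\<^sup>2"
proof -
  define P where "P = 2 * energy u' + 1/12 + 2 * h\<^sup>2"
  define D where "D = sqrt (S (\<lambda>j. (d j)\<^sup>2))"
  define Z where "Z = sqrt \<zeta> / \<tau>"
  have D2: "D\<^sup>2 = S (\<lambda>j. (d j)\<^sup>2)" by (simp add: D_def S_nonneg)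
  have Z2: "Z\<^sup>2 = \<zeta> / \<tau>\<^sup>2" using \<zeta>_nonneg by (simp add: Z_def power_divide)
  have D0: "0 \<le> D" by (simp add: D_def S_nonneg)
  have DP: "D\<^sup>2 \<le> 500000 * P" using coercive_u' dform_nonneg[of d] unfolding D2 P_def by linarith
  define R where "R = dform u' d - S (\<lambda>j. (u' j)^3 * d j) + (- q) * S (\<lambda>j. u' j * d j)"
  have R: "R \<le> 3 * Z * D"
    using gradient_bound[of d, OF u'_dform d_Suc_K] unfolding R_def D_def[symmetric] Z_def by simp
  have res: "residual d \<le> 3 * h\<^sup>2 * D"
    using residual_bound[of d, OF d_Suc_K] unfolding D_def by linarith
  define T1 T2 where "T1 = (1 - S (\<lambda>j. (soliton j)\<^sup>2)) * (1/8 + (- q)) / 2" and "T2 = ((- q) - 1/8) / 2 * D\<^sup>2"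
  have exp: "energy u' - energy soliton = R + residual d - T1 - T2
     + S (\<lambda>j. soliton j * (d j)^3) + S (\<lambda>j. (d j)^4) / 2"
    using energy_expansion[OF u'_mass, of "- q"] unfolding R_def D2 d_def T1_def T2_def .
  have t1: "- T1 \<le> h\<^sup>2"
  proof -
    have "\<bar>1/8 + (- q)\<bar> \<le> 1" 
    proof -
      have "10 * \<nu> \<le> 1/8" by (simp add: \<nu>)
      then show ?thesis using q_near by linarith
    qed
    then have "\<bar>1 - S (\<lambda>j. (soliton j)\<^sup>2)\<bar> * \<bar>1/8 + (- q)\<bar> \<le> h\<^sup>2 * 1"
      using soliton_mass by (intro mult_mono) auto
    then have "\<bar>T1\<bar> \<le> h\<^sup>2 / 2" unfolding T1_def abs_divide abs_mult by simp
    then show ?thesis using zero_le_power2[of h] by linarith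
  qed
  have "- (X / 2) \<le> 5 * \<nu>" if "\<bar>X\<bar> \<le> 10 * \<nu>" for X using that by linarith
  from this[OF q_near] have "- (((- q) - 1/8) / 2) * D\<^sup>2 \<le> 5 * \<nu> * D\<^sup>2"
    by (intro mult_right_mono) simp_all
  then have t2: "- T2 \<le> 5 * \<nu> * D\<^sup>2" unfolding T2_def by simp
  have t3: "S (\<lambda>j. soliton j * (d j)^3) \<le> \<nu> * D\<^sup>2"
  proof -
    have "S (\<lambda>j. soliton j * (d j)^3) \<le> S (\<lambda>j. \<nu> * (d j)\<^sup>2)"
    proof (rule S_mono)
      fix j assume j: "j \<le> K"
      have "soliton j * d j \<le> \<bar>soliton j\<bar> * \<bar>d j\<bar>" by (simp flip: abs_mult)
      also have "\<dots> \<le> 1 * \<nu>" using soliton_le_half[of j] soliton_nonneg[of j] d_sup[OF j] by (intro mult_mono) auto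
      finally have "soliton j * d j * (d j)\<^sup>2 \<le> \<nu> * (d j)\<^sup>2" by (intro mult_right_mono) auto
      then show "soliton j * (d j)^3 \<le> \<nu> * (d j)\<^sup>2" by (simp add: power2_eq_square power3_eq_cube)
    qed
    then show ?thesis unfolding S_cmult D2 .
  qed
  have t4: "S (\<lambda>j. (d j)^4) / 2 \<le> \<nu> * D\<^sup>2"
  proof -
    have "S (\<lambda>j. (d j)^4) \<le> S (\<lambda>j. \<nu> * (d j)\<^sup>2)"
    proof (rule S_mono)
      fix j assume j: "j \<le> K"
      have "\<bar>d j\<bar>\<^sup>2 \<le> \<nu>\<^sup>2" using d_sup[OF j] by (intro power_mono) auto
      also have "\<dots> \<le> \<nu>" by (simp add: \<nu> power2_eq_square)
      finally have "(d j)\<^sup>2 * (d j)\<^sup>2 \<le> \<nu> * (d j)\<^sup>2" by (intro mult_right_mono) auto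
      then show "(d j)^4 \<le> \<nu> * (d j)\<^sup>2" by (simp add: power2_eq_square power4_eq_xxxx)
    qed
    moreover have "0 \<le> \<nu> * D\<^sup>2" by (simp add: \<nu>)
    ultimately show ?thesis unfolding S_cmult D2[symmetric] by linarith
  qed
  have "energy u' \<le> - 1/24 + 4 * h\<^sup>2 + 3 * Z * D + 3 * h\<^sup>2 * D + h\<^sup>2 + 7 * \<nu> * D\<^sup>2"
    using exp R res t1 t2 t3 t4 energy_soliton by linarith
  then have main: "P \<le> 12 * h\<^sup>2 + 6 * (Z * D) + 6 * (h\<^sup>2 * D) + 14 * \<nu> * D\<^sup>2"
    unfolding P_def by argo
  \<comment> \<open>The weight in Young's inequality is chosen so that, by \<open>DP\<close>, each
    of the three terms with \<open>D^2\<close> is at most P/16.\<close>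
  have y: "6 * (x * D) \<le> 1/8000000 * D\<^sup>2 + 72000000 * x\<^sup>2" for x
    using zero_le_power2[of "D - 24000000 * x"] by (simp add: power2_diff power_mult_distrib mult.commute[of x D])
  have "(h\<^sup>2)\<^sup>2 \<le> h\<^sup>2 * (1 / 10^26)" unfolding power2_eq_square[of "h\<^sup>2"]
    using h2_small by (intro mult_left_mono) auto
  then have "72000000 * (h\<^sup>2)\<^sup>2 \<le> 72000000 * (h\<^sup>2 * (1 / 10^26))" by (intro mult_left_mono) auto
  also have "\<dots> \<le> h\<^sup>2" by simp
  finally have h4: "72000000 * (h\<^sup>2)\<^sup>2 \<le> h\<^sup>2" .
  have "14 * \<nu> * D\<^sup>2 \<le> 1/8000000 * D\<^sup>2" by (intro mult_right_mono) (auto simp: \<nu>)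
  then have "P \<le> 13 * h\<^sup>2 + 3/8000000 * D\<^sup>2 + 72000000 * Z\<^sup>2"
    using main y[of Z] y[of "h\<^sup>2"] h4 by argo
  then have "P \<le> 13 * h\<^sup>2 + 3/16 * P + 72000000 * Z\<^sup>2" using DP by argo
  then have "13/16 * P \<le> 13 * h\<^sup>2 + 72000000 * Z\<^sup>2" by argo
  then have "P \<le> 100 * h\<^sup>2 + 100000000 * Z\<^sup>2" using zero_le_power2[of h] zero_le_power2[of Z] by argo
  then show ?thesis unfolding P_def Z2 using zero_le_power2[of h] by argo
qed

end

section \<open>Tridiagonal systems by shooting\<close>

context
  fixes c :: "nat \<Rightarrow> real" and K :: nat
  assumes c_gt: "\<And>j. 2 < c j"
begin

text \<open>Runs from the outer end inwards: entry \<open>i\<close> is the unknown at K + 1 - i. The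
  value 0 is the boundary condition at K + 1, and \<open>s\<close> is the trial value at K.\<close>

fun shoot :: "(nat \<Rightarrow> real) \<Rightarrow> real \<Rightarrow> nat \<Rightarrow> real" where
  "shoot b s 0 = 0"
| "shoot b s (Suc 0) = s"
| "shoot b s (Suc (Suc i)) = c (K - i) * shoot b s (Suc i) - shoot b s i - b (K - i)"

lemma shoot_affine: "shoot b s i = shoot b 0 i + s * shoot (\<lambda>_. 0) 1 i"
  by (induction b s i rule: shoot.induct) (simp_all add: algebra_simps)

text \<open>Diagonal dominance makes the homogeneous solution grow towards the origin. The remaining
  equation there is then affine in the trial value with positive slope, hence solvable.\<close>

lemma shoot_mono: "0 \<le> shoot (\<lambda>_. 0) 1 i \<and> shoot (\<lambda>_. 0) 1 i \<le> shoot (\<lambda>_. 0) 1 (Suc i) \<and> 1 \<le> shoot (\<lambda>_. 0) 1 (Suc i)"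
proof (induction i)
  case (Suc i)
  define x y where "x = shoot (\<lambda>_. 0) 1 i" and "y = shoot (\<lambda>_. 0) 1 (Suc i)"
  have xy: "0 \<le> x" "x \<le> y" "1 \<le> y" using Suc by (auto simp: x_def y_def)
  have "2 * y \<le> c (K - i) * y" using c_gt[of "K - i"] xy by (intro mult_right_mono) auto
  then have "y \<le> c (K - i) * y - x" using xy by linarith
  then show ?case using xy by (simp add: x_def y_def)
qed simp

lemma tridiagonal_solution:
  "\<exists>x. (\<forall>j>K. x j = 0) \<and> (\<forall>j. 1 \<le> j \<and> j \<le> K \<longrightarrow> c j * x j - x (j - 1) - x (Suc j) = b j)
     \<and> c 0 * x 0 - 2 * x 1 = (b 0 :: real)"
proof -
  define q where "q = shoot (\<lambda>_. 0) 1"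
  define p where "p = shoot b 0"
  have "2 * q K \<le> 2 * q (Suc K)" using shoot_mono[of K] by (simp add: q_def)
  also have "\<dots> < c 0 * q (Suc K)" using c_gt[of 0] shoot_mono[of K] by (intro mult_strict_right_mono) (auto simp: q_def)
  finally have pos: "0 < c 0 * q (Suc K) - 2 * q K" by simp
  define s where "s = (b 0 - (c 0 * p (Suc K) - 2 * p K)) / (c 0 * q (Suc K) - 2 * q K)"
  define y where "y = shoot b s"
  have y: "y i = p i + s * q i" for i unfolding y_def p_def q_def by (rule shoot_affine)
  have "s * (c 0 * q (Suc K) - 2 * q K) = b 0 - (c 0 * p (Suc K) - 2 * p K)"
    using pos by (simp add: s_def)
  then have y0: "c 0 * y (Suc K) - 2 * y K = b 0" unfolding y by (simp add: algebra_simps)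
  define x where "x j = (if j \<le> K then y (Suc K - j) else 0)" for j
  have xS: "x (Suc j) = y (K - j)" if "j \<le> K" for j
    using that by (cases "j = K") (auto simp: x_def y_def)
  have "c j * x j - x (j - 1) - x (Suc j) = b j" if j: "1 \<le> j" "j \<le> K" for j
  proof -
    define i where "i = K - j"
    have "y (Suc (Suc i)) = c (K - i) * y (Suc i) - y i - b (K - i)" by (simp add: y_def)
    moreover have "j - 1 \<le> K" "K - i = j" "Suc K - j = Suc i" "Suc K - (j - 1) = Suc (Suc i)" using j by (auto simp: i_def)
    ultimately show ?thesis using j xS[of j] by (simp add: x_def i_def)
  qed
  moreover have "c 0 * x 0 - 2 * x 1 = b 0" using y0 xS[of 0] by (simp add: x_def)
  ultimately show ?thesis by (intro exI[of _ x]) (auto simp: x_def)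
qed

end

section \<open>Existence and variational form of the implicit step\<close>

context grid
begin

definition implicit_step :: "real \<Rightarrow> (nat \<Rightarrow> real) \<Rightarrow> (nat \<Rightarrow> real) \<Rightarrow> bool" where
  "implicit_step \<tau> u x \<longleftrightarrow> supported x \<and> (\<forall>j\<le>K. x j + \<tau> * (half_lap x j - (u j)\<^sup>2 * x j) = u j)"

lemma implicit_step_exists:
  assumes "0 < \<tau>" "\<tau> \<le> 1/4" "\<And>j. (u j)\<^sup>2 \<le> 1"
  shows "\<exists>x. implicit_step \<tau> u x"
proof -
  \<comment> \<open>Multiplication by 2 h^2 / \<tau> makes the off-diagonal entries -1 (-2 in the
    row of the origin). The diagonal then exceeds 2 because \<tau> u^2 \<le> 1/4.\<close>
  define g where "g = 2 * h\<^sup>2 / \<tau>"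
  have g: "0 < g" using assms h_pos by (simp add: g_def)
  define c where "c j = g * (1 - \<tau> * (u j)\<^sup>2) + 2" for j
  define b where "b j = g * u j" for j
  have c: "2 < c j" for j
  proof -
    have "\<tau> * (u j)\<^sup>2 \<le> 1/4 * 1" using assms by (intro mult_mono) auto
    then have "0 < g * (1 - \<tau> * (u j)\<^sup>2)" using g by (intro mult_pos_pos) auto
    then show ?thesis by (simp add: c_def)
  qed
  obtain x where x: "\<And>j. j > K \<Longrightarrow> x j = 0" "\<And>j. 1 \<le> j \<Longrightarrow> j \<le> K \<Longrightarrow> c j * x j - x (j - 1) - x (Suc j) = b j"
    "c 0 * x 0 - 2 * x 1 = b 0" using tridiagonal_solution[of c K b] c by auto
  have scale: "g * \<tau> / (2 * h\<^sup>2) = 1" using assms h_pos by (simp add: g_def)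
  have "x j + \<tau> * (half_lap x j - (u j)\<^sup>2 * x j) = u j" if "j \<le> K" for j
  proof -
    have "g * (\<tau> * half_lap x j) = 2 * h\<^sup>2 * half_lap x j" using assms by (simp add: g_def)
    also have "\<dots> = (if j = 0 then 2 * x 0 - 2 * x 1 else 2 * x j - x (j - 1) - x (Suc j))"
      using h_pos by (simp add: half_lap_def)
    finally have n: "g * (\<tau> * half_lap x j) = (if j = 0 then 2 * x 0 - 2 * x 1 else 2 * x j - x (j - 1) - x (Suc j))" .
    have "c j * x j = g * (x j - \<tau> * (u j)\<^sup>2 * x j) + 2 * x j" by (simp add: c_def algebra_simps)
    then have "g * (x j - \<tau> * (u j)\<^sup>2 * x j) + g * (\<tau> * half_lap x j) = g * u j"
      using x(2)[of j] x(3) that unfolding n b_def by (cases "j = 0") auto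
    then have "g * (x j + \<tau> * (half_lap x j - (u j)\<^sup>2 * x j)) = g * u j" by (simp add: algebra_simps)
    then show ?thesis using g by simp
  qed
  then show ?thesis using x(1) unfolding implicit_step_def supported_def by blast
qed

definition normalize :: "(nat \<Rightarrow> real) \<Rightarrow> nat \<Rightarrow> real" where
  "normalize x j = x j / sqrt (S (\<lambda>j. (x j)\<^sup>2))"

end

context unit_profile
begin

text \<open>A vanishing solution would force u = 0 through the equation, against unit mass. This is
  what makes the normalization a genuine division.\<close>

lemma implicit_step_nonzero:
  assumes "implicit_step \<tau> u x" shows "0 < S (\<lambda>j. (x j)\<^sup>2)"
proof (rule ccontr)
  assume "\<not> 0 < S (\<lambda>j. (x j)\<^sup>2)"
  then have z: "S (\<lambda>j. (x j)\<^sup>2) = 0" using S_nonneg[of "\<lambda>j. (x j)\<^sup>2"] by simp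
  have xz: "x j = 0" for j
  proof (cases "j \<le> K")
    case True
    have "weight j * (x j)\<^sup>2 \<le> (\<Sum>j\<le>K. weight j * (x j)\<^sup>2)"
    proof (rule member_le_sum[of j "{..K}" "\<lambda>j. weight j * (x j)\<^sup>2"])
      show "0 \<le> weight i * (x i)\<^sup>2" for i using weight_ge_1[of i] by simp
    qed (simp_all add: True)
    also have "\<dots> = 0" using z h_pos by (simp add: S_def)
    finally have "weight j * (x j)\<^sup>2 \<le> 0" .
    then show ?thesis using weight_ge_1[of j] by (auto simp: mult_le_0_iff)
  next
    case False
    then show ?thesis using assms by (simp add: implicit_step_def supported_def)
  qed
  have "u j = 0" if "j \<le> K" for j
  proof -
    have "x j + \<tau> * (half_lap x j - (u j)\<^sup>2 * x j) = u j" using assms that by (simp add: implicit_step_def)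
    then show ?thesis by (simp add: half_lap_def xz split: if_splits)
  qed
  then have "S (\<lambda>j. (u j)\<^sup>2) = S (\<lambda>j. 0)" by (intro S_cong) simp
  moreover have "S (\<lambda>j. 0) = 0" by (simp add: S_def)
  ultimately show False using u_mass by simp
qed

lemma flow_step_normalize:
  assumes \<tau>: "0 < \<tau>" "\<tau> \<le> 1/4" and x: "implicit_step \<tau> u x"
  shows "flow_step h K u \<tau> (normalize x) (sqrt (S (\<lambda>j. (x j)\<^sup>2)))"
proof -
  define N where "N = sqrt (S (\<lambda>j. (x j)\<^sup>2))"
  have N: "0 < N" using implicit_step_nonzero[OF x] by (simp add: N_def)
  have N2: "N\<^sup>2 = S (\<lambda>j. (x j)\<^sup>2)" using implicit_step_nonzero[OF x] by (simp add: N_def)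
  define v where "v = normalize x"
  have xv: "x = (\<lambda>j. N * v j)" using N by (auto simp: v_def normalize_def N_def)
  have "S (\<lambda>j. (x j)\<^sup>2) = N\<^sup>2 * S (\<lambda>j. (v j)\<^sup>2)"
    unfolding S_cmult[symmetric] by (rule S_cong) (simp add: xv power_mult_distrib)
  then have "N\<^sup>2 * S (\<lambda>j. (v j)\<^sup>2) = N\<^sup>2" unfolding N2[symmetric] by (rule sym)
  then have mass: "S (\<lambda>j. (v j)\<^sup>2) = 1" using N by simp
  have supp: "supported v" using x by (auto simp: v_def normalize_def implicit_step_def supported_def)
  have weak: "S (\<lambda>j. u j * w j) = N * (S (\<lambda>j. v j * w j) + \<tau> * (dform v w - S (\<lambda>j. (u j)\<^sup>2 * (v j * w j))))"
    if w: "w (Suc K) = 0" for w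
  proof -
    have "S (\<lambda>j. u j * w j) = S (\<lambda>j. (x j + \<tau> * (half_lap x j - (u j)\<^sup>2 * x j)) * w j)"
      using x by (intro S_cong) (simp add: implicit_step_def)
    also have "\<dots> = S (\<lambda>j. (x j * w j + \<tau> * (half_lap x j * w j)) - \<tau> * ((u j)\<^sup>2 * (x j * w j)))"
      by (rule S_cong) (simp add: algebra_simps)
    also have "\<dots> = S (\<lambda>j. x j * w j) + \<tau> * dform x w - \<tau> * S (\<lambda>j. (u j)\<^sup>2 * (x j * w j))"
      unfolding S_add S_diff S_cmult S_half_lap[of w x, OF w] ..
    also have "S (\<lambda>j. x j * w j) = N * S (\<lambda>j. v j * w j)" unfolding xv S_cmult[symmetric] by (simp add: mult.assoc)
    also have "S (\<lambda>j. (u j)\<^sup>2 * (x j * w j)) = N * S (\<lambda>j. (u j)\<^sup>2 * (v j * w j))"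
      unfolding xv S_cmult[symmetric] by (simp add: mult.assoc mult.left_commute)
    also have "dform x w = N * dform v w" unfolding xv dform_cmult ..
    finally show ?thesis by (simp add: algebra_simps)
  qed
  show ?thesis unfolding N_def[symmetric] v_def[symmetric]
    by unfold_locales (use \<tau> N mass supp weak in auto)
qed

end

section \<open>An invariant set of states and the decay along a trajectory\<close>

context truncated_grid
begin

text \<open>Only the energy excess and the sign at 0 are recorded: both can be propagated by a step,
  and coercivity recovers the closeness to the soliton from them.\<close>

definition good :: "(nat \<Rightarrow> real) \<Rightarrow> bool" where
  "good u \<longleftrightarrow> supported u \<and> S (\<lambda>j. (u j)\<^sup>2) = 1 \<and> 2 * energy u + 1/12 \<le> 1 / 10^24 \<and> 0 \<le> u 0"

definition deviation :: "(nat \<Rightarrow> real) \<Rightarrow> real" where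
  "deviation u = dform (\<lambda>j. u j - soliton j) (\<lambda>j. u j - soliton j) + S (\<lambda>j. (u j - soliton j)\<^sup>2)"

lemma good_unit_profile: "good u \<Longrightarrow> unit_profile h K u"
proof
  assume g: "good u"
  then show "supported u" "S (\<lambda>j. (u j)\<^sup>2) = 1" by (auto simp: good_def)
  have "u (Suc K) = 0" "energy u \<le> 0" using g by (auto simp: good_def supported_def)
  then show "dform u u \<le> 1/2" using g dform_bound_of_energy[of u] by (auto simp: good_def)
qed

lemma good_deviation:
  assumes "good u" "h \<le> 1 / 10^13"
  shows "deviation u \<le> 500000 * (2 * energy u + 1/12 + 2 * h\<^sup>2)"
proof -
  interpret unit_profile h K u by (rule good_unit_profile[OF assms(1)])
  have "0 \<le> u 0" "2 * energy u + 1/12 \<le> 1/100000" "h \<le> 1/1000"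
    using assms by (auto simp: good_def)
  then show ?thesis unfolding deviation_def by (rule coercivity)
qed

lemma good_small:
  assumes "good u" "h \<le> 1 / 10^13" shows "S (\<lambda>j. (u j - soliton j)\<^sup>2) \<le> 1/100"
proof -
  have "h\<^sup>2 \<le> (1 / 10^13)\<^sup>2" using assms h_pos by (intro power_mono) auto
  then have "deviation u \<le> 500000 * (1 / 10^24 + 2 * (1 / 10^13)\<^sup>2)"
    using good_deviation[OF assms] assms(1) unfolding good_def by argo
  also have "\<dots> \<le> 1/100" by (simp add: power2_eq_square)
  finally show ?thesis using dform_nonneg[of "\<lambda>j. u j - soliton j"] unfolding deviation_def by linarith
qed

lemma good_step:
  assumes g: "good u" and h: "h \<le> 1 / 10^13" and \<tau>: "0 < \<tau>" "\<tau> \<le> 1/4" and x: "implicit_step \<tau> u x"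
  defines "v \<equiv> normalize x"
  shows "good v" "(2 * energy v + 1/12 - 100 * h\<^sup>2) * (1 + 2 / 10^8 * \<tau>) \<le> 2 * energy u + 1/12 - 100 * h\<^sup>2"
proof -
  interpret unit_profile h K u by (rule good_unit_profile[OF g])
  interpret flow_step h K u \<tau> v "sqrt (S (\<lambda>j. (x j)\<^sup>2))"
    unfolding v_def by (rule flow_step_normalize[OF \<tau> x])
  have "0 \<le> \<zeta> / \<tau>" using \<zeta>_nonneg \<tau> by simp
  then have ev: "energy v \<le> energy u" using energy_decrease by linarith
  have eu: "2 * energy u + 1/12 \<le> 1 / 10^24" using g by (simp add: good_def)
  \<comment> \<open>The sign cannot flip. Otherwise - v would be \<open>good\<close> and hence, like
    u, near the soliton, so that |u + v| would be small; but a > 0 gives |u + v|^2 = 2 + 2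
    a.\<close>
  have v0: "0 \<le> v 0"
  proof (rule ccontr)
    assume "\<not> 0 \<le> v 0"
    define w where "w j = - v j" for j
    have "(w j)\<^sup>2 = (v j)\<^sup>2" "(w j)^4 = (v j)^4" for j by (simp_all add: w_def)
    moreover have "dform w w = dform v v" by (simp add: dform_def w_def algebra_simps)
    ultimately have "energy w = energy v" "S (\<lambda>j. (w j)\<^sup>2) = 1" using u'_mass by (simp_all add: energy_def)
    then have "good w" using ev eu u'_supp \<open>\<not> 0 \<le> v 0\<close> by (auto simp: good_def w_def supported_def)
    have "S (\<lambda>j. (u j - w j)\<^sup>2) \<le> S (\<lambda>j. 2 * (u j - soliton j)\<^sup>2 + 2 * (w j - soliton j)\<^sup>2)"
    proof (rule S_mono)
      fix j show "(u j - w j)\<^sup>2 \<le> 2 * (u j - soliton j)\<^sup>2 + 2 * (w j - soliton j)\<^sup>2"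
        using zero_le_power2[of "(u j - soliton j) + (w j - soliton j)"] by (simp add: power2_eq_square algebra_simps)
    qed
    also have "\<dots> \<le> 2 * (1/100) + 2 * (1/100)"
      unfolding S_add S_cmult using good_small[OF g h] good_small[OF \<open>good w\<close> h] by (intro add_mono mult_left_mono) auto
    finally have "S (\<lambda>j. (u j - w j)\<^sup>2) \<le> 1" by simp
    moreover have "S (\<lambda>j. (u j - w j)\<^sup>2) = S (\<lambda>j. (u j)\<^sup>2 + 2 * (u j * v j) + (v j)\<^sup>2)"
      by (rule S_cong) (simp add: w_def power2_eq_square algebra_simps)
    then have "S (\<lambda>j. (u j - w j)\<^sup>2) = 1 + 2 * a + 1" unfolding S_add S_cmult u_mass u'_mass a_def .
    ultimately show False using a_pos by simp
  qed
  then show "good v" using ev eu u'_supp u'_mass by (auto simp: good_def)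
  interpret near_flow_step h K u \<tau> v "sqrt (S (\<lambda>j. (x j)\<^sup>2))" "1 / 10^9"
    by unfold_locales (use h eu v0 g in \<open>auto simp: good_def\<close>)
  define P P' where "P = 2 * energy u + 1/12 - 100 * h\<^sup>2" and "P' = 2 * energy v + 1/12 - 100 * h\<^sup>2"
  have "P' \<le> 100000000 * (\<zeta> / \<tau>\<^sup>2)" using gradient_inequality unfolding P'_def by linarith
  \<comment> \<open>Multiplication by \<tau> turns |z|^2/\<tau>^2 into the |z|^2/\<tau> that the
    energy has lost in the step; this is the source of the contraction factor.\<close>
  then have "P' * (2 / 10^8 * \<tau>) \<le> 100000000 * (\<zeta> / \<tau>\<^sup>2) * (2 / 10^8 * \<tau>)"
    using \<tau> by (intro mult_right_mono) auto
  also have "\<dots> = 2 * (\<zeta> / \<tau>)" using \<tau> by (simp add: power2_eq_square)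
  also have "\<dots> \<le> P - P'" using energy_decrease unfolding P_def P'_def by linarith
  finally show "P' * (1 + 2 / 10^8 * \<tau>) \<le> P" by (simp add: algebra_simps)
qed

lemma trajectory:
  assumes g: "good u0" and h: "h \<le> 1 / 10^13" and \<tau>: "0 < \<tau>" "\<tau> \<le> 1/4"
  shows "\<exists>U X. U 0 = u0 \<and> (\<forall>n. good (U n) \<and> implicit_step \<tau> (U n) (X n) \<and> U (Suc n) = normalize (X n)
     \<and> deviation (U n) \<le> 500000 * (exp (- (real n * \<tau> / 10^8)) + 102 * h\<^sup>2))"
proof -
  have sech_sample: "\<exists>x. implicit_step \<tau> u x" if "good u" for u
  proof -
    interpret unit_profile h K u by (rule good_unit_profile[OF that])
    show ?thesis by (rule implicit_step_exists[OF \<tau> u_sq_le])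
  qed
  define solve where "solve u = (SOME x. implicit_step \<tau> u x)" for u
  have solve: "implicit_step \<tau> u (solve u)" if "good u" for u
    unfolding solve_def using sech_sample[OF that] by (rule someI_ex)
  define U where "U = rec_nat u0 (\<lambda>_ u. normalize (solve u))"
  have U: "U 0 = u0" "U (Suc n) = normalize (solve (U n))" for n by (simp_all add: U_def)
  have G: "good (U n)" for n
    by (induction n) (auto simp: U g intro!: good_step(1)[OF _ h \<tau>] solve)
  define P where "P n = 2 * energy (U n) + 1/12 - 100 * h\<^sup>2" for n
  have P_rec: "P (Suc n) * (1 + 2 / 10^8 * \<tau>) \<le> P n" for n
    unfolding P_def U(2) by (rule good_step(2)[OF G h \<tau> solve[OF G]])
  have P: "P n \<le> exp (- (real n * \<tau> / 10^8))" for n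
  proof (induction n)
    case 0
    have "2 * energy (U 0) + 1/12 \<le> 1 / 10^24" using G[of 0] by (simp add: good_def)
    also have "\<dots> \<le> 1" by simp
    finally have "P 0 \<le> 1" using zero_le_power2[of h] unfolding P_def by linarith
    then show ?case by simp
  next
    case (Suc n)
    \<comment> \<open>\<open>P\<close> may be negative, since 100 h^2 has been subtracted, and then
      the claim is trivial. Otherwise exp y \<le> 1 + 2 y on [0,1] converts the factor of the
      recursion into an exponential.\<close>
    show ?case
    proof (cases "P (Suc n) \<le> 0")
      case True
      then show ?thesis by (rule order.trans) simp
    next
      case False
      define y where "y = \<tau> / 10^8"
      have y: "0 \<le> y" "y \<le> 1" using \<tau> by (auto simp: y_def)
      have "exp y \<le> 1 + y + y\<^sup>2" using exp_bound y by simp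
      also have "y\<^sup>2 \<le> y" using y by (simp add: power2_eq_square mult_left_le)
      finally have "exp y \<le> 1 + 2 / 10^8 * \<tau>" by (simp add: y_def)
      then have "P (Suc n) * exp y \<le> P (Suc n) * (1 + 2 / 10^8 * \<tau>)" using False by (intro mult_left_mono) auto
      also have "\<dots> \<le> P n" by (rule P_rec)
      also have "\<dots> \<le> exp (- (real n * \<tau> / 10^8))" by (rule Suc)
      finally have "P (Suc n) * exp y * exp (- y) \<le> exp (- (real n * \<tau> / 10^8)) * exp (- y)"
        by (intro mult_right_mono) auto
      moreover have "P (Suc n) * exp y * exp (- y) = P (Suc n)" by (simp add: mult.assoc exp_add[symmetric])
      moreover have "exp (- (real n * \<tau> / 10^8)) * exp (- y) = exp (- (real (Suc n) * \<tau> / 10^8))"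
        by (simp add: exp_add[symmetric] y_def field_simps)
      ultimately show ?thesis by simp
    qed
  qed
  have "deviation (U n) \<le> 500000 * (exp (- (real n * \<tau> / 10^8)) + 102 * h\<^sup>2)" for n
    using good_deviation[OF G h, of n] P[of n] unfolding P_def by argo
  then show ?thesis using U G solve by (intro exI[of _ U] exI[of _ "\<lambda>n. solve (U n)"]) auto
qed

text \<open>The converse of coercivity, for the initial state. Since x^4 lies above its tangents,
  the quartic term changes by at most first order in the deviation. The excess is at most 14 *
  10^-26 + 8 h^2, below the threshold 10^-24.\<close>

lemma good_initial:
  assumes supp: "supported u" and mass: "S (\<lambda>j. (u j)\<^sup>2) = 1" and h: "h \<le> 1 / 10^13"
    and dev: "deviation u \<le> (1 / 10^26)\<^sup>2"
  shows "good u"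
proof -
  define \<beta> :: real where "\<beta> = 1 / 10^26"
  define d where "d j = u j - soliton j" for j
  have d_K: "d (Suc K) = 0" using supp by (simp add: d_def supported_def soliton_Suc_K)
  have D: "dform d d \<le> \<beta>\<^sup>2" "S (\<lambda>j. (d j)\<^sup>2) \<le> \<beta>\<^sup>2"
    using dev dform_nonneg[of d] S_nonneg[of "\<lambda>j. (d j)\<^sup>2"] unfolding deviation_def d_def[symmetric] \<beta>_def[symmetric]
    by auto
  have sup: "\<bar>d j\<bar> \<le> \<beta>" if "j \<le> K" for j
  proof -
    have "(d j)\<^sup>2 \<le> dform d d + S (\<lambda>j. (d j)\<^sup>2) / 2" using sup_bound[of d j] d_K that by simp
    also have "\<dots> \<le> \<beta>\<^sup>2" using dev S_nonneg[of "\<lambda>j. (d j)\<^sup>2"]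
      unfolding deviation_def d_def[symmetric] \<beta>_def[symmetric] by simp
    finally have "\<bar>d j\<bar> \<le> \<bar>\<beta>\<bar>" by (simp only: abs_le_square_iff)
    then show ?thesis by (simp add: \<beta>_def)
  qed
  have u: "u = (\<lambda>j. soliton j + d j)" by (simp add: d_def)
  have "\<bar>d 0\<bar> \<le> 1/2" using sup[of 0] by (simp add: \<beta>_def)
  moreover have "u 0 = 1/2 + d 0" by (simp add: d_def soliton_0)
  ultimately have u0: "0 \<le> u 0" by linarith
  have "dform u u = dform soliton soliton + 2 * dform soliton d + dform d d"
    unfolding u dform_add dform_add2 by (simp add: dform_sym)
  moreover have "(dform soliton d)\<^sup>2 \<le> 1 * \<beta>\<^sup>2"
    by (rule order.trans[OF dform_Cauchy_Schwarz mult_mono[OF dform_soliton D(1)]]) (auto simp: dform_nonneg)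
  then have "\<bar>dform soliton d\<bar> \<le> \<bar>\<beta>\<bar>" by (simp only: abs_le_square_iff mult_1)
  then have "dform soliton d \<le> \<beta>" by (simp add: \<beta>_def)
  moreover have b2: "\<beta>\<^sup>2 \<le> \<beta>" by (simp add: \<beta>_def power2_eq_square)
  ultimately have A: "dform u u \<le> dform soliton soliton + 3 * \<beta>" using D(1) by linarith
  have B: "S (\<lambda>j. (soliton j)^4) - S (\<lambda>j. (u j)^4) \<le> 8 * \<beta>"
  proof -
    have "S (\<lambda>j. (soliton j)^4) - S (\<lambda>j. (u j)^4) = S (\<lambda>j. (soliton j)^4 - (u j)^4)" unfolding S_diff ..
    also have "\<dots> \<le> S (\<lambda>j. 4 * \<beta> * (soliton j)\<^sup>2)"
    proof (rule S_mono)
      fix j assume j: "j \<le> K"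
      have "(soliton j)^4 + 4 * (soliton j)^3 * d j \<le> (soliton j + d j)^4"
      proof -
        have "(x + y)^4 - (x^4 + 4 * x^3 * y) = y\<^sup>2 * ((2 * x + y)\<^sup>2 + 2 * x\<^sup>2)" for x y :: real
          by (simp add: power2_eq_square power3_eq_cube power4_eq_xxxx algebra_simps)
        moreover have "0 \<le> y\<^sup>2 * ((2 * x + y)\<^sup>2 + 2 * x\<^sup>2)" for x y :: real by simp
        ultimately have "0 \<le> (soliton j + d j)^4 - ((soliton j)^4 + 4 * (soliton j)^3 * d j)" by metis
        then show ?thesis by simp
      qed
      moreover have "- 4 * (soliton j)^3 * d j \<le> 4 * \<beta> * (soliton j)\<^sup>2"
      proof -
        have "\<bar>soliton j\<bar> \<le> 1" using soliton_nonneg[of j] soliton_le_half[of j] by simp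
        then have "\<bar>soliton j\<bar> * \<bar>d j\<bar> \<le> 1 * \<beta>" using sup[OF j] by (rule mult_mono) simp_all
        then have "- (soliton j * d j) \<le> \<beta>" unfolding abs_mult[symmetric] by linarith
        then have "- (soliton j * d j) * (4 * (soliton j)\<^sup>2) \<le> \<beta> * (4 * (soliton j)\<^sup>2)" by (rule mult_right_mono) simp
        moreover have "- (x * y) * (4 * x\<^sup>2) = - 4 * x^3 * y" for x y :: real
          by (simp add: power2_eq_square power3_eq_cube)
        moreover have "\<beta> * (4 * (soliton j)\<^sup>2) = 4 * \<beta> * (soliton j)\<^sup>2" by simp
        ultimately show ?thesis by metis
      qed
      moreover have "(u j)^4 = (soliton j + d j)^4" by (simp add: d_def)
      ultimately show "(soliton j)^4 - (u j)^4 \<le> 4 * \<beta> * (soliton j)\<^sup>2" by linarith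
    qed
    also have "\<dots> = 4 * \<beta> * S (\<lambda>j. (soliton j)\<^sup>2)" by (rule S_cmult)
    also have "\<dots> \<le> 4 * \<beta> * 2" using soliton_mass_le by (intro mult_left_mono) (auto simp: \<beta>_def)
    finally show ?thesis by simp
  qed
  have "2 * energy u + 1/12 \<le> 2 * energy soliton + 1/12 + 14 * \<beta>" using A B unfolding energy_def by argo
  moreover have "h\<^sup>2 \<le> (1 / 10^13)\<^sup>2" using h h_pos by (intro power_mono) auto
  ultimately have "2 * energy u + 1/12 \<le> 8 * (1 / 10^13)\<^sup>2 + 14 * \<beta>" using energy_soliton by argo
  also have "\<dots> \<le> 1 / 10^24" by (simp add: \<beta>_def power2_eq_square)
  finally show ?thesis using supp mass u0 by (simp add: good_def)
qed

end

section \<open>Weak derivatives\<close>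

lemma L2_measurable: "f \<in> L2 \<Longrightarrow> f \<in> borel_measurable lborel"
  and L2_integrable: "f \<in> L2 \<Longrightarrow> integrable lborel (\<lambda>x. (cmod (f x))\<^sup>2)"
  by (auto simp: L2_def)

lemma L2_norm_sq: "(L2_norm f)\<^sup>2 = (LINT x|lborel. (cmod (f x))\<^sup>2)"
  by (simp add: L2_norm_def)

lemma integrable_scaleR_L2:
  fixes \<phi> :: "real \<Rightarrow> real"
  assumes "f \<in> L2" "\<phi> \<in> borel_measurable lborel" "integrable lborel (\<lambda>x. (\<phi> x)\<^sup>2)"
  shows "integrable lborel (\<lambda>x. \<phi> x *\<^sub>R f x)"
proof (rule Bochner_Integration.integrable_bound)
  show "integrable lborel (\<lambda>x. (\<phi> x)\<^sup>2 + (cmod (f x))\<^sup>2)"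
    using assms L2_integrable by (intro Bochner_Integration.integrable_add)
  show "(\<lambda>x. \<phi> x *\<^sub>R f x) \<in> borel_measurable lborel"
    using assms L2_measurable by measurable
  have "\<bar>\<phi> x\<bar> * cmod (f x) \<le> (\<phi> x)\<^sup>2 + (cmod (f x))\<^sup>2" for x
  proof -
    have "0 \<le> \<bar>\<phi> x\<bar> * cmod (f x)" by simp
    moreover have "2 * (\<bar>\<phi> x\<bar> * cmod (f x)) \<le> (\<phi> x)\<^sup>2 + (cmod (f x))\<^sup>2"
      using zero_le_power2[of "\<bar>\<phi> x\<bar> - cmod (f x)"] by (simp add: power2_diff)
    ultimately show ?thesis by linarith
  qed
  then show "AE x in lborel. norm (\<phi> x *\<^sub>R f x) \<le> norm ((\<phi> x)\<^sup>2 + (cmod (f x))\<^sup>2)" by simp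
qed

lemma L2_diff:
  assumes "f \<in> L2" "g \<in> L2" shows "(\<lambda>x. f x - g x) \<in> L2"
proof -
  have [measurable]: "f \<in> borel_measurable lborel" "g \<in> borel_measurable lborel"
    using assms by (auto simp: L2_def)
  have "integrable lborel (\<lambda>x. (cmod (f x - g x))\<^sup>2)"
  proof (rule Bochner_Integration.integrable_bound)
    show "integrable lborel (\<lambda>x. 2 * (cmod (f x))\<^sup>2 + 2 * (cmod (g x))\<^sup>2)"
      using assms by (auto simp: L2_def)
    have "(cmod (f x - g x))\<^sup>2 \<le> 2 * (cmod (f x))\<^sup>2 + 2 * (cmod (g x))\<^sup>2" for x
    proof -
      have "(cmod (f x - g x))\<^sup>2 \<le> (cmod (f x) + cmod (g x))\<^sup>2"
        by (intro power_mono norm_triangle_ineq4) auto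
      also have "\<dots> \<le> 2 * (cmod (f x))\<^sup>2 + 2 * (cmod (g x))\<^sup>2"
        using zero_le_power2[of "cmod (f x) - cmod (g x)"] by (simp add: power2_sum power2_diff)
      finally show ?thesis .
    qed
    then show "AE x in lborel. norm ((cmod (f x - g x))\<^sup>2) \<le> norm (2 * (cmod (f x))\<^sup>2 + 2 * (cmod (g x))\<^sup>2)"
      by simp
  qed measurable
  then show ?thesis by (simp add: L2_def)
qed

lemma pos_part_sq_derivative: "((\<lambda>t. (max 0 t)\<^sup>2) has_real_derivative 2 * max 0 t) (at (t::real))"
proof (cases "t = 0")
  case True
  have "((\<lambda>y. (max 0 y)\<^sup>2 / y) \<longlongrightarrow> 0) (at (0::real))"
  proof (rule Lim_null_comparison)
    have "norm ((max 0 y)\<^sup>2 / y) \<le> \<bar>y\<bar>" for y :: real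
      by (cases "y = 0") (auto simp: max_def power2_eq_square)
    then show "\<forall>\<^sub>F y in at 0. norm ((max 0 y)\<^sup>2 / y) \<le> \<bar>y :: real\<bar>" by simp
    show "((\<lambda>y::real. \<bar>y\<bar>) \<longlongrightarrow> 0) (at 0)" by (rule tendsto_eq_intros tendsto_ident_at | simp)+
  qed
  then show ?thesis using True by (simp add: has_field_derivative_iff)
next
  case False
  show ?thesis
  proof (cases "t > 0")
    case True
    have "((\<lambda>t. t\<^sup>2) has_real_derivative 2 * t) (at t)" by (auto intro!: derivative_eq_intros)
    then have "((\<lambda>t. (max 0 t)\<^sup>2) has_real_derivative 2 * t) (at t)"
      by (rule has_field_derivative_transform_within_open[where S="{0<..}"]) (use True in auto)
    then show ?thesis using True by simp
  next
    case f: False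
    have "((\<lambda>t. 0) has_real_derivative 0) (at t)" by simp
    then have "((\<lambda>t. (max 0 t)\<^sup>2) has_real_derivative 0) (at t)"
      by (rule has_field_derivative_transform_within_open[where S="{..<0}"]) (use f False in auto)
    then show ?thesis using f False by simp
  qed
qed

text \<open>\<open>C\<^sup>1\<close> cut-off functions which increase to the indicator function of an open interval.\<close>

definition bump :: "real \<Rightarrow> real \<Rightarrow> real \<Rightarrow> real" where
  "bump a b x = (max 0 (x - a))\<^sup>2 * (max 0 (b - x))\<^sup>2"

definition cutoff :: "real \<Rightarrow> real \<Rightarrow> nat \<Rightarrow> real \<Rightarrow> real" where
  "cutoff a b n x = real n * bump a b x / (1 + real n * bump a b x)"

lemma bump_nonneg: "0 \<le> bump a b x" by (simp add: bump_def)

lemma cutoff_bounds: "0 \<le> cutoff a b n x" "cutoff a b n x \<le> 1"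
  using bump_nonneg[of a b x] by (auto simp: cutoff_def divide_le_eq add_pos_nonneg)

lemma cutoff_outside: "x \<notin> {a<..<b} \<Longrightarrow> cutoff a b n x = 0"
  by (auto simp: cutoff_def bump_def)

lemma cutoff_limit: "(\<lambda>n. cutoff a b n x) \<longlonglongrightarrow> indicator {a<..<b} x"
proof (cases "x \<in> {a<..<b}")
  case True
  then have p: "0 < bump a b x" by (simp add: bump_def)
  have "(\<lambda>n. 1 - 1 / (1 + real n * bump a b x)) \<longlonglongrightarrow> 1 - 0"
  proof (intro tendsto_diff tendsto_const tendsto_divide_0[OF tendsto_const] filterlim_at_top_imp_at_infinity)
    show "filterlim (\<lambda>n. 1 + real n * bump a b x) at_top sequentially"
      using p by (intro filterlim_tendsto_add_at_top[OF tendsto_const] filterlim_at_top_mult_tendsto_pos[OF tendsto_const]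
          filterlim_real_sequentially)
  qed
  moreover have "1 - 1 / (1 + real n * bump a b x) = cutoff a b n x" for n
    using bump_nonneg[of a b x] by (simp add: cutoff_def field_simps add_nonneg_eq_0_iff)
  ultimately show ?thesis using True by simp
next
  case False
  then show ?thesis by (simp add: cutoff_outside)
qed

lemma test_fun_cutoff: "test_fun (cutoff a b n)"
proof -
  define D where "D x = 2 * max 0 (x - a) * (max 0 (b - x))\<^sup>2 - (max 0 (x - a))\<^sup>2 * (2 * max 0 (b - x))" for x :: real
  have l: "((\<lambda>x. (max 0 (x - a))\<^sup>2) has_real_derivative 2 * max 0 (x - a) * 1) (at x)" for x
    by (rule DERIV_chain2[OF pos_part_sq_derivative]) (auto intro!: derivative_eq_intros)
  have r: "((\<lambda>x. (max 0 (b - x))\<^sup>2) has_real_derivative 2 * max 0 (b - x) * (- 1)) (at x)" for x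
    by (rule DERIV_chain2[OF pos_part_sq_derivative]) (auto intro!: derivative_eq_intros)
  have bd: "(bump a b has_real_derivative D x) (at x)" for x
    unfolding bump_def[abs_def] D_def
    by (rule DERIV_cong[OF DERIV_mult[OF l r]]) (simp add: algebra_simps)
  have pos: "0 < 1 + real n * bump a b x" for x using bump_nonneg[of a b x] by (simp add: add_pos_nonneg)
  have "(cutoff a b n has_real_derivative real n * D x / (1 + real n * bump a b x)\<^sup>2) (at x)" for x
    unfolding cutoff_def[abs_def] using pos[of x]
    by (auto intro!: derivative_eq_intros bd simp: power2_eq_square field_simps)
  moreover have "continuous_on UNIV (\<lambda>x. real n * D x / (1 + real n * bump a b x)\<^sup>2)"
    unfolding D_def bump_def using pos[unfolded bump_def]
    by (intro continuous_intros) (metis less_irrefl zero_eq_power2)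
  ultimately have "cutoff a b n C1_differentiable_on UNIV"
    unfolding C1_differentiable_on_def has_real_derivative_iff_has_vector_derivative
    by (intro exI[of _ "\<lambda>x. real n * D x / (1 + real n * bump a b x)\<^sup>2"]) auto
  moreover have "bounded {x. cutoff a b n x \<noteq> 0}"
    by (rule bounded_subset[of "{a<..<b}"]) (simp, use cutoff_outside[of _ a b n] in blast)
  ultimately show ?thesis by (simp add: test_fun_def compact_eq_bounded_closed bounded_closure)
qed

lemma integrable_indicator_Ioo: "integrable lborel (indicat_real {a<..<b :: real})"
  by (cases "a \<le> b") (auto intro!: integrable_real_indicator)

section \<open>The fundamental lemma of the calculus of variations\<close>

lemma integral_interval_zero:
  assumes w: "w \<in> L2" and z: "\<And>\<phi>. test_fun \<phi> \<Longrightarrow> (LINT x|lborel. \<phi> x *\<^sub>R w x) = 0"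
  shows "(LINT x|lborel. indicator {a<..<b} x *\<^sub>R w x) = 0"
proof -
  have [measurable]: "w \<in> borel_measurable lborel" using w by (rule L2_measurable)
  have [measurable]: "cutoff a b n \<in> borel_measurable borel" for n
    unfolding cutoff_def[abs_def] bump_def by measurable
  have "(\<lambda>n. LINT x|lborel. cutoff a b n x *\<^sub>R w x) \<longlonglongrightarrow> (LINT x|lborel. indicator {a<..<b} x *\<^sub>R w x)"
  proof (rule integral_dominated_convergence)
    show "integrable lborel (\<lambda>x. cmod (indicator {a<..<b} x *\<^sub>R w x))"
    proof (intro integrable_norm integrable_scaleR_L2[OF w])
      have "(\<lambda>x. (indicator {a<..<b} x :: real)\<^sup>2) = indicator {a<..<b}" by (auto simp: indicator_def)
      then show "integrable lborel (\<lambda>x. (indicator {a<..<b} x :: real)\<^sup>2)" by (simp add: integrable_indicator_Ioo)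
    qed measurable
    show "AE x in lborel. (\<lambda>n. cutoff a b n x *\<^sub>R w x) \<longlonglongrightarrow> indicator {a<..<b} x *\<^sub>R w x"
      by (intro AE_I2 tendsto_scaleR cutoff_limit tendsto_const)
    have "norm (cutoff a b n x *\<^sub>R w x) \<le> cmod (indicator {a<..<b} x *\<^sub>R w x)" for n x
      using cutoff_bounds[of a b n x] cutoff_outside[of x a b n]
      by (cases "x \<in> {a<..<b}") (auto simp: mult_left_le_one_le)
    then show "AE x in lborel. norm (cutoff a b n x *\<^sub>R w x) \<le> cmod (indicator {a<..<b} x *\<^sub>R w x)" for n
      by simp
  qed measurable
  moreover have "(LINT x|lborel. cutoff a b n x *\<^sub>R w x) = 0" for n by (rule z[OF test_fun_cutoff])
  ultimately show ?thesis by (simp add: LIMSEQ_const_iff)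
qed

text \<open>On a bounded interval the positive and the negative part of \<open>w\<close> are
  densities of two finite measures that agree on all half-lines, so the parts coincide almost
  everywhere. As at most one of them is nonzero at any point, both vanish.\<close>

lemma AE_zero_real:
  fixes w :: "real \<Rightarrow> real"
  assumes [measurable]: "w \<in> borel_measurable lborel"
    and int: "\<And>a b. integrable lborel (\<lambda>x. indicator {a<..<b} x * w x)"
    and zero: "\<And>a b. (LINT x|lborel. indicator {a<..<b} x * w x) = 0"
  shows "AE x in lborel. w x = 0"
proof -
  have "AE x in lborel. x \<in> {- real n<..<real n} \<longrightarrow> w x = 0" for n
  proof -
    define I where "I = {- real n<..<real n}"
    have [measurable]: "I \<in> sets borel" by (simp add: I_def)
    define f where "f x = ennreal (indicator I x * max 0 (w x))" for x
    define g where "g x = ennreal (indicator I x * max 0 (- w x))" for x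
    have [measurable]: "f \<in> borel_measurable lborel" "g \<in> borel_measurable lborel"
      unfolding f_def g_def by measurable
    have J: "I \<inter> {y<..} = {max y (- real n)<..<real n}" for y by (auto simp: I_def)
    have if': "integrable lborel (\<lambda>x. indicator (I \<inter> {y<..}) x * max 0 (s * w x))" if "\<bar>s\<bar> = 1" for y s
      by (rule Bochner_Integration.integrable_bound[OF int[of "max y (- real n)" "real n", folded J]])
        (use that in \<open>auto simp: indicator_def max_def abs_if split: if_splits\<close>)
    have em: "emeasure (density lborel f) {y<..} = ennreal (LINT x|lborel. indicator (I \<inter> {y<..}) x * max 0 (1 * w x))"
      "emeasure (density lborel g) {y<..} = ennreal (LINT x|lborel. indicator (I \<inter> {y<..}) x * max 0 (- 1 * w x))" for y
    proof -
      have "emeasure (density lborel f) {y<..} = (\<integral>\<^sup>+x. ennreal (indicator (I \<inter> {y<..}) x * max 0 (1 * w x)) \<partial>lborel)"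
        by (subst emeasure_density) (auto intro!: nn_integral_cong simp: f_def indicator_def)
      then show "emeasure (density lborel f) {y<..} = ennreal (LINT x|lborel. indicator (I \<inter> {y<..}) x * max 0 (1 * w x))"
        by (subst nn_integral_eq_integral[symmetric]) (auto intro: if'[of 1 y, simplified])
      have "emeasure (density lborel g) {y<..} = (\<integral>\<^sup>+x. ennreal (indicator (I \<inter> {y<..}) x * max 0 (- 1 * w x)) \<partial>lborel)"
        by (subst emeasure_density) (auto intro!: nn_integral_cong simp: g_def indicator_def)
      then show "emeasure (density lborel g) {y<..} = ennreal (LINT x|lborel. indicator (I \<inter> {y<..}) x * max 0 (- 1 * w x))"
        by (subst nn_integral_eq_integral[symmetric]) (auto intro: if'[of "-1" y, simplified])
    qed
    have eq: "(LINT x|lborel. indicator (I \<inter> {y<..}) x * max 0 (1 * w x))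
        = (LINT x|lborel. indicator (I \<inter> {y<..}) x * max 0 (- 1 * w x))" for y
    proof -
      have "(LINT x|lborel. indicator (I \<inter> {y<..}) x * max 0 (1 * w x))
        - (LINT x|lborel. indicator (I \<inter> {y<..}) x * max 0 (- 1 * w x))
        = (LINT x|lborel. indicator (I \<inter> {y<..}) x * max 0 (1 * w x) - indicator (I \<inter> {y<..}) x * max 0 (- 1 * w x))"
        by (rule Bochner_Integration.integral_diff[symmetric]) (use if'[of 1 y] if'[of "-1" y] in simp_all)
      also have "\<dots> = (LINT x|lborel. indicator (I \<inter> {y<..}) x * w x)"
        by (intro Bochner_Integration.integral_cong) (auto simp: indicator_def max_def)
      also have "\<dots> = 0" unfolding J by (rule zero)
      finally show ?thesis by simp
    qed
    have "density lborel f = density lborel g"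
      by (rule measure_eqI_lessThan) (simp_all only: em eq, simp_all)
    then have "AE x in lborel. f x = g x"
      by (intro sigma_finite_measure.density_unique[OF lborel.sigma_finite_measure_axioms]) simp_all
    then show ?thesis
    proof eventually_elim
      case (elim x)
      then show ?case by (auto simp: f_def g_def I_def indicator_def max_def ennreal_eq_zero_iff split: if_splits)
    qed
  qed
  then have "AE x in lborel. \<forall>n. x \<in> {- real n<..<real n} \<longrightarrow> w x = 0"
    by (subst AE_all_countable) blast
  then show ?thesis
  proof eventually_elim
    case (elim x)
    obtain n where "\<bar>x\<bar> < real n" using reals_Archimedean2 by blast
    then show ?case using elim by (auto simp: abs_less_iff)
  qed
qed

lemma AE_zero_of_test_fun:
  assumes w: "w \<in> L2" and z: "\<And>\<phi>. test_fun \<phi> \<Longrightarrow> (LINT x|lborel. \<phi> x *\<^sub>R w x) = 0"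
  shows "AE x in lborel. w x = 0"
proof -
  have [measurable]: "w \<in> borel_measurable lborel" using w by (rule L2_measurable)
  have int: "integrable lborel (\<lambda>x. indicator {a<..<b} x *\<^sub>R w x)" for a b :: real
  proof (rule integrable_scaleR_L2[OF w])
    have "(\<lambda>x. (indicator {a<..<b} x :: real)\<^sup>2) = indicator {a<..<b}" by (auto simp: indicator_def)
    then show "integrable lborel (\<lambda>x. (indicator {a<..<b} x :: real)\<^sup>2)" by (simp add: integrable_indicator_Ioo)
  qed measurable
  note zero = integral_interval_zero[OF w z]
  have re: "AE x in lborel. Re (w x) = 0"
  proof (rule AE_zero_real)
    show "integrable lborel (\<lambda>x. indicator {a<..<b} x * Re (w x))" for a b :: real
      using integrable_Re[OF int[of a b]] by simp
    show "(LINT x|lborel. indicator {a<..<b} x * Re (w x)) = 0" for a b :: real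
      using integral_Re[OF int[of a b]] zero[of a b] by simp
  qed measurable
  have im: "AE x in lborel. Im (w x) = 0"
  proof (rule AE_zero_real)
    show "integrable lborel (\<lambda>x. indicator {a<..<b} x * Im (w x))" for a b :: real
      using integrable_Im[OF int[of a b]] by simp
    show "(LINT x|lborel. indicator {a<..<b} x * Im (w x)) = 0" for a b :: real
      using integral_Im[OF int[of a b]] zero[of a b] by simp
  qed measurable
  show ?thesis using re im by eventually_elim (simp add: complex_eq_iff)
qed

section \<open>Uniqueness and computation of weak derivatives\<close>

lemma test_fun_continuous: "test_fun \<phi> \<Longrightarrow> continuous_on UNIV \<phi>"
  unfolding test_fun_def by (blast intro: C1_differentiable_imp_continuous_on)

lemma test_fun_derivative:
  assumes "test_fun \<phi>"
  shows "(\<phi> has_real_derivative deriv \<phi> x) (at x)" and "continuous_on UNIV (deriv \<phi>)"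
proof -
  obtain D where D: "\<And>x. (\<phi> has_real_derivative D x) (at x)" "continuous_on UNIV D"
    using assms unfolding test_fun_def C1_differentiable_on_def has_real_derivative_iff_has_vector_derivative by blast
  then have "deriv \<phi> = D" by (auto intro!: DERIV_imp_deriv)
  then show "(\<phi> has_real_derivative deriv \<phi> x) (at x)" "continuous_on UNIV (deriv \<phi>)" using D by auto
qed

lemma test_fun_support:
  assumes "test_fun \<phi>"
  obtains R where "0 < R" "\<And>x. R \<le> \<bar>x\<bar> \<Longrightarrow> \<phi> x = 0" "\<And>x. R \<le> \<bar>x\<bar> \<Longrightarrow> deriv \<phi> x = 0"
proof -
  have "bounded {x. \<phi> x \<noteq> 0}"
    using assms unfolding test_fun_def by (meson bounded_subset closure_subset compact_imp_bounded)
  then obtain R0 where R0: "\<And>x. \<phi> x \<noteq> 0 \<Longrightarrow> \<bar>x\<bar> \<le> R0" by (auto simp: bounded_iff)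
  define R where "R = \<bar>R0\<bar> + 1"
  have z: "\<phi> x = 0" if "\<bar>R0\<bar> < \<bar>x\<bar>" for x using R0[of x] that by linarith
  have "deriv \<phi> x = 0" if "R \<le> \<bar>x\<bar>" for x
  proof -
    have "open {y::real. \<bar>R0\<bar> < \<bar>y\<bar>}" by (intro open_Collect_less continuous_intros)
    moreover have "x \<in> {y. \<bar>R0\<bar> < \<bar>y\<bar>}" using that by (simp add: R_def)
    ultimately have "((\<lambda>_. 0) has_real_derivative deriv \<phi> x) (at x)"
      by (rule has_field_derivative_transform_within_open[OF test_fun_derivative(1)[OF assms]]) (simp add: z)
    then show ?thesis by (metis DERIV_const DERIV_unique)
  qed
  then show thesis using z by (intro that[of R]) (auto simp: R_def)
qed

lemma integrable_sq_of_compact_support: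
  fixes f :: "real \<Rightarrow> real"
  assumes "continuous_on UNIV f" "\<And>x. R \<le> \<bar>x\<bar> \<Longrightarrow> f x = 0"
  shows "f \<in> borel_measurable lborel" "integrable lborel (\<lambda>x. (f x)\<^sup>2)"
proof -
  show "f \<in> borel_measurable lborel" using assms by (simp add: borel_measurable_continuous_onI)
  have "set_integrable lborel {-R..R} (\<lambda>x. (f x)\<^sup>2)"
    using assms(1) by (intro borel_integrable_atLeastAtMost') (auto intro!: continuous_intros intro: continuous_on_subset)
  moreover have "(\<lambda>x. indicat_real {-R..R} x *\<^sub>R (f x)\<^sup>2) = (\<lambda>x. (f x)\<^sup>2)"
  proof
    fix x show "indicat_real {-R..R} x *\<^sub>R (f x)\<^sup>2 = (f x)\<^sup>2"
      using assms(2)[of x] by (cases "x \<in> {-R..R}") auto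
  qed
  ultimately show "integrable lborel (\<lambda>x. (f x)\<^sup>2)" by (simp add: set_integrable_def)
qed

lemma integrable_test_fun:
  assumes "test_fun \<phi>" "f \<in> L2"
  shows "integrable lborel (\<lambda>x. \<phi> x *\<^sub>R f x)" "integrable lborel (\<lambda>x. deriv \<phi> x *\<^sub>R f x)"
proof -
  obtain R where R: "\<And>x. R \<le> \<bar>x\<bar> \<Longrightarrow> \<phi> x = 0" "\<And>x. R \<le> \<bar>x\<bar> \<Longrightarrow> deriv \<phi> x = 0"
    using test_fun_support[OF assms(1)] by metis
  show "integrable lborel (\<lambda>x. \<phi> x *\<^sub>R f x)" "integrable lborel (\<lambda>x. deriv \<phi> x *\<^sub>R f x)"
    using integrable_sq_of_compact_support[OF test_fun_continuous[OF assms(1)] R(1)]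
      integrable_sq_of_compact_support[OF test_fun_derivative(2)[OF assms(1)] R(2)]
    by (auto intro!: integrable_scaleR_L2[OF assms(2)])
qed

lemma weak_deriv_unique:
  assumes "g1 \<in> L2" "g2 \<in> L2" "weak_deriv f g1" "weak_deriv f g2"
  shows "AE x in lborel. g1 x = g2 x"
proof -
  have "(LINT x|lborel. \<phi> x *\<^sub>R (g1 x - g2 x)) = 0" if "test_fun \<phi>" for \<phi>
  proof -
    have "(LINT x|lborel. \<phi> x *\<^sub>R g1 x) = (LINT x|lborel. \<phi> x *\<^sub>R g2 x)"
      using assms(3,4) that by (auto simp: weak_deriv_def)
    then show ?thesis
      using integrable_test_fun(1)[OF that assms(1)] integrable_test_fun(1)[OF that assms(2)]
      by (simp add: scaleR_diff_right)
  qed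
  from AE_zero_of_test_fun[OF L2_diff[OF assms(1,2)] this] show ?thesis by simp
qed

text \<open>Removes the choice operator: the selected derivative agrees almost everywhere with any
  known one, so their norms are equal.\<close>

lemma H1_norm_eq:
  assumes "g \<in> L2" "weak_deriv f g"
  shows "H1_norm f = sqrt ((L2_norm f)\<^sup>2 + (L2_norm g)\<^sup>2)"
proof -
  define g' where "g' = (SOME g. g \<in> L2 \<and> weak_deriv f g)"
  have g': "g' \<in> L2 \<and> weak_deriv f g'" unfolding g'_def by (rule someI[of _ g]) (use assms in auto)
  have "L2_norm g' = L2_norm g"
    unfolding L2_norm_def
    using weak_deriv_unique[of g' g f] g' assms L2_measurable
    by (intro arg_cong[where f=sqrt] integral_cong_AE) (auto elim: eventually_mono)
  then show ?thesis unfolding H1_norm_def g'_def[symmetric] by simp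
qed

text \<open>On the support of a test function only finitely many points are exceptional. The
  fundamental theorem of calculus for the product allows these, and continuity of \<open>q\<close>
  rules out jump terms.\<close>

lemma weak_deriv_piecewise:
  fixes q g :: "real \<Rightarrow> real" and T :: "real set"
  assumes cont: "continuous_on UNIV q"
    and T: "\<And>a b. finite (T \<inter> {a..b})"
    and deriv: "\<And>x. x \<notin> T \<Longrightarrow> (q has_real_derivative g x) (at x)"
    and L2: "(\<lambda>x. of_real (q x)) \<in> L2" "(\<lambda>x. of_real (g x)) \<in> L2"
  shows "weak_deriv (\<lambda>x. of_real (q x)) (\<lambda>x. of_real (g x))"
  unfolding weak_deriv_def
proof (intro allI impI)
  fix \<phi> assume \<phi>: "test_fun \<phi>"
  obtain R where R: "0 < R" "\<And>x. R \<le> \<bar>x\<bar> \<Longrightarrow> \<phi> x = 0" "\<And>x. R \<le> \<bar>x\<bar> \<Longrightarrow> deriv \<phi> x = 0"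
    using test_fun_support[OF \<phi>] by metis
  define F where "F x = \<phi> x * q x" for x
  define F' where "F' x = deriv \<phi> x * q x + \<phi> x * g x" for x
  have "(F' has_integral (F R - F (- R))) {-R..R}"
  proof (rule fundamental_theorem_of_calculus_interior_strong)
    show "finite (T \<inter> {-R..R})" by (rule T)
    show "continuous_on {-R..R} F"
      unfolding F_def using test_fun_continuous[OF \<phi>] cont by (auto intro!: continuous_intros intro: continuous_on_subset)
    fix x assume "x \<in> {-R<..<R} - T \<inter> {-R..R}"
    then have "x \<notin> T" by auto
    then have "(F has_real_derivative F' x) (at x)"
      unfolding F_def F'_def
      by (auto intro!: derivative_eq_intros test_fun_derivative(1)[OF \<phi>] deriv simp: algebra_simps)
    then show "(F has_vector_derivative F' x) (at x)" by (simp add: has_real_derivative_iff_has_vector_derivative)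
  qed (use R in simp)
  moreover have "F R = 0" "F (- R) = 0" using R by (auto simp: F_def)
  ultimately have "(F' has_integral 0) {-R..R}" by simp
  then have i1: "(F' has_integral 0) UNIV"
    by (rule has_integral_on_superset) (use R in \<open>auto simp: F'_def not_le abs_if\<close>)
  note i = integrable_test_fun(2)[OF \<phi> L2(1)] integrable_test_fun(1)[OF \<phi> L2(2)]
  have r: "integrable lborel (\<lambda>x. deriv \<phi> x * q x)" "integrable lborel (\<lambda>x. \<phi> x * g x)"
    using integrable_Re[OF i(1)] integrable_Re[OF i(2)] by simp_all
  have "(F' has_integral (LINT x|lborel. F' x)) UNIV"
    unfolding F'_def by (intro has_integral_integral_lborel Bochner_Integration.integrable_add r)
  then have "(LINT x|lborel. F' x) = 0" using i1 by (rule has_integral_unique)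
  then have "(LINT x|lborel. deriv \<phi> x * q x) = - (LINT x|lborel. \<phi> x * g x)"
    unfolding F'_def using r by simp
  moreover have "(LINT x|lborel. deriv \<phi> x *\<^sub>R complex_of_real (q x)) = of_real (LINT x|lborel. deriv \<phi> x * q x)"
    "(LINT x|lborel. \<phi> x *\<^sub>R complex_of_real (g x)) = of_real (LINT x|lborel. \<phi> x * g x)"
    by (simp_all add: scaleR_conv_of_real flip: of_real_mult)
  ultimately show "(LINT x|lborel. deriv \<phi> x *\<^sub>R complex_of_real (q x)) = - (LINT x|lborel. \<phi> x *\<^sub>R complex_of_real (g x))"
    by simp
qed

section \<open>Interpolation of grid functions\<close>

definition sech_profile :: "real \<Rightarrow> real" where
  "sech_profile x = 1 / (2 * cosh (x / 2))"

definition sech_profile' :: "real \<Rightarrow> real" where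
  "sech_profile' x = - tanh (x / 2) * sech_profile x / 2"

lemma ground_state_eq: "ground_state x = of_real (sech_profile x)"
  by (simp add: ground_state_def sech_profile_def)

lemma sech_profile_pos: "0 < sech_profile x" by (simp add: sech_profile_def)

lemma sech_profile_le_exp: "sech_profile x \<le> exp (- (\<bar>x\<bar> / 2))"
proof -
  have "exp (\<bar>x\<bar> / 2) \<le> 2 * cosh (\<bar>x\<bar> / 2)" by (simp add: cosh_field_def)
  also have "cosh (\<bar>x\<bar> / 2) = cosh (x / 2)" using cosh_real_abs[of "x / 2"] by simp
  finally have "inverse (2 * cosh (x / 2)) \<le> inverse (exp (\<bar>x\<bar> / 2))"
    by (intro le_imp_inverse_le) auto
  then show ?thesis by (simp add: sech_profile_def exp_minus inverse_eq_divide)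
qed

lemma sech_profile_derivative: "(sech_profile has_real_derivative sech_profile' x) (at x)"
  unfolding sech_profile_def[abs_def] sech_profile'_def tanh_def
  by (auto intro!: derivative_eq_intros simp: power2_eq_square field_simps)

lemma sech_profile'_derivative:
  "(sech_profile' has_real_derivative (2 * (tanh (x / 2))\<^sup>2 - 1) * sech_profile x / 4) (at x)"
  unfolding sech_profile'_def[abs_def]
  by (auto intro!: derivative_eq_intros sech_profile_derivative
      simp: sech_profile'_def power2_eq_square field_simps)

lemma tanh_sq_le_1: "(tanh (x::real))\<^sup>2 \<le> 1"
proof -
  have "\<bar>tanh x\<bar> \<le> 1" using tanh_real_lt_1[of x] tanh_real_gt_neg1[of x] by linarith
  then show ?thesis by (simp only: abs_square_le_1)
qed

lemma sech_profile'_le: "\<bar>sech_profile' x\<bar> \<le> sech_profile x"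
proof -
  have "\<bar>tanh (x / 2)\<bar> \<le> 1" using tanh_real_lt_1[of "x / 2"] tanh_real_gt_neg1[of "x / 2"] by linarith
  then have "\<bar>tanh (x / 2)\<bar> * (sech_profile x / 2) \<le> 1 * (sech_profile x / 2)"
    using sech_profile_pos[of x] by (intro mult_right_mono) auto
  then show ?thesis using sech_profile_pos[of x] by (simp add: sech_profile'_def abs_mult)
qed

lemma sech_profile''_le: "\<bar>(2 * (tanh (x / 2))\<^sup>2 - 1) * sech_profile x / 4\<bar> \<le> sech_profile x"
proof -
  have "\<bar>2 * (tanh (x / 2))\<^sup>2 - 1\<bar> \<le> 1" using tanh_sq_le_1[of "x / 2"] zero_le_power2[of "tanh (x / 2)"] by linarith
  then have "\<bar>2 * (tanh (x / 2))\<^sup>2 - 1\<bar> * sech_profile x \<le> 1 * sech_profile x"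
    using sech_profile_pos[of x] by (intro mult_right_mono) auto
  then show ?thesis using sech_profile_pos[of x] by (simp add: abs_mult)
qed

lemma sech_profile_continuous: "continuous_on S sech_profile" "continuous_on S sech_profile'"
  by (rule DERIV_continuous_on, rule has_field_derivative_at_within,
      rule sech_profile_derivative sech_profile'_derivative)+

text \<open>Half the decay rate of the ground state: still square integrable, while the other half
  of the decay yields a power of h beyond the cut-off.\<close>

definition decay :: "real \<Rightarrow> real" where "decay x = exp (- (\<bar>x\<bar> / 4))"

lemma decay_pos: "0 < decay x" by (simp add: decay_def)

lemma decay_sq_integral:
  shows "integrable lborel (\<lambda>x. (decay x)\<^sup>2)" "(LINT x|lborel. (decay x)\<^sup>2) \<le> 4"
proof -
  define f where "f x = indicator {0..} x * exp (- x / 2)" for x :: real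
  have [measurable]: "f \<in> borel_measurable borel" unfolding f_def by measurable
  have "(\<integral>\<^sup>+x. ennreal (exp (- x / 2)) * indicator {0..} x \<partial>lborel) = ennreal (0 - (- 2 * exp (- 0 / 2)))"
  proof (rule nn_integral_FTC_atLeast)
    show "((\<lambda>x. - 2 * exp (- x / 2)) has_real_derivative exp (- x / 2)) (at x)" for x :: real
      by (auto intro!: derivative_eq_intros)
    have "((\<lambda>x::real. - 2 * exp (- (1/2) * x)) \<longlongrightarrow> - 2 * 0) at_top"
      by (intro tendsto_mult tendsto_const filterlim_compose[OF exp_at_bot]
          filterlim_tendsto_neg_mult_at_bot[OF tendsto_const] filterlim_ident) auto
    then show "((\<lambda>x::real. - 2 * exp (- x / 2)) \<longlongrightarrow> 0) at_top" by simp
  qed auto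
  then have nn: "(\<integral>\<^sup>+x. ennreal (f x) \<partial>lborel) = ennreal 2"
    by (simp add: f_def ennreal_mult' mult.commute ennreal_indicator)
  have i: "integrable lborel f"
    by (rule integrableI_nonneg) (simp, simp add: f_def, simp add: nn)
  have v: "(LINT x|lborel. f x) = 2"
  proof -
    have "AE x in lborel. 0 \<le> f x" by (simp add: f_def)
    then show ?thesis using integral_eq_nn_integral[of f lborel] by (simp add: nn)
  qed
  have i': "integrable lborel (\<lambda>x. f (- x))"
    using lborel_integrable_real_affine[OF i, of "-1" 0] by simp
  have v': "(LINT x|lborel. f (- x)) = 2"
    using lborel_integral_real_affine[of "-1" f 0] v by simp
  have le: "(decay x)\<^sup>2 \<le> f x + f (- x)" for x
    by (auto simp: decay_def f_def indicator_def power2_eq_square exp_add[symmetric] abs_if)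
  have meas: "(\<lambda>x. (decay x)\<^sup>2) \<in> borel_measurable lborel" unfolding decay_def by measurable
  show int: "integrable lborel (\<lambda>x. (decay x)\<^sup>2)"
    by (rule Bochner_Integration.integrable_bound[OF Bochner_Integration.integrable_add[OF i i'] meas])
      (use le in \<open>auto simp: f_def\<close>)
  have "(LINT x|lborel. (decay x)\<^sup>2) \<le> (LINT x|lborel. f x + f (- x))"
    by (intro integral_mono int Bochner_Integration.integrable_add i i' le)
  then show "(LINT x|lborel. (decay x)\<^sup>2) \<le> 4" using i i' v v' by simp
qed

section \<open>Step functions, sums over the whole grid and piecewise linear interpolation\<close>

lemma floor_cell: "0 < h \<Longrightarrow> \<lfloor>x / h\<rfloor> = l \<longleftrightarrow> of_int l * h \<le> x \<and> x < (of_int l + 1) * (h::real)"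
  by (simp add: floor_eq_iff pos_le_divide_eq pos_divide_less_eq)

lemma step_integral:
  fixes c :: "int \<Rightarrow> real"
  assumes h: "0 < h" and c: "\<And>l. l \<notin> A \<Longrightarrow> c l = 0" and A: "finite A"
  shows "integrable lborel (\<lambda>x. c \<lfloor>x / h\<rfloor>)" "(LINT x|lborel. c \<lfloor>x / h\<rfloor>) = h * (\<Sum>l\<in>A. c l)"
proof -
  have cell: "indicator {of_int l * h..<(of_int l + 1) * h} x = (if \<lfloor>x / h\<rfloor> = l then 1 else (0::real))" for l x
    using floor_cell[OF h, of x l] by (simp add: indicator_def)
  have eq: "c \<lfloor>x / h\<rfloor> = (\<Sum>l\<in>A. c l * indicator {of_int l * h..<(of_int l + 1) * h} x)" for x
    unfolding cell using c A by (simp add: if_distrib[of "\<lambda>y. _ * y"] sum.delta' cong: if_cong)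
  have le: "of_int l * h \<le> (of_int l + 1) * h" for l :: int using h by (intro mult_right_mono) auto
  have "has_bochner_integral lborel (\<lambda>x. \<Sum>l\<in>A. c l * indicator {of_int l * h..<(of_int l + 1) * h} x)
     (\<Sum>l\<in>A. c l * measure lborel {of_int l * h..<(of_int l + 1) * h})"
    by (intro has_bochner_integral_sum has_bochner_integral_mult_right has_bochner_integral_real_indicator)
      (simp_all add: le)
  moreover have "measure lborel {of_int l * h..<(of_int l + 1) * h} = h" for l :: int
    using le[of l] by (simp add: distrib_right)
  ultimately have "has_bochner_integral lborel (\<lambda>x. c \<lfloor>x / h\<rfloor>) (h * (\<Sum>l\<in>A. c l))"
    unfolding eq by (simp add: sum_distrib_left mult.commute)
  then show "integrable lborel (\<lambda>x. c \<lfloor>x / h\<rfloor>)" "(LINT x|lborel. c \<lfloor>x / h\<rfloor>) = h * (\<Sum>l\<in>A. c l)"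
    by (auto simp: has_bochner_integral_iff)
qed

lemma int_interval_Suc: "{- int (Suc n)..int (Suc n)} = insert (- int (Suc n)) (insert (int (Suc n)) {- int n..int n})"
  by auto

lemma sum_even: "(\<Sum>l\<in>{- int n..int n}. f (nat \<bar>l\<bar>)) = (\<Sum>j\<le>n. weight j * f j)"
proof (induction n)
  case (Suc n)
  define g where "g l = f (nat \<bar>l\<bar>)" for l
  have "sum g (insert (- int (Suc n)) (insert (int (Suc n)) {- int n..int n}))
      = g (- int (Suc n)) + (g (int (Suc n)) + sum g {- int n..int n})"
    by (subst sum.insert; simp)
  moreover have "nat \<bar>- int (Suc n)\<bar> = Suc n" "nat \<bar>int (Suc n)\<bar> = Suc n" by auto
  then have "g (- int (Suc n)) = f (Suc n)" "g (int (Suc n)) = f (Suc n)" unfolding g_def by (simp_all only:)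
  ultimately show ?case
    using Suc.IH unfolding int_interval_Suc g_def[symmetric] by (simp add: weight_def)
qed (simp add: weight_def)

text \<open>Reflection sends the edge from l to l + 1 to the one from -l - 1 to -l with its ends
  exchanged, hence the symmetry of \<open>f\<close>. The range has one more edge on the left so that
  it is invariant under this.\<close>

lemma sum_even_edges:
  assumes sym: "\<And>a b. f a b = (f b a :: real)"
  shows "(\<Sum>l\<in>{- int n - 1..int n}. f (nat \<bar>l\<bar>) (nat \<bar>l + 1\<bar>)) = 2 * (\<Sum>j\<le>n. f j (Suc j))"
proof (induction n)
  case 0
  have "{- int 0 - 1..int 0} = {-1, 0}" by auto
  then show ?case by (simp add: sym[of "Suc 0" 0])
next
  case (Suc n)
  have i: "{- int (Suc n) - 1..int (Suc n)} = insert (- int (Suc n) - 1) (insert (int (Suc n)) {- int n - 1..int n})"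
    by auto
  have e: "nat \<bar>- int (Suc n) - 1\<bar> = Suc (Suc n)" "nat \<bar>- int (Suc n) - 1 + 1\<bar> = Suc n"
    "nat \<bar>int (Suc n)\<bar> = Suc n" "nat \<bar>int (Suc n) + 1\<bar> = Suc (Suc n)" by auto
  define g where "g l = f (nat \<bar>l\<bar>) (nat \<bar>l + 1\<bar>)" for l
  have "sum g (insert (- int (Suc n) - 1) (insert (int (Suc n)) {- int n - 1..int n}))
      = g (- int (Suc n) - 1) + (g (int (Suc n)) + sum g {- int n - 1..int n})"
    by (subst sum.insert; simp)
  moreover have "g (- int (Suc n) - 1) = f (Suc n) (Suc (Suc n))" "g (int (Suc n)) = f (Suc n) (Suc (Suc n))"
    unfolding g_def e by (rule sym refl)+
  ultimately show ?case
    using Suc.IH unfolding i g_def[symmetric] by simp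
qed

text \<open>The interpolant on the cell of \<open>x\<close>, where at most two hat functions are
  nonzero; the integer part selects the left node.\<close>

definition lin :: "real \<Rightarrow> (int \<Rightarrow> real) \<Rightarrow> real \<Rightarrow> real" where
  "lin h v x = v \<lfloor>x / h\<rfloor> + (x / h - of_int \<lfloor>x / h\<rfloor>) * (v (\<lfloor>x / h\<rfloor> + 1) - v \<lfloor>x / h\<rfloor>)"

lemma hat_outside: "l \<noteq> \<lfloor>y\<rfloor> \<Longrightarrow> l \<noteq> \<lfloor>y\<rfloor> + 1 \<Longrightarrow> hat (y - of_int l) = 0"
  unfolding hat_def by linarith

lemma lin_hat:
  "lin h v x = v \<lfloor>x / h\<rfloor> * hat (x / h - of_int \<lfloor>x / h\<rfloor>) + v (\<lfloor>x / h\<rfloor> + 1) * hat (x / h - of_int (\<lfloor>x / h\<rfloor> + 1))"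
proof -
  define y m where "y = x / h" and "m = \<lfloor>y\<rfloor>"
  have "of_int m \<le> y" "y < of_int m + 1" by (auto simp: m_def)
  then have hats: "hat (y - of_int m) = 1 - (y - of_int m)" "hat (y - of_int (m + 1)) = y - of_int m"
    by (auto simp: hat_def)
  show ?thesis unfolding lin_def y_def[symmetric] m_def[symmetric] hats by (simp add: algebra_simps)
qed

lemma interpolant_lin: "interpolant h (\<lambda>l. of_real (v l)) x = of_real (lin h v x)"
proof -
  define m where "m = \<lfloor>x / h\<rfloor>"
  have "interpolant h (\<lambda>l. of_real (v l)) x = (\<Sum>\<^sub>\<infinity>l\<in>{m, m + 1}. complex_of_real (v l) * of_real (hat (x / h - of_int l)))"
    unfolding interpolant_def m_def by (rule infsum_cong_neutral) (auto simp: hat_outside)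
  also have "\<dots> = of_real (lin h v x)" by (simp add: lin_hat m_def)
  finally show ?thesis .
qed

lemma lin_sum:
  assumes "finite A" "\<And>l. l \<notin> A \<Longrightarrow> v l = 0"
  shows "lin h v x = (\<Sum>l\<in>A. v l * hat (x / h - of_int l))"
proof -
  have "of_real (lin h v x) = (\<Sum>\<^sub>\<infinity>l\<in>A. complex_of_real (v l) * of_real (hat (x / h - of_int l)))"
    unfolding interpolant_lin[symmetric] interpolant_def
    by (rule infsum_cong_neutral) (use assms in auto)
  also have "\<dots> = of_real (\<Sum>l\<in>A. v l * hat (x / h - of_int l))" using assms by simp
  finally show ?thesis by (simp only: of_real_eq_iff)
qed

lemma lin_continuous:
  assumes h: "0 < h" and "finite A" "\<And>l. l \<notin> A \<Longrightarrow> v l = 0"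
  shows "continuous_on UNIV (lin h v)"
proof -
  have "continuous_on UNIV (\<lambda>x. \<Sum>l\<in>A. v l * hat (x / h - of_int l))"
    unfolding hat_def using h by (intro continuous_intros) auto
  moreover have "lin h v = (\<lambda>x. \<Sum>l\<in>A. v l * hat (x / h - of_int l))" using lin_sum[OF assms(2,3)] by auto
  ultimately show ?thesis by simp
qed

lemma lin_derivative:
  assumes h: "0 < h" and x: "x \<notin> range (\<lambda>l::int. of_int l * h)"
  shows "(lin h v has_real_derivative (v (\<lfloor>x / h\<rfloor> + 1) - v \<lfloor>x / h\<rfloor>) / h) (at x)"
proof -
  define m where "m = \<lfloor>x / h\<rfloor>"
  have mx: "of_int m * h \<le> x" "x < (of_int m + 1) * h" using floor_cell[OF h, of x m] by (auto simp: m_def)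
  moreover have "of_int m * h \<noteq> x" using x by auto
  ultimately have xin: "x \<in> {of_int m * h<..<(of_int m + 1) * h}" by auto
  have "((\<lambda>x. v m + (x / h - of_int m) * (v (m + 1) - v m)) has_real_derivative (v (m + 1) - v m) / h) (at x)"
    using h by (auto intro!: derivative_eq_intros)
  then have "(lin h v has_real_derivative (v (m + 1) - v m) / h) (at x)"
  proof (rule has_field_derivative_transform_within_open[OF _ open_greaterThanLessThan xin])
    fix y assume "y \<in> {of_int m * h<..<(of_int m + 1) * h}"
    then have "\<lfloor>y / h\<rfloor> = m" using floor_cell[OF h, of y m] by auto
    then show "v m + (y / h - of_int m) * (v (m + 1) - v m) = lin h v y" by (simp add: lin_def)
  qed
  then show ?thesis by (simp add: m_def)
qed

lemma finite_grid_points: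
  assumes "0 < h" shows "finite (range (\<lambda>l::int. of_int l * h) \<inter> {a..b::real})"
proof (rule finite_subset)
  show "range (\<lambda>l::int. of_int l * h) \<inter> {a..b} \<subseteq> (\<lambda>l. of_int l * h) ` {\<lfloor>a / h\<rfloor>..\<lceil>b / h\<rceil>}"
  proof
    fix y assume "y \<in> range (\<lambda>l::int. of_int l * h) \<inter> {a..b}"
    then obtain l :: int where l: "y = of_int l * h" "a \<le> of_int l * h" "of_int l * h \<le> b" by auto
    then have "a / h \<le> of_int l" "of_int l \<le> b / h"
      using assms by (simp_all add: pos_divide_le_eq pos_le_divide_eq)
    then have "\<lfloor>a / h\<rfloor> \<le> l" "l \<le> \<lceil>b / h\<rceil>" by linarith+
    then have "l \<in> {\<lfloor>a / h\<rfloor>..\<lceil>b / h\<rceil>}" by simp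
    then show "y \<in> (\<lambda>l. of_int l * h) ` {\<lfloor>a / h\<rfloor>..\<lceil>b / h\<rceil>}" using l by auto
  qed
qed simp

lemma abs_cell_bounds:
  assumes h: "0 < h" and l: "\<lfloor>x / h\<rfloor> = l" and y: "of_int l * h \<le> y" "y \<le> (of_int l + 1) * (h::real)"
  shows "\<bar>x\<bar> - h \<le> \<bar>y\<bar>"
proof -
  have "of_int l * h \<le> x" "x < (of_int l + 1) * h" using floor_cell[OF h, of x l] l by auto
  then show ?thesis using y unfolding distrib_right by linarith
qed

text \<open>Where both nodes of a cell carry samples, the mean value theorem applies, with first and
  second derivative bounded by the profile. In the other cells |x| \<ge> h K, and profile and node
  values are below h^2 \<open>decay x\<close>, so even their quotient by h is of order h.\<close>

lemma interpolation_error: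
  fixes e :: "int \<Rightarrow> real"
  assumes h: "0 < h" "h \<le> 1/2" and trunc: "exp (- (h * real K / 4)) \<le> h^4"
    and e: "\<And>l. \<bar>l\<bar> \<le> int K \<Longrightarrow> e l = sech_profile (of_int l * h)" "\<And>l. \<bar>l\<bar> > int K \<Longrightarrow> e l = 0"
  shows "\<bar>lin h e x - sech_profile x\<bar> \<le> 4 * h * decay x"
    and "\<bar>(e (\<lfloor>x / h\<rfloor> + 1) - e \<lfloor>x / h\<rfloor>) / h - sech_profile' x\<bar> \<le> 4 * h * decay x"
proof -
  define m where "m = \<lfloor>x / h\<rfloor>"
  define p where "p = of_int m * h"
  have p1: "(of_int m + 1) * h = p + h" "of_int (m + 1) * h = p + h" by (simp_all add: p_def distrib_right)
  have fl: "\<lfloor>x / h\<rfloor> = m" by (simp add: m_def)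
  have px: "p \<le> x" "x < p + h"
    using iffD1[OF floor_cell[OF h(1)] fl] unfolding p1 p_def[symmetric] by auto
  have cell: "\<bar>x\<bar> - h \<le> \<bar>y\<bar>" if "p \<le> y" "y \<le> p + h" for y
    using abs_cell_bounds[OF h(1) fl, of y] that unfolding p1 p_def[symmetric] by blast
  have exp2: "exp (h / 2) \<le> 2" using exp_bound_half[of "h / 2"] h by simp
  have near: "sech_profile y \<le> 2 * decay x" if "p \<le> y" "y \<le> p + h" for y
  proof -
    have "\<bar>x\<bar> - h \<le> \<bar>y\<bar>" using cell that .
    then have "exp (- (\<bar>y\<bar> / 2)) \<le> exp (h / 2 - \<bar>x\<bar> / 2)" unfolding exp_le_cancel_iff by linarith
    then have "sech_profile y \<le> exp (h / 2 - \<bar>x\<bar> / 2)" using sech_profile_le_exp[of y] by linarith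
    also have "\<dots> \<le> exp (h / 2 + - (\<bar>x\<bar> / 4))" by simp
    also have "\<dots> = exp (h / 2) * decay x" unfolding decay_def exp_add ..
    also have "\<dots> \<le> 2 * decay x" using exp2 decay_pos[of x] by (intro mult_right_mono) auto
    finally show ?thesis .
  qed
  define s where "s = (e (m + 1) - e m) / h"
  have lin: "lin h e x = e m + (x - p) * s"
  proof -
    have "x / h - of_int m = (x - p) / h" using h(1) by (simp add: p_def diff_divide_distrib)
    then show ?thesis unfolding lin_def m_def[symmetric] s_def by simp
  qed
  have goal: "\<bar>lin h e x - sech_profile x\<bar> \<le> 4 * h * decay x \<and> \<bar>s - sech_profile' x\<bar> \<le> 4 * h * decay x"
  proof (cases "\<bar>m\<bar> \<le> int K \<and> \<bar>m + 1\<bar> \<le> int K")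
    case True
    then have ev: "e m = sech_profile p" "e (m + 1) = sech_profile (p + h)"
      using e(1)[of m] e(1)[of "m + 1"] unfolding p1(2) p_def[symmetric] by blast+
    obtain \<xi> where \<xi>: "p < \<xi>" "\<xi> < p + h" "sech_profile (p + h) - sech_profile p = (p + h - p) * sech_profile' \<xi>"
    proof -
      have "\<exists>z>p. z < p + h \<and> sech_profile (p + h) - sech_profile p = (p + h - p) * sech_profile' z"
        by (rule MVT2) (use h(1) sech_profile_derivative in simp_all)
      then show thesis using that by blast
    qed
    then have s: "s = sech_profile' \<xi>" using h by (simp add: s_def ev)
    have d0: "\<bar>sech_profile' y\<bar> \<le> 2 * decay x" if "p \<le> y" "y \<le> p + h" for y
      using order.trans[OF sech_profile'_le near[OF that]] .
    have lip: "\<bar>F b - F a\<bar> \<le> h * (2 * decay x)"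
      if ab: "p \<le> a" "a \<le> p + h" "p \<le> b" "b \<le> p + h"
        and F: "\<And>y. (F has_real_derivative F' y) (at y)" "\<And>y. \<bar>F' y\<bar> \<le> sech_profile y" for a b and F F' :: "real \<Rightarrow> real"
    proof -
      have main: "\<bar>F b - F a\<bar> \<le> h * (2 * decay x)" if "a < b" "p \<le> a" "b \<le> p + h" for a b
      proof -
        obtain \<theta> where \<theta>: "a < \<theta>" "\<theta> < b" "F b - F a = (b - a) * F' \<theta>"
          using MVT2[OF \<open>a < b\<close>, of F F'] F(1) by blast
        have "\<bar>F' \<theta>\<bar> \<le> 2 * decay x" using order.trans[OF F(2) near[of \<theta>]] \<theta> that by simp
        then have "\<bar>b - a\<bar> * \<bar>F' \<theta>\<bar> \<le> h * (2 * decay x)" using that h by (intro mult_mono) auto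
        then show ?thesis by (simp add: \<theta>(3) abs_mult)
      qed
      consider "a < b" | "b < a" | "a = b" by linarith
      then show ?thesis
      proof cases
        case 2
        then show ?thesis using main[of b a] ab by (simp add: abs_minus_commute)
      qed (use main[of a b] ab h decay_pos[of x] in auto)
    qed
    have "\<bar>sech_profile x - sech_profile p\<bar> \<le> h * (2 * decay x)"
      by (rule lip[OF _ _ _ _ sech_profile_derivative sech_profile'_le]) (use px h(1) in simp_all)
    moreover have "\<bar>x - p\<bar> * \<bar>s\<bar> \<le> h * (2 * decay x)"
      using px h d0[of \<xi>] \<xi> by (intro mult_mono) (auto simp: s)
    then have "\<bar>(x - p) * s\<bar> \<le> h * (2 * decay x)" by (simp add: abs_mult)
    ultimately have "\<bar>lin h e x - sech_profile x\<bar> \<le> 4 * h * decay x" unfolding lin ev by linarith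
    moreover have "\<bar>sech_profile' \<xi> - sech_profile' x\<bar> \<le> h * (2 * decay x)"
      by (rule lip[OF _ _ _ _ sech_profile'_derivative sech_profile''_le]) (use px h(1) \<xi> in simp_all)
    then have "\<bar>s - sech_profile' x\<bar> \<le> 4 * h * decay x"
      unfolding s using mult_pos_pos[OF h(1) decay_pos[of x]] by linarith
    ultimately show ?thesis ..
  next
    case False
    then have mK: "m \<ge> int K \<or> m \<le> - int K - 1" by auto
    have xK: "h * real K \<le> \<bar>x\<bar>"
    proof (cases "m \<ge> int K")
      case True
      then have "real K * h \<le> p" unfolding p_def using h by (intro mult_right_mono) auto
      then show ?thesis using px by (simp add: mult.commute)
    next
      case False
      then have "m + 1 \<le> - int K" using mK by simp
      then have "real_of_int (m + 1) \<le> real_of_int (- int K)" by (simp only: of_int_le_iff)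
      then have "of_int (m + 1) * h \<le> (- real K) * h" using h(1) by (intro mult_right_mono) simp_all
      then show ?thesis using px unfolding p1 by (simp add: mult.commute)
    qed
    have kink_step: "h^4 \<le> h\<^sup>2" "h\<^sup>2 \<le> h" using h power_decreasing[of 2 4 h] power_decreasing[of 1 2 h] by auto
    have G: "0 < h\<^sup>2 * decay x" using h decay_pos[of x] by simp
    have "exp (- (\<bar>x\<bar> / 2)) = exp (- (\<bar>x\<bar> / 4)) * decay x" by (simp add: decay_def exp_add[symmetric])
    also have "\<dots> \<le> exp (- (h * real K / 4)) * decay x" using xK decay_pos[of x] by (intro mult_right_mono) auto
    also have "\<dots> \<le> h^4 * decay x" using trunc decay_pos[of x] by (intro mult_right_mono) auto
    also have "\<dots> \<le> h\<^sup>2 * decay x" using kink_step decay_pos[of x] by (intro mult_right_mono) auto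
    finally have tail: "sech_profile x \<le> h\<^sup>2 * decay x" using sech_profile_le_exp[of x] by linarith
    \<comment> \<open>The cell may touch the node K or -K, whose sample is nonzero. Its bound exp (-
      h K / 2) is split in two equal factors: one is at most h^4, the other becomes
      \<open>decay x\<close> up to a constant.\<close>
    have val: "0 \<le> e l \<and> e l \<le> h\<^sup>2 * decay x" if l: "l = m \<or> l = m + 1" for l
    proof (cases "\<bar>l\<bar> \<le> int K")
      case True
      then have lK: "\<bar>l\<bar> = int K" using l mK by auto
      define y where "y = of_int l * h"
      have y: "p \<le> y" "y \<le> p + h" using l h(1) unfolding y_def by (auto simp: p1(2) p_def[symmetric] simp del: of_int_add)
      have "\<bar>real_of_int l\<bar> = real_of_int \<bar>l\<bar>" by simp
      also have "\<dots> = real K" unfolding lK by simp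
      finally have ay: "\<bar>y\<bar> = h * real K" using h(1) unfolding y_def abs_mult by simp
      have "\<bar>x\<bar> - h \<le> \<bar>y\<bar>" using cell y .
      have "sech_profile y \<le> exp (- (h * real K / 2))" using sech_profile_le_exp[of y] by (simp add: ay)
      also have "\<dots> = exp (- (h * real K / 4)) * exp (- (h * real K / 4))" by (simp add: exp_add[symmetric])
      also have "\<dots> \<le> h^4 * exp (h / 4 - \<bar>x\<bar> / 4)"
        using trunc \<open>\<bar>x\<bar> - h \<le> \<bar>y\<bar>\<close> by (intro mult_mono) (auto simp: ay)
      also have "exp (h / 4 - \<bar>x\<bar> / 4) = exp (h / 4) * decay x" by (simp add: decay_def exp_add[symmetric])
      also have "h^4 * (exp (h / 4) * decay x) \<le> h^4 * (2 * decay x)"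
      proof -
        have "exp (h / 4) \<le> exp (h / 2)" using h by simp
        then have "exp (h / 4) \<le> 2" using exp2 by linarith
        then show ?thesis using decay_pos[of x] h by (intro mult_left_mono mult_right_mono) auto
      qed
      also have "\<dots> = (2 * h\<^sup>2) * (h\<^sup>2 * decay x)" by (simp add: power2_eq_square power4_eq_xxxx)
      also have "\<dots> \<le> 1 * (h\<^sup>2 * decay x)"
        using G power_mono[of h "1/2" 2] h by (intro mult_right_mono) (auto simp: power2_eq_square)
      finally show ?thesis using e(1)[OF True] sech_profile_pos[of y] by (simp add: y_def[symmetric])
    next
      case F: False
      then show ?thesis using e(2)[of l] G by simp
    qed
    have "\<bar>e (m + 1) - e m\<bar> \<le> h\<^sup>2 * decay x" using val[of m] val[of "m + 1"] by auto
    then have sb: "\<bar>s\<bar> \<le> h * decay x" using h by (simp add: s_def power2_eq_square abs_divide field_simps)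
    have hG: "h\<^sup>2 * decay x \<le> h * decay x" using kink_step decay_pos[of x] by (intro mult_right_mono) auto
    have "\<bar>x - p\<bar> * \<bar>s\<bar> \<le> 1 * (h * decay x)" using px h sb by (intro mult_mono) auto
    then have "\<bar>(x - p) * s\<bar> \<le> h * decay x" by (simp add: abs_mult)
    then have "\<bar>lin h e x - sech_profile x\<bar> \<le> 4 * h * decay x"
      unfolding lin using val[of m] tail hG sech_profile_pos[of x] by linarith
    moreover have "\<bar>s - sech_profile' x\<bar> \<le> 4 * h * decay x"
      using sb tail hG sech_profile'_le[of x] mult_pos_pos[OF h(1) decay_pos[of x]] by linarith
    ultimately show ?thesis ..
  qed
  then show "\<bar>lin h e x - sech_profile x\<bar> \<le> 4 * h * decay x"
    and "\<bar>(e (\<lfloor>x / h\<rfloor> + 1) - e \<lfloor>x / h\<rfloor>) / h - sech_profile' x\<bar> \<le> 4 * h * decay x"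
    unfolding s_def m_def by blast+
qed

lemma integral_le_of_sq_le:
  fixes f f1 f2 :: "real \<Rightarrow> real"
  assumes f: "f \<in> borel_measurable lborel" and f1: "integrable lborel f1" and f2: "integrable lborel f2"
    and le: "\<And>x. (f x)\<^sup>2 \<le> a * f1 x + b * f2 x"
  shows "integrable lborel (\<lambda>x. (f x)\<^sup>2)"
    and "(LINT x|lborel. (f x)\<^sup>2) \<le> a * (LINT x|lborel. f1 x) + b * (LINT x|lborel. f2 x)"
proof -
  have i: "integrable lborel (\<lambda>x. a * f1 x + b * f2 x)" using f1 f2 by simp
  have m: "(\<lambda>x. (f x)\<^sup>2) \<in> borel_measurable lborel" using f by measurable
  show int: "integrable lborel (\<lambda>x. (f x)\<^sup>2)"
  proof (rule Bochner_Integration.integrable_bound[OF i m])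
    show "AE x in lborel. norm ((f x)\<^sup>2) \<le> norm (a * f1 x + b * f2 x)"
    proof (rule AE_I2)
      fix x show "norm ((f x)\<^sup>2) \<le> norm (a * f1 x + b * f2 x)"
        using le[of x] zero_le_power2[of "f x"] by (simp only: real_norm_def abs_of_nonneg)
    qed
  qed
  have "(LINT x|lborel. (f x)\<^sup>2) \<le> (LINT x|lborel. a * f1 x + b * f2 x)"
    by (rule integral_mono[OF int i le])
  then show "(LINT x|lborel. (f x)\<^sup>2) \<le> a * (LINT x|lborel. f1 x) + b * (LINT x|lborel. f2 x)"
    using f1 f2 by simp
qed

lemma sq_add_le: "(a + b)\<^sup>2 \<le> 2 * a\<^sup>2 + 2 * (b\<^sup>2 :: real)"
  using zero_le_power2[of "a - b"] by (simp add: power2_sum power2_diff)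

section \<open>The \<open>H1\<close> distance to the ground state in terms of the discrete
  deviation\<close>

locale sampled_profile = truncated_grid +
  fixes u :: "nat \<Rightarrow> real"
  assumes supp: "supported u"
begin

definition dev :: "nat \<Rightarrow> real" where "dev j = u j - soliton j"
definition u_ext :: "int \<Rightarrow> real" where "u_ext l = u (nat \<bar>l\<bar>)"
definition soliton_ext :: "int \<Rightarrow> real" where "soliton_ext l = soliton (nat \<bar>l\<bar>)"
definition dev_ext :: "int \<Rightarrow> real" where "dev_ext l = dev (nat \<bar>l\<bar>)"
definition slope :: "(int \<Rightarrow> real) \<Rightarrow> int \<Rightarrow> real" where "slope v l = (v (l + 1) - v l) / h"
text \<open>\<open>q\<close> is the error on the line and \<open>g\<close> its derivative off the
  nodes. \<open>r\<close> and \<open>r'\<close> are the same quantities for the truncated soliton,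
  hence pure interpolation errors of order h.\<close>

definition q :: "real \<Rightarrow> real" where "q x = lin h u_ext x - sech_profile x"
definition g :: "real \<Rightarrow> real" where "g x = slope u_ext \<lfloor>x / h\<rfloor> - sech_profile' x"
definition r :: "real \<Rightarrow> real" where "r x = lin h soliton_ext x - sech_profile x"
definition r' :: "real \<Rightarrow> real" where "r' x = slope soliton_ext \<lfloor>x / h\<rfloor> - sech_profile' x"

lemma soliton_ext_inside: "\<bar>l\<bar> \<le> int K \<Longrightarrow> soliton_ext l = sech_profile (of_int l * h)"
proof -
  assume l: "\<bar>l\<bar> \<le> int K"
  have "cosh (\<bar>real_of_int l\<bar> * h / 2) = cosh (of_int l * h / 2)"
    using cosh_real_abs[of "of_int l * h / 2"] h_pos by (simp add: abs_mult)
  moreover have "real (nat \<bar>l\<bar>) = \<bar>real_of_int l\<bar>" by simp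
  moreover have "nat \<bar>l\<bar> \<le> K" using l by simp
  ultimately show ?thesis by (simp only: soliton_ext_def soliton_def sech_sample_def sech_profile_def if_True)
qed

lemma outside:
  assumes "l \<notin> {- int K..int K}" shows "u_ext l = 0" "soliton_ext l = 0" "dev_ext l = 0"
proof -
  have "K < nat \<bar>l\<bar>" using assms by auto
  then show "u_ext l = 0" "soliton_ext l = 0" "dev_ext l = 0"
    using supp by (auto simp: u_ext_def soliton_ext_def dev_ext_def dev_def supported_def soliton_def)
qed

lemma slope_outside:
  assumes "l \<notin> {- int K - 1..int K}" shows "slope u_ext l = 0" "slope dev_ext l = 0"
  using assms outside[of l] outside[of "l + 1"] by (auto simp: slope_def)

lemma soliton_ext_outside: "\<bar>l\<bar> > int K \<Longrightarrow> soliton_ext l = 0"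
  by (rule outside(2)) auto

lemma r_bounds: "\<bar>r x\<bar> \<le> 4 * h * decay x" "\<bar>r' x\<bar> \<le> 4 * h * decay x"
  using interpolation_error[OF h_pos h_le trunc soliton_ext_inside soliton_ext_outside]
  unfolding r_def r'_def slope_def by blast+

lemma u_ext_split: "u_ext l = dev_ext l + soliton_ext l" by (simp add: u_ext_def dev_ext_def dev_def soliton_ext_def)

lemma q_split: "q x = lin h dev_ext x + r x"
  by (simp add: q_def r_def lin_def u_ext_split algebra_simps)

lemma g_split: "g x = slope dev_ext \<lfloor>x / h\<rfloor> + r' x"
  by (simp add: g_def r'_def slope_def u_ext_split add_divide_distrib diff_divide_distrib)

lemma cont: "continuous_on UNIV (lin h u_ext)" "continuous_on UNIV (lin h soliton_ext)" "continuous_on UNIV (lin h dev_ext)"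
proof -
  note c = lin_continuous[OF h_pos finite_atLeastAtMost_int[of "- int K" "int K"]]
  show "continuous_on UNIV (lin h u_ext)" "continuous_on UNIV (lin h soliton_ext)" "continuous_on UNIV (lin h dev_ext)"
    by (rule c[OF outside(1)] c[OF outside(2)] c[OF outside(3)]; assumption)+
qed

lemma q_cont: "continuous_on UNIV q"
  unfolding q_def[abs_def] by (intro continuous_on_diff cont(1) sech_profile_continuous)

lemma step_sq:
  "integrable lborel (\<lambda>x. (dev_ext \<lfloor>x / h\<rfloor>)\<^sup>2)" "(LINT x|lborel. (dev_ext \<lfloor>x / h\<rfloor>)\<^sup>2) = S (\<lambda>j. (dev j)\<^sup>2)"
proof -
  have z: "(dev_ext l)\<^sup>2 = 0" if "l \<notin> {- int K..int K}" for l using outside(3)[OF that] by simp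
  note s = step_integral[OF h_pos, of "{- int K..int K}" "\<lambda>l. (dev_ext l)\<^sup>2", OF z finite_atLeastAtMost_int]
  show "integrable lborel (\<lambda>x. (dev_ext \<lfloor>x / h\<rfloor>)\<^sup>2)" by (rule s(1))
  have "(\<Sum>l\<in>{- int K..int K}. (dev_ext l)\<^sup>2) = (\<Sum>j\<le>K. weight j * (dev j)\<^sup>2)"
    unfolding dev_ext_def by (rule sum_even)
  moreover have "(LINT x|lborel. (dev_ext \<lfloor>x / h\<rfloor>)\<^sup>2) = h * (\<Sum>l\<in>{- int K..int K}. (dev_ext l)\<^sup>2)" by (rule s(2))
  ultimately show "(LINT x|lborel. (dev_ext \<lfloor>x / h\<rfloor>)\<^sup>2) = S (\<lambda>j. (dev j)\<^sup>2)" by (simp only: S_def)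
qed

lemma step_slope_sq:
  "integrable lborel (\<lambda>x. (slope dev_ext \<lfloor>x / h\<rfloor>)\<^sup>2)" "(LINT x|lborel. (slope dev_ext \<lfloor>x / h\<rfloor>)\<^sup>2) = 2 * dform dev dev"
proof -
  have z: "(slope dev_ext l)\<^sup>2 = 0" if "l \<notin> {- int K - 1..int K}" for l using slope_outside(2)[OF that] by simp
  note s = step_integral[OF h_pos, of "{- int K - 1..int K}" "\<lambda>l. (slope dev_ext l)\<^sup>2", OF z finite_atLeastAtMost_int]
  show "integrable lborel (\<lambda>x. (slope dev_ext \<lfloor>x / h\<rfloor>)\<^sup>2)" by (rule s(1))
  have "(\<Sum>l\<in>{- int K - 1..int K}. (slope dev_ext l)\<^sup>2)
      = (\<Sum>l\<in>{- int K - 1..int K}. (\<lambda>a b. ((dev b - dev a) / h)\<^sup>2) (nat \<bar>l\<bar>) (nat \<bar>l + 1\<bar>))"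
    by (simp add: slope_def dev_ext_def)
  also have "\<dots> = 2 * (\<Sum>j\<le>K. ((dev (Suc j) - dev j) / h)\<^sup>2)"
    by (rule sum_even_edges) (simp add: power_divide power2_commute)
  finally have "h * (\<Sum>l\<in>{- int K - 1..int K}. (slope dev_ext l)\<^sup>2) = 2 * dform dev dev"
    using h_pos by (simp add: dform_def power_divide power2_eq_square sum_divide_distrib[symmetric])
  moreover have "(LINT x|lborel. (slope dev_ext \<lfloor>x / h\<rfloor>)\<^sup>2) = h * (\<Sum>l\<in>{- int K - 1..int K}. (slope dev_ext l)\<^sup>2)"
    by (rule s(2))
  ultimately show "(LINT x|lborel. (slope dev_ext \<lfloor>x / h\<rfloor>)\<^sup>2) = 2 * dform dev dev" by (simp only:)
qed

lemma step_measurable: "(\<lambda>x. slope u_ext \<lfloor>x / h\<rfloor>) \<in> borel_measurable lborel"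
  "(\<lambda>x. slope dev_ext \<lfloor>x / h\<rfloor>) \<in> borel_measurable lborel" "(\<lambda>x. dev_ext \<lfloor>x / h\<rfloor>) \<in> borel_measurable lborel"
  using step_integral(1)[OF h_pos, of "{- int K - 1..int K}" "slope u_ext", OF slope_outside(1)]
    step_integral(1)[OF h_pos, of "{- int K - 1..int K}" "slope dev_ext", OF slope_outside(2)]
    step_integral(1)[OF h_pos, of "{- int K..int K}" dev_ext, OF outside(3)]
  by (auto intro: borel_measurable_integrable)

lemma sech_measurable: "sech_profile \<in> borel_measurable lborel" "sech_profile' \<in> borel_measurable lborel"
  using sech_profile_continuous by (auto intro: borel_measurable_continuous_onI)

lemma measurable_all: "q \<in> borel_measurable lborel" "g \<in> borel_measurable lborel"
  "r \<in> borel_measurable lborel" "r' \<in> borel_measurable lborel"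
proof -
  show q: "q \<in> borel_measurable lborel" using q_cont by (auto intro: borel_measurable_continuous_onI)
  have "continuous_on UNIV r"
    unfolding r_def[abs_def] by (intro continuous_on_diff cont(2) sech_profile_continuous)
  then show "r \<in> borel_measurable lborel" by (auto intro: borel_measurable_continuous_onI)
  show g: "g \<in> borel_measurable lborel"
    unfolding g_def[abs_def] by (intro borel_measurable_diff step_measurable sech_measurable)
  have "r' = (\<lambda>x. g x - slope dev_ext \<lfloor>x / h\<rfloor>)" using g_split by auto
  then show "r' \<in> borel_measurable lborel" using borel_measurable_diff[OF g step_measurable(2)] by simp
qed

lemma error_integrals:
  assumes "f \<in> borel_measurable lborel" "\<And>x. \<bar>f x\<bar> \<le> 4 * h * decay x"
  shows "integrable lborel (\<lambda>x. (f x)\<^sup>2)" "(LINT x|lborel. (f x)\<^sup>2) \<le> 64 * h\<^sup>2"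
proof -
  have le: "(f x)\<^sup>2 \<le> 16 * h\<^sup>2 * (decay x)\<^sup>2 + 0 * (decay x)\<^sup>2" for x
    using power_mono[OF assms(2)[of x] abs_ge_zero, of 2] by (simp add: power_mult_distrib)
  note i = integral_le_of_sq_le[OF assms(1) decay_sq_integral(1) decay_sq_integral(1) le]
  show "integrable lborel (\<lambda>x. (f x)\<^sup>2)" by (rule i(1))
  have "16 * h\<^sup>2 * (LINT x|lborel. (decay x)\<^sup>2) \<le> 16 * h\<^sup>2 * 4"
    by (intro mult_left_mono decay_sq_integral(2)) simp
  then show "(LINT x|lborel. (f x)\<^sup>2) \<le> 64 * h\<^sup>2" using i(2) by simp
qed

lemma lin_dev_ext: "lin h dev_ext x = dev_ext \<lfloor>x / h\<rfloor> + (x / h - of_int \<lfloor>x / h\<rfloor>) * (h * slope dev_ext \<lfloor>x / h\<rfloor>)"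
  using h_pos by (simp add: lin_def slope_def)

lemma frac_slope_sq: "((x / h - of_int \<lfloor>x / h\<rfloor>) * (h * slope dev_ext \<lfloor>x / h\<rfloor>))\<^sup>2 \<le> h\<^sup>2 * (slope dev_ext \<lfloor>x / h\<rfloor>)\<^sup>2"
proof -
  have "0 \<le> x / h - of_int \<lfloor>x / h\<rfloor>" "x / h - of_int \<lfloor>x / h\<rfloor> \<le> 1" by linarith+
  then have "(x / h - of_int \<lfloor>x / h\<rfloor>)\<^sup>2 \<le> 1" by (rule power_le_one)
  then have "(x / h - of_int \<lfloor>x / h\<rfloor>)\<^sup>2 * (h * slope dev_ext \<lfloor>x / h\<rfloor>)\<^sup>2 \<le> 1 * (h * slope dev_ext \<lfloor>x / h\<rfloor>)\<^sup>2"
    by (intro mult_right_mono) auto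
  then show ?thesis by (simp add: power_mult_distrib)
qed

lemma lin_sq_integrals:
  "integrable lborel (\<lambda>x. (lin h dev_ext x)\<^sup>2)"
  "(LINT x|lborel. (lin h dev_ext x)\<^sup>2) \<le> 2 * S (\<lambda>j. (dev j)\<^sup>2) + 2 * h\<^sup>2 * (2 * dform dev dev)"
proof -
  have m: "lin h dev_ext \<in> borel_measurable lborel" using cont(3) by (auto intro: borel_measurable_continuous_onI)
  have le: "(lin h dev_ext x)\<^sup>2 \<le> 2 * (dev_ext \<lfloor>x / h\<rfloor>)\<^sup>2 + 2 * h\<^sup>2 * (slope dev_ext \<lfloor>x / h\<rfloor>)\<^sup>2" for x
    unfolding lin_dev_ext using sq_add_le[of "dev_ext \<lfloor>x / h\<rfloor>" "(x / h - of_int \<lfloor>x / h\<rfloor>) * (h * slope dev_ext \<lfloor>x / h\<rfloor>)"]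
      frac_slope_sq[of x] by linarith
  note i = integral_le_of_sq_le[OF m step_sq(1) step_slope_sq(1) le]
  show "integrable lborel (\<lambda>x. (lin h dev_ext x)\<^sup>2)" by (rule i(1))
  show "(LINT x|lborel. (lin h dev_ext x)\<^sup>2) \<le> 2 * S (\<lambda>j. (dev j)\<^sup>2) + 2 * h\<^sup>2 * (2 * dform dev dev)"
    using i(2) unfolding step_sq(2) step_slope_sq(2) .
qed

lemmas r_int = error_integrals[OF measurable_all(3) r_bounds(1)]
lemmas r'_int = error_integrals[OF measurable_all(4) r_bounds(2)]

lemma q_le: "(q x)\<^sup>2 \<le> 2 * (lin h dev_ext x)\<^sup>2 + 2 * (r x)\<^sup>2" unfolding q_split by (rule sq_add_le)
lemma g_le: "(g x)\<^sup>2 \<le> 2 * (slope dev_ext \<lfloor>x / h\<rfloor>)\<^sup>2 + 2 * (r' x)\<^sup>2" unfolding g_split by (rule sq_add_le)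

lemmas q_int = integral_le_of_sq_le[OF measurable_all(1) lin_sq_integrals(1) r_int(1) q_le]
lemmas g_int = integral_le_of_sq_le[OF measurable_all(2) step_slope_sq(1) r'_int(1) g_le]

lemma upper_bound:
  "(LINT x|lborel. (q x)\<^sup>2) + (LINT x|lborel. (g x)\<^sup>2)
     \<le> 6 * (dform dev dev + S (\<lambda>j. (dev j)\<^sup>2)) + 256 * h\<^sup>2"
proof -
  have s: "0 \<le> S (\<lambda>j. (dev j)\<^sup>2)" by (simp add: S_nonneg)
  have "h\<^sup>2 * (2 * dform dev dev) \<le> 1/4 * (2 * dform dev dev)"
    using h_sq_le dform_nonneg by (intro mult_right_mono) auto
  then show ?thesis
    using q_int(2) g_int(2) r_int(2) r'_int(2) lin_sq_integrals(2) s unfolding step_slope_sq(2) by argo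
qed

text \<open>Used for the initial state: the hypothesis is on the \<open>H1\<close> distance, whereas
  the energy method needs the discrete deviation. Node values are recovered from the interpolant up
  to h times the slope of the cell.\<close>

lemma lower_bound:
  "dform dev dev + S (\<lambda>j. (dev j)\<^sup>2)
     \<le> 4 * ((LINT x|lborel. (q x)\<^sup>2) + (LINT x|lborel. (g x)\<^sup>2)) + 400 * h\<^sup>2"
proof -
  define Q G where "Q = (LINT x|lborel. (q x)\<^sup>2)" and "G = (LINT x|lborel. (g x)\<^sup>2)"
  have QG: "0 \<le> Q" "0 \<le> G" by (auto simp: Q_def G_def)
  have diff: "(a - b)\<^sup>2 \<le> 2 * a\<^sup>2 + 2 * b\<^sup>2" for a b :: real using sq_add_le[of a "- b"] by simp
  have le1: "(slope dev_ext \<lfloor>x / h\<rfloor>)\<^sup>2 \<le> 2 * (g x)\<^sup>2 + 2 * (r' x)\<^sup>2" for x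
    using diff[of "g x" "r' x"] by (simp add: g_split)
  have D: "2 * dform dev dev \<le> 2 * G + 2 * (64 * h\<^sup>2)"
    using integral_le_of_sq_le(2)[OF step_measurable(2) g_int(1) r'_int(1) le1] r'_int(2)
    unfolding step_slope_sq(2) G_def by linarith
  have le2: "(lin h dev_ext x)\<^sup>2 \<le> 2 * (q x)\<^sup>2 + 2 * (r x)\<^sup>2" for x
    using diff[of "q x" "r x"] by (simp add: q_split)
  have L: "(LINT x|lborel. (lin h dev_ext x)\<^sup>2) \<le> 2 * Q + 2 * (64 * h\<^sup>2)"
  proof -
    have m: "lin h dev_ext \<in> borel_measurable lborel" using cont(3) by (auto intro: borel_measurable_continuous_onI)
    show ?thesis using integral_le_of_sq_le(2)[OF m q_int(1) r_int(1) le2] r_int(2) unfolding Q_def by linarith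
  qed
  have le3: "(dev_ext \<lfloor>x / h\<rfloor>)\<^sup>2 \<le> 2 * (lin h dev_ext x)\<^sup>2 + 2 * h\<^sup>2 * (slope dev_ext \<lfloor>x / h\<rfloor>)\<^sup>2" for x
  proof -
    define y where "y = (x / h - of_int \<lfloor>x / h\<rfloor>) * (h * slope dev_ext \<lfloor>x / h\<rfloor>)"
    have "dev_ext \<lfloor>x / h\<rfloor> = lin h dev_ext x - y" unfolding lin_dev_ext y_def by simp
    then have "(dev_ext \<lfloor>x / h\<rfloor>)\<^sup>2 \<le> 2 * (lin h dev_ext x)\<^sup>2 + 2 * y\<^sup>2" using diff[of "lin h dev_ext x" y] by simp
    moreover have "y\<^sup>2 \<le> h\<^sup>2 * (slope dev_ext \<lfloor>x / h\<rfloor>)\<^sup>2" unfolding y_def by (rule frac_slope_sq)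
    ultimately show ?thesis by linarith
  qed
  have "S (\<lambda>j. (dev j)\<^sup>2) \<le> 2 * (LINT x|lborel. (lin h dev_ext x)\<^sup>2) + 2 * h\<^sup>2 * (2 * dform dev dev)"
    using integral_le_of_sq_le(2)[OF step_measurable(3) lin_sq_integrals(1) step_slope_sq(1) le3]
    unfolding step_sq(2) step_slope_sq(2) .
  moreover have "h\<^sup>2 * (2 * dform dev dev) \<le> 1/4 * (2 * dform dev dev)"
    using h_sq_le dform_nonneg by (intro mult_right_mono) auto
  ultimately have "S (\<lambda>j. (dev j)\<^sup>2) \<le> 4 * Q + 256 * h\<^sup>2 + dform dev dev" using L by argo
  then show ?thesis using D QG zero_le_power2[of h] unfolding Q_def[symmetric] G_def[symmetric] by argo
qed

lemma L2_of_real: "f \<in> borel_measurable lborel \<Longrightarrow> integrable lborel (\<lambda>x. (f x)\<^sup>2) \<Longrightarrow> (\<lambda>x. of_real (f x)) \<in> L2"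
  by (simp add: L2_def)

lemma weak_deriv_q: "weak_deriv (\<lambda>x. of_real (q x)) (\<lambda>x. of_real (g x))"
proof (rule weak_deriv_piecewise[OF q_cont finite_grid_points[OF h_pos]])
  fix x assume x: "x \<notin> range (\<lambda>l::int. of_int l * h)"
  show "(q has_real_derivative g x) (at x)"
    unfolding q_def[abs_def] g_def slope_def
    by (intro DERIV_diff lin_derivative[OF h_pos x] sech_profile_derivative)
qed (intro L2_of_real measurable_all q_int(1) g_int(1))+

lemma interpolant_minus_ground_state:
  "(\<lambda>x. interpolant h (\<lambda>l. of_real (u (nat \<bar>l\<bar>))) x - ground_state x) = (\<lambda>x. of_real (q x))"
  unfolding u_ext_def[symmetric] interpolant_lin ground_state_eq q_def by simp

lemma interpolant_H1: "(\<lambda>x. interpolant h (\<lambda>l. of_real (u (nat \<bar>l\<bar>))) x - ground_state x) \<in> H1"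
  unfolding interpolant_minus_ground_state H1_def
  using weak_deriv_q L2_of_real measurable_all q_int(1) g_int(1) by blast

lemma interpolant_H1_norm:
  "(H1_norm (\<lambda>x. interpolant h (\<lambda>l. of_real (u (nat \<bar>l\<bar>))) x - ground_state x))\<^sup>2
     = (LINT x|lborel. (q x)\<^sup>2) + (LINT x|lborel. (g x)\<^sup>2)"
proof -
  have "H1_norm (\<lambda>x. of_real (q x)) = sqrt ((L2_norm (\<lambda>x. of_real (q x)))\<^sup>2 + (L2_norm (\<lambda>x. of_real (g x)))\<^sup>2)"
    by (rule H1_norm_eq[OF L2_of_real[OF measurable_all(2) g_int(1)] weak_deriv_q])
  then show ?thesis unfolding interpolant_minus_ground_state by (simp add: L2_norm_sq)
qed

end

section \<open>Convergence of the scheme\<close>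

abbreviation even_extension :: "(nat \<Rightarrow> real) \<Rightarrow> int \<Rightarrow> complex" where
  "even_extension u l \<equiv> of_real (u (nat \<bar>l\<bar>))"

text \<open>Maximum principle: where the difference of two solutions has largest modulus, the
  neighbours cannot balance the diagonal because \<tau> |p|^2 < 1. The sequences are complex and not
  assumed even, since uniqueness is claimed among all solutions of the scheme.\<close>

lemma implicit_step_unique:
  fixes p s1 s2 :: "int \<Rightarrow> complex"
  assumes h: "0 < h" and \<tau>: "0 < \<tau>" "\<tau> < 1" and p: "\<And>l. cmod (p l) \<le> 1"
    and s1: "\<And>l. \<bar>l\<bar> \<le> int K \<Longrightarrow> s1 l = p l + of_real \<tau> * (1 / 2 * discrete_laplacian h s1 l + of_real ((cmod (p l))\<^sup>2) * s1 l)"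
    and s2: "\<And>l. \<bar>l\<bar> \<le> int K \<Longrightarrow> s2 l = p l + of_real \<tau> * (1 / 2 * discrete_laplacian h s2 l + of_real ((cmod (p l))\<^sup>2) * s2 l)"
    and out: "\<And>l. \<bar>l\<bar> \<ge> int K + 1 \<Longrightarrow> s1 l = 0" "\<And>l. \<bar>l\<bar> \<ge> int K + 1 \<Longrightarrow> s2 l = 0"
  shows "s1 = s2"
proof -
  define d where "d l = s1 l - s2 l" for l
  define m where "m = Max ((\<lambda>l. cmod (d l)) ` {- int K..int K})"
  have fin: "finite ((\<lambda>l. cmod (d l)) ` {- int K..int K})" "(\<lambda>l. cmod (d l)) ` {- int K..int K} \<noteq> {}" by auto
  obtain l where lm: "m = cmod (d l)" and l: "l \<in> {- int K..int K}"
    using Max_in[OF fin] unfolding m_def[symmetric] by (rule imageE)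
  have m0: "0 \<le> m" unfolding lm by simp
  have le: "cmod (d k) \<le> m" for k
  proof (cases "k \<in> {- int K..int K}")
    case True
    then show ?thesis unfolding m_def by (intro Max_ge fin(1) imageI)
  next
    case False
    then have "\<bar>k\<bar> \<ge> int K + 1" by auto
    then show ?thesis using out m0 by (simp add: d_def)
  qed
  define P where "P = (cmod (p l))\<^sup>2"
  define \<kappa> where "\<kappa> = \<tau> / (2 * h\<^sup>2)"
  have \<kappa>: "0 < \<kappa>" using \<tau> h by (simp add: \<kappa>_def)
  have lK: "\<bar>l\<bar> \<le> int K" using l by auto
  have lap: "of_real \<tau> * (1 / 2 * discrete_laplacian h s l) = of_real \<kappa> * (s (l + 1) + s (l - 1) - 2 * s l)" for s
    by (simp add: discrete_laplacian_def \<kappa>_def)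
  have fix_point: "s l = p l + of_real \<kappa> * (s (l + 1) + s (l - 1) - 2 * s l) + of_real (\<tau> * P) * s l"
    if "s = s1 \<or> s = s2" for s
  proof -
    have "s l = p l + of_real \<tau> * (1 / 2 * discrete_laplacian h s l + of_real P * s l)"
      using that s1[OF lK] s2[OF lK] unfolding P_def by blast
    also have "\<dots> = p l + of_real \<tau> * (1 / 2 * discrete_laplacian h s l) + of_real (\<tau> * P) * s l"
      by (simp only: distrib_left mult.assoc add.assoc of_real_mult)
    finally show ?thesis unfolding lap .
  qed
  have lin: "(1 + 2 * k - t) * (a - b) = k * ((a1 - b1) + (a2 - b2))"
    if a: "a = c + k * (a1 + a2 - 2 * a) + t * a" and b: "b = c + k * (b1 + b2 - 2 * b) + t * b"
    for a b c k t a1 a2 b1 b2 :: complex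
  proof -
    have "(1 + 2 * k - t) * (a - b) - k * ((a1 - b1) + (a2 - b2))
        = (a - (c + k * (a1 + a2 - 2 * a) + t * a)) - (b - (c + k * (b1 + b2 - 2 * b) + t * b))"
      by (simp add: algebra_simps)
    also have "\<dots> = 0" unfolding a[symmetric] b[symmetric] by (simp only: diff_self)
    finally show ?thesis by (simp only: right_minus_eq)
  qed
  have eq: "of_real (1 + 2 * \<kappa> - \<tau> * P) * d l = of_real \<kappa> * (d (l + 1) + d (l - 1))"
    using lin[OF fix_point[OF disjI1[OF refl]] fix_point[OF disjI2[OF refl]]] 
    by (simp only: d_def of_real_add of_real_diff of_real_1 of_real_mult of_real_numeral)
  have "P \<le> 1" using p[of l] by (simp add: P_def power_le_one)
  then have "\<tau> * P \<le> \<tau> * 1" using \<tau> by (intro mult_left_mono) auto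
  then have pos: "0 < 1 - \<tau> * P" using \<tau> by linarith
  have "(1 + 2 * \<kappa> - \<tau> * P) * m = cmod (of_real (1 + 2 * \<kappa> - \<tau> * P) * d l)"
    unfolding norm_mult norm_of_real lm[symmetric] using pos \<kappa> by simp
  also have "\<dots> = \<kappa> * cmod (d (l + 1) + d (l - 1))" unfolding eq norm_mult norm_of_real using \<kappa> by simp
  also have "\<dots> \<le> \<kappa> * (m + m)"
    using \<kappa> le[of "l + 1"] le[of "l - 1"] norm_triangle_ineq[of "d (l + 1)" "d (l - 1)"] by (intro mult_left_mono) linarith+
  finally have "(1 - \<tau> * P) * m \<le> 0" by (simp add: algebra_simps)
  then have "m \<le> 0" using pos by (simp add: mult_le_0_iff)
  have "d k = 0" for k
  proof -
    have "cmod (d k) \<le> 0" using le[of k] \<open>m \<le> 0\<close> by (rule order.trans)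
    then show ?thesis by simp
  qed
  then show ?thesis by (auto simp: d_def fun_eq_iff)
qed

lemma gradient_schemeD:
  assumes "gradient_scheme h K \<tau> p \<psi> \<psi>s"
  shows "\<psi> 0 = p"
    and "\<bar>l\<bar> \<le> int K \<Longrightarrow> \<psi>s n l = \<psi> n l + of_real \<tau> *
      (1 / 2 * discrete_laplacian h (\<psi>s n) l + of_real ((cmod (\<psi> n l))\<^sup>2) * \<psi>s n l)"
    and "\<bar>l\<bar> \<ge> int K + 1 \<Longrightarrow> \<psi>s n l = 0"
    and "\<psi> (Suc n) l = \<psi>s n l / of_real (sqrt (discrete_mass h (\<psi>s n)))"
proof -
  note s = assms[unfolded gradient_scheme_def]
  show "\<psi> 0 = p" by (rule conjunct1[OF s])
  note t = spec[OF conjunct2[OF s], of n]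
  show "\<psi>s n l = \<psi> n l + of_real \<tau> *
      (1 / 2 * discrete_laplacian h (\<psi>s n) l + of_real ((cmod (\<psi> n l))\<^sup>2) * \<psi>s n l)" if "\<bar>l\<bar> \<le> int K"
    using that by (rule mp[OF spec[OF conjunct1[OF t]]])
  show "\<psi>s n l = 0" if "\<bar>l\<bar> \<ge> int K + 1"
    using that by (rule mp[OF spec[OF conjunct1[OF conjunct2[OF t]]]])
  show "\<psi> (Suc n) l = \<psi>s n l / of_real (sqrt (discrete_mass h (\<psi>s n)))"
    by (rule spec[OF conjunct2[OF conjunct2[OF conjunct2[OF t]]]])
qed

section \<open>Transfer between the half grid and even complex sequences\<close>

context grid
begin

lemma discrete_laplacian_even:
  "discrete_laplacian h (even_extension x) l = of_real (- 2 * half_lap x (nat \<bar>l\<bar>))"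
proof -
  define j where "j = nat \<bar>l\<bar>"
  have "(x (nat \<bar>l + 1\<bar>) + x (nat \<bar>l - 1\<bar>) - 2 * x j) / h\<^sup>2 = - 2 * half_lap x j"
  proof (cases "l = 0")
    case True
    then have "j = 0" "nat \<bar>l + 1\<bar> = 1" "nat \<bar>l - 1\<bar> = 1" by (simp_all add: j_def)
    then show ?thesis using h_pos by (simp add: half_lap_def field_simps)
  next
    case False
    then have j0: "j \<noteq> 0" by (simp add: j_def)
    have n: "- 2 * half_lap x j = (x (Suc j) + x (j - 1) - 2 * x j) / h\<^sup>2"
      using h_pos j0 by (simp add: half_lap_def field_simps)
    show ?thesis
    proof (cases "l > 0")
      case True
      then have a: "nat \<bar>l + 1\<bar> = Suc j" "nat \<bar>l - 1\<bar> = j - 1" unfolding j_def by linarith+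
      show ?thesis unfolding a n ..
    next
      case neg: False
      then have a: "nat \<bar>l + 1\<bar> = j - 1" "nat \<bar>l - 1\<bar> = Suc j" using False unfolding j_def by linarith+
      show ?thesis unfolding a n by (simp only: add.commute[of "x (j - 1)"])
    qed
  qed
  then have "complex_of_real ((x (nat \<bar>l + 1\<bar>) + x (nat \<bar>l - 1\<bar>) - 2 * x j) / h\<^sup>2) = of_real (- 2 * half_lap x j)"
    by (rule arg_cong)
  then show ?thesis unfolding j_def[symmetric] discrete_laplacian_def
    by (simp only: of_real_add of_real_diff of_real_divide of_real_mult of_real_numeral)
qed

lemma discrete_mass_even:
  assumes "supported x"
  shows "discrete_mass h (even_extension x) = S (\<lambda>j. (x j)\<^sup>2)"
proof -
  have "(\<Sum>\<^sub>\<infinity>l. (cmod (even_extension x l))\<^sup>2) = (\<Sum>\<^sub>\<infinity>l\<in>{- int K..int K}. (x (nat \<bar>l\<bar>))\<^sup>2)"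
  proof (rule infsum_cong_neutral)
    fix l :: int assume "l \<in> UNIV - {- int K..int K}"
    then have "K < nat \<bar>l\<bar>" by auto
    then show "(cmod (even_extension x l))\<^sup>2 = 0" using assms by (simp add: supported_def)
  qed auto
  also have "\<dots> = (\<Sum>l\<in>{- int K..int K}. (x (nat \<bar>l\<bar>))\<^sup>2)" by simp
  also have "\<dots> = (\<Sum>j\<le>K. weight j * (x j)\<^sup>2)" by (rule sum_even)
  finally show ?thesis unfolding discrete_mass_def S_def by (rule arg_cong)
qed

lemma even_extension_discrete_space: "supported x \<Longrightarrow> even_extension x \<in> discrete_space K"
  by (auto simp: discrete_space_def supported_def)

lemma discrete_space_even:
  assumes "p \<in> discrete_space K" "\<And>j. p j \<in> \<real>"
  shows "p = even_extension (\<lambda>j. Re (p (int j)))" "supported (\<lambda>j. Re (p (int j)))"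
proof -
  show "p = even_extension (\<lambda>j. Re (p (int j)))"
  proof
    fix l
    have "p l = p (int (nat \<bar>l\<bar>))"
      using assms(1) unfolding discrete_space_def by (cases "l \<ge> 0") auto
    then show "p l = even_extension (\<lambda>j. Re (p (int j))) l" using assms(2)[of l] by (simp add: of_real_Re)
  qed
  show "supported (\<lambda>j. Re (p (int j)))" using assms(1) by (simp add: discrete_space_def supported_def)
qed

lemma implicit_step_even:
  assumes "implicit_step \<tau> u x" "\<bar>l\<bar> \<le> int K"
  shows "even_extension x l = even_extension u l + of_real \<tau> * (1 / 2 * discrete_laplacian h (even_extension x) l
     + of_real ((cmod (even_extension u l))\<^sup>2) * even_extension x l)"
proof -
  define j where "j = nat \<bar>l\<bar>"
  have "j \<le> K" using assms(2) by (simp add: j_def)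
  then have "x j + \<tau> * (half_lap x j - (u j)\<^sup>2 * x j) = u j" using assms(1) by (simp add: implicit_step_def)
  then have "x j = u j - \<tau> * (half_lap x j - (u j)\<^sup>2 * x j)" by (simp only: eq_diff_eq)
  also have "\<dots> = u j + \<tau> * (1 / 2 * (- 2 * half_lap x j) + (u j)\<^sup>2 * x j)" by (simp add: algebra_simps)
  finally have "x j = u j + \<tau> * (1 / 2 * (- 2 * half_lap x j) + (u j)\<^sup>2 * x j)" .
  then have "complex_of_real (x j) = of_real (u j + \<tau> * (1 / 2 * (- 2 * half_lap x j) + (u j)\<^sup>2 * x j))"
    by (rule arg_cong)
  also have "\<dots> = of_real (u j) + of_real \<tau> * (1 / 2 * of_real (- 2 * half_lap x j)
      + of_real ((cmod (of_real (u j)))\<^sup>2) * of_real (x j))" by simp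
  finally show ?thesis unfolding discrete_laplacian_even j_def[symmetric] .
qed

end

section \<open>Convergence of the scheme on a fixed grid\<close>

context truncated_grid
begin

lemma deviation_eq:
  assumes "supported u" shows "sampled_profile h K u" "deviation u = dform (sampled_profile.dev h K u) (sampled_profile.dev h K u) + S (\<lambda>j. (sampled_profile.dev h K u j)\<^sup>2)"
proof -
  show s: "sampled_profile h K u" using assms by unfold_locales
  interpret sampled_profile h K u by (rule s)
  have "dev = (\<lambda>j. u j - soliton j)" by (simp add: dev_def fun_eq_iff)
  then show "deviation u = dform dev dev + S (\<lambda>j. (dev j)\<^sup>2)" by (simp add: deviation_def)
qed

lemma H1_norm_le_deviation:
  assumes "supported u"
  shows "(H1_norm (\<lambda>x. interpolant h (even_extension u) x - ground_state x))\<^sup>2 \<le> 6 * deviation u + 256 * h\<^sup>2"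
proof -
  interpret sampled_profile h K u by (rule deviation_eq(1)[OF assms])
  show ?thesis unfolding interpolant_H1_norm deviation_eq(2)[OF assms] by (rule upper_bound)
qed

lemma deviation_le_H1_norm:
  assumes "supported u"
  shows "deviation u \<le> 4 * (H1_norm (\<lambda>x. interpolant h (even_extension u) x - ground_state x))\<^sup>2 + 400 * h\<^sup>2"
proof -
  interpret sampled_profile h K u by (rule deviation_eq(1)[OF assms])
  show ?thesis unfolding interpolant_H1_norm deviation_eq(2)[OF assms] by (rule lower_bound)
qed

text \<open>The deviation is a squared norm, so its rate is halved and its constant enters by a
  square root: 6 * 500000 * 102 + 256 is below 20000^2.\<close>

lemma gradient_scheme_convergence:
  assumes h_small: "h \<le> 1 / 10^28" and \<tau>: "0 < \<tau>" "\<tau> \<le> 1/4"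
    and p: "p \<in> discrete_space K" "\<And>j. p j \<in> \<real>" "discrete_mass h p = 1"
    and close: "H1_norm (\<lambda>x. interpolant h p x - ground_state x) \<le> 1 / 10^27"
  shows "\<exists>\<psi> \<psi>s. gradient_scheme h K \<tau> p \<psi> \<psi>s \<and>
      (\<forall>\<psi>' \<psi>s'. gradient_scheme h K \<tau> p \<psi>' \<psi>s' \<longrightarrow> \<psi>' = \<psi> \<and> \<psi>s' = \<psi>s) \<and>
      (\<forall>n. \<psi> n \<in> discrete_space K \<and> (\<lambda>x. interpolant h (\<psi> n) x - ground_state x) \<in> H1 \<and>
        H1_norm (\<lambda>x. interpolant h (\<psi> n) x - ground_state x) \<le> 20000 * (exp (- (1 / (2 * 10^8)) * real n * \<tau>) + h))"
proof -
  define u0 where "u0 = (\<lambda>j. Re (p (int j)))"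
  have pe: "p = even_extension u0" and supp: "supported u0"
    unfolding u0_def by (rule discrete_space_even[OF p(1,2)])+
  have mass: "S (\<lambda>j. (u0 j)\<^sup>2) = 1" using p(3) discrete_mass_even[OF supp] by (simp add: pe)
  have h13: "h \<le> 1 / 10^13" using h_small by simp
  have h2: "h\<^sup>2 \<le> (1 / 10^28)\<^sup>2" using h_small h_pos by (intro power_mono) auto
  have H0: "0 \<le> H1_norm f" for f by (simp add: H1_norm_def)
  have "(H1_norm (\<lambda>x. interpolant h p x - ground_state x))\<^sup>2 \<le> (1 / 10^27)\<^sup>2"
    by (rule power_mono[OF close H0])
  \<comment> \<open>The sum is 8 * 10^-54, inside the radius 10^-52 that \<open>good_initial\<close>
    accepts; the bounds on the distance and on h are fixed by this.\<close>
  then have "deviation u0 \<le> 4 * (1 / 10^27)\<^sup>2 + 400 * (1 / 10^28)\<^sup>2"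
    using deviation_le_H1_norm[OF supp] h2 unfolding pe by linarith
  also have "\<dots> \<le> (1 / 10^26)\<^sup>2" by (simp add: power2_eq_square)
  finally have g0: "good u0" by (rule good_initial[OF supp mass h13])
  obtain U X where U: "U 0 = u0" and G: "\<And>n. good (U n)" and X: "\<And>n. implicit_step \<tau> (U n) (X n)"
    and US: "\<And>n. U (Suc n) = normalize (X n)"
    and dev: "\<And>n. deviation (U n) \<le> 500000 * (exp (- (real n * \<tau> / 10^8)) + 102 * h\<^sup>2)"
    using trajectory[OF g0 h13 \<tau>] by blast
  have Us: "supported (U n)" for n using G[of n] by (simp add: good_def)
  have Xs: "supported (X n)" for n using X[of n] by (simp add: implicit_step_def)
  have U1: "cmod (even_extension (U n) l) \<le> 1" for n l
  proof -
    interpret unit_profile h K "U n" by (rule good_unit_profile[OF G])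
    show ?thesis using u_sq_le[of "nat \<bar>l\<bar>"] by (simp add: abs_square_le_1)
  qed
  have Xpos: "0 < S (\<lambda>j. (X n j)\<^sup>2)" for n
  proof -
    interpret unit_profile h K "U n" by (rule good_unit_profile[OF G])
    show ?thesis by (rule implicit_step_nonzero[OF X])
  qed
  define \<psi> where "\<psi> n = even_extension (U n)" for n
  define \<psi>s where "\<psi>s n = even_extension (X n)" for n
  have Xout: "\<psi>s n l = 0" if "\<bar>l\<bar> \<ge> int K + 1" for n l
  proof -
    have "K < nat \<bar>l\<bar>" using that by auto
    then show ?thesis using Xs[of n] by (simp add: \<psi>s_def supported_def)
  qed
  have step: "\<psi>s n l = \<psi> n l + of_real \<tau> * (1 / 2 * discrete_laplacian h (\<psi>s n) l + of_real ((cmod (\<psi> n l))\<^sup>2) * \<psi>s n l)"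
    if "\<bar>l\<bar> \<le> int K" for n l
    unfolding \<psi>_def \<psi>s_def by (rule implicit_step_even[OF X that])
  have Xmass: "discrete_mass h (\<psi>s n) = S (\<lambda>j. (X n j)\<^sup>2)" for n
    unfolding \<psi>s_def by (rule discrete_mass_even[OF Xs])
  have next_\<psi>: "\<psi> (Suc n) l = \<psi>s n l / of_real (sqrt (discrete_mass h (\<psi>s n)))" for n l
    unfolding Xmass unfolding \<psi>_def US normalize_def \<psi>s_def by simp
  have scheme: "gradient_scheme h K \<tau> p \<psi> \<psi>s"
    unfolding gradient_scheme_def
  proof (intro conjI allI impI)
    show "\<psi> 0 = p" by (simp add: \<psi>_def U pe)
    show "discrete_mass h (\<psi>s n) \<noteq> 0" for n using Xpos[of n] by (simp add: Xmass)
  qed (fact step Xout next_\<psi>)+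
  have unique: "\<psi>' = \<psi> \<and> \<psi>s' = \<psi>s" if s: "gradient_scheme h K \<tau> p \<psi>' \<psi>s'" for \<psi>' \<psi>s'
  proof -
    have star: "\<psi>s' n = \<psi>s n" if eq: "\<psi>' n = \<psi> n" for n
    proof (rule implicit_step_unique[OF h_pos \<tau>(1)])
      show "\<tau> < 1" using \<tau> by simp
      show "cmod (\<psi> n l) \<le> 1" for l unfolding \<psi>_def by (rule U1)
      show "\<psi>s' n l = \<psi> n l + of_real \<tau> * (1 / 2 * discrete_laplacian h (\<psi>s' n) l + of_real ((cmod (\<psi> n l))\<^sup>2) * \<psi>s' n l)"
        if "\<bar>l\<bar> \<le> int K" for l unfolding eq[symmetric] by (rule gradient_schemeD(2)[OF s that])
      show "\<psi>s' n l = 0" if "\<bar>l\<bar> \<ge> int K + 1" for l by (rule gradient_schemeD(3)[OF s that])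
    qed (fact step Xout)+
    have "\<psi>' n = \<psi> n" for n
    proof (induction n)
      case 0
      show ?case unfolding gradient_schemeD(1)[OF s] gradient_schemeD(1)[OF scheme] ..
    next
      case (Suc n)
      have "\<psi>' (Suc n) l = \<psi>s' n l / of_real (sqrt (discrete_mass h (\<psi>s' n)))" for l
        by (rule gradient_schemeD(4)[OF s])
      then show ?case unfolding star[OF Suc] next_\<psi>[symmetric] by (rule ext)
    qed
    then have eq: "\<psi>' = \<psi>" by (rule ext)
    have "\<psi>s' = \<psi>s" by (rule ext) (rule star, simp only: eq)
    with eq show ?thesis ..
  qed
  have conv: "H1_norm (\<lambda>x. interpolant h (\<psi> n) x - ground_state x) \<le> 20000 * (exp (- (1 / (2 * 10^8)) * real n * \<tau>) + h)" for n
  proof (rule power2_le_imp_le)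
    define E where "E = exp (- (1 / (2 * 10^8)) * real n * \<tau>)"
    have E: "0 \<le> E" by (simp add: E_def)
    have E2: "exp (- (real n * \<tau> / 10^8)) = E\<^sup>2"
      unfolding E_def power2_eq_square exp_add[symmetric] by (rule arg_cong[where f=exp]) simp
    have "(H1_norm (\<lambda>x. interpolant h (\<psi> n) x - ground_state x))\<^sup>2 \<le> 6 * deviation (U n) + 256 * h\<^sup>2"
      unfolding \<psi>_def by (rule H1_norm_le_deviation[OF Us])
    also have "\<dots> \<le> 6 * (500000 * (E\<^sup>2 + 102 * h\<^sup>2)) + 256 * h\<^sup>2" using dev[of n] unfolding E2 by linarith
    also have "\<dots> \<le> 400000000 * (E\<^sup>2 + h\<^sup>2)" using zero_le_power2[of h] zero_le_power2[of E] by argo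
    also have "\<dots> \<le> 400000000 * (E + h)\<^sup>2"
      using E h_pos by (intro mult_left_mono) (auto simp: power2_sum)
    also have "\<dots> = (20000 * (E + h))\<^sup>2" by (simp only: power_mult_distrib) simp
    finally show "(H1_norm (\<lambda>x. interpolant h (\<psi> n) x - ground_state x))\<^sup>2
        \<le> (20000 * (exp (- (1 / (2 * 10^8)) * real n * \<tau>) + h))\<^sup>2" by (simp only: E_def)
  qed (use h_pos in simp)
  have H1: "(\<lambda>x. interpolant h (\<psi> n) x - ground_state x) \<in> H1" for n
  proof -
    interpret sampled_profile h K "U n" by (rule deviation_eq(1)[OF Us])
    show ?thesis unfolding \<psi>_def by (rule interpolant_H1)
  qed
  have space: "\<psi> n \<in> discrete_space K" for n
    unfolding \<psi>_def by (rule even_extension_discrete_space[OF Us])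
  show ?thesis
  proof (rule exI[of _ \<psi>], rule exI[of _ \<psi>s], intro conjI)
    show "\<forall>\<psi>' \<psi>s'. gradient_scheme h K \<tau> p \<psi>' \<psi>s' \<longrightarrow> \<psi>' = \<psi> \<and> \<psi>s' = \<psi>s"
      using unique by blast
    show "\<forall>n. \<psi> n \<in> discrete_space K \<and> (\<lambda>x. interpolant h (\<psi> n) x - ground_state x) \<in> H1 \<and>
        H1_norm (\<lambda>x. interpolant h (\<psi> n) x - ground_state x) \<le> 20000 * (exp (- (1 / (2 * 10^8)) * real n * \<tau>) + h)"
      using space H1 conv by (intro allI conjI)
  qed (rule scheme)
qed

end

text \<open>The threshold is 16 ln (1/h) / h, so the required physical cut-off h K grows only
  logarithmically as h tends to 0.\<close>

lemma exp_threshold: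
  assumes "0 < (h::real)" shows "\<exists>K0::nat. \<forall>K\<ge>K0. exp (- (h * real K / 4)) \<le> h^4"
proof -
  obtain K0 :: nat where K0: "- (4 * ln (h^4) / h) \<le> real K0" using real_arch_simple by blast
  have "exp (- (h * real K / 4)) \<le> h^4" if "K0 \<le> K" for K
  proof -
    have "- (4 * ln (h^4) / h) \<le> real K" using K0 that by linarith
    then have "h * (- (4 * ln (h^4) / h)) \<le> h * real K" using assms by (intro mult_left_mono) auto
    then have "- (h * real K / 4) \<le> ln (h^4)" using assms by simp
    then have "exp (- (h * real K / 4)) \<le> exp (ln (h^4))" unfolding exp_le_cancel_iff .
    then show ?thesis using assms by simp
  qed
  then show ?thesis by blast
qed

theorem theorem5p2:
  shows "\<exists>B C C1 c :: real. B > 0 \<and> C > 0 \<and> C1 > 0 \<and> c > 0 \<and>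
    (\<exists>h0 > 0. \<exists>\<tau>0 > 0. \<forall>h :: real. 0 < h \<and> h < h0 \<longrightarrow>
      (\<exists>K0 :: nat. \<forall>K :: nat. 0 < K \<and> K0 \<le> K \<longrightarrow>
        (\<forall>\<tau> :: real. 0 < \<tau> \<and> \<tau> < \<tau>0 \<longrightarrow>
          (\<forall>\<psi>0 \<in> discrete_space K.
            (\<forall>j. \<psi>0 j \<in> \<real>) \<and>
            discrete_mass h \<psi>0 = 1 \<and>
            H1_norm (\<lambda>x. interpolant h \<psi>0 x - ground_state x) \<le> B \<longrightarrow>
            (\<exists>\<psi> \<psi>s. gradient_scheme h K \<tau> \<psi>0 \<psi> \<psi>s \<and>
              (\<forall>\<psi>' \<psi>s'. gradient_scheme h K \<tau> \<psi>0 \<psi>' \<psi>s' \<longrightarrow> \<psi>' = \<psi> \<and> \<psi>s' = \<psi>s) \<and>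
              (\<forall>n. \<psi> n \<in> discrete_space K \<and>
                (\<lambda>x. interpolant h (\<psi> n) x - ground_state x) \<in> H1 \<and>
                H1_norm (\<lambda>x. interpolant h (\<psi> n) x - ground_state x)
                  \<le> C * (exp (- c * real n * \<tau>) + h
                         + 1 / h\<^sup>2 * exp (- C1 * h * real K))))))))"
\<comment> \<open>Three of the witnesses are the constants of
  \<open>gradient_scheme_convergence\<close>. Any positive value would do for the third,
  \<open>C1\<close>: its term is nonnegative, and as the threshold for \<open>K\<close> is chosen
  after h, the effect of the cut-off is already contained in the summand h.\<close>
proof (rule exI[of _ "1 / 10^27"], rule exI[of _ 20000], rule exI[of _ 1], rule exI[of _ "1 / (2 * 10^8)"], intro conjI)
  show "\<exists>h0 > 0. \<exists>\<tau>0 > 0. \<forall>h :: real. 0 < h \<and> h < h0 \<longrightarrow>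
      (\<exists>K0 :: nat. \<forall>K :: nat. 0 < K \<and> K0 \<le> K \<longrightarrow>
        (\<forall>\<tau> :: real. 0 < \<tau> \<and> \<tau> < \<tau>0 \<longrightarrow>
          (\<forall>\<psi>0 \<in> discrete_space K.
            (\<forall>j. \<psi>0 j \<in> \<real>) \<and>
            discrete_mass h \<psi>0 = 1 \<and>
            H1_norm (\<lambda>x. interpolant h \<psi>0 x - ground_state x) \<le> 1 / 10^27 \<longrightarrow>
            (\<exists>\<psi> \<psi>s. gradient_scheme h K \<tau> \<psi>0 \<psi> \<psi>s \<and>
              (\<forall>\<psi>' \<psi>s'. gradient_scheme h K \<tau> \<psi>0 \<psi>' \<psi>s' \<longrightarrow> \<psi>' = \<psi> \<and> \<psi>s' = \<psi>s) \<and>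
              (\<forall>n. \<psi> n \<in> discrete_space K \<and>
                (\<lambda>x. interpolant h (\<psi> n) x - ground_state x) \<in> H1 \<and>
                H1_norm (\<lambda>x. interpolant h (\<psi> n) x - ground_state x)
                  \<le> 20000 * (exp (- (1 / (2 * 10^8)) * real n * \<tau>) + h
                         + 1 / h\<^sup>2 * exp (- 1 * h * real K)))))))"
  proof (rule exI[of _ "1 / 10^28"], intro conjI, simp, rule exI[of _ "1/4"], intro conjI, simp, intro allI impI)
    fix h :: real assume h: "0 < h \<and> h < 1 / 10^28"
    then obtain K0 :: nat where K0: "\<And>K. K0 \<le> K \<Longrightarrow> exp (- (h * real K / 4)) \<le> h^4" using exp_threshold by blast
    show "\<exists>K0 :: nat. \<forall>K :: nat. 0 < K \<and> K0 \<le> K \<longrightarrow>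
        (\<forall>\<tau> :: real. 0 < \<tau> \<and> \<tau> < 1/4 \<longrightarrow>
          (\<forall>\<psi>0 \<in> discrete_space K.
            (\<forall>j. \<psi>0 j \<in> \<real>) \<and>
            discrete_mass h \<psi>0 = 1 \<and>
            H1_norm (\<lambda>x. interpolant h \<psi>0 x - ground_state x) \<le> 1 / 10^27 \<longrightarrow>
            (\<exists>\<psi> \<psi>s. gradient_scheme h K \<tau> \<psi>0 \<psi> \<psi>s \<and>
              (\<forall>\<psi>' \<psi>s'. gradient_scheme h K \<tau> \<psi>0 \<psi>' \<psi>s' \<longrightarrow> \<psi>' = \<psi> \<and> \<psi>s' = \<psi>s) \<and>
              (\<forall>n. \<psi> n \<in> discrete_space K \<and>
                (\<lambda>x. interpolant h (\<psi> n) x - ground_state x) \<in> H1 \<and>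
                H1_norm (\<lambda>x. interpolant h (\<psi> n) x - ground_state x)
                  \<le> 20000 * (exp (- (1 / (2 * 10^8)) * real n * \<tau>) + h
                         + 1 / h\<^sup>2 * exp (- 1 * h * real K))))))"
    proof (intro exI[of _ K0] allI impI ballI)
      fix K :: nat and \<tau> :: real and \<psi>0
      assume K: "0 < K \<and> K0 \<le> K" and \<tau>: "0 < \<tau> \<and> \<tau> < 1/4" and p: "\<psi>0 \<in> discrete_space K"
        and a: "(\<forall>j. \<psi>0 j \<in> \<real>) \<and> discrete_mass h \<psi>0 = 1 \<and>
            H1_norm (\<lambda>x. interpolant h \<psi>0 x - ground_state x) \<le> 1 / 10^27"
      have "h \<le> 1/2" using h by simp
      then interpret truncated_grid h K using h K0[of K] K by unfold_locales auto
      have weaken: "x \<le> 20000 * (y + h + 1 / h\<^sup>2 * exp (- 1 * h * real K))" if "x \<le> 20000 * (y + h)" for x y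
        by (rule order.trans[OF that]) simp
      have "\<exists>\<psi> \<psi>s. gradient_scheme h K \<tau> \<psi>0 \<psi> \<psi>s \<and>
          (\<forall>\<psi>' \<psi>s'. gradient_scheme h K \<tau> \<psi>0 \<psi>' \<psi>s' \<longrightarrow> \<psi>' = \<psi> \<and> \<psi>s' = \<psi>s) \<and>
          (\<forall>n. \<psi> n \<in> discrete_space K \<and> (\<lambda>x. interpolant h (\<psi> n) x - ground_state x) \<in> H1 \<and>
            H1_norm (\<lambda>x. interpolant h (\<psi> n) x - ground_state x) \<le> 20000 * (exp (- (1 / (2 * 10^8)) * real n * \<tau>) + h))"
        by (rule gradient_scheme_convergence[OF _ _ _ p]) (use h \<tau> a in simp_all)
      then obtain \<psi> \<psi>s where scheme: "gradient_scheme h K \<tau> \<psi>0 \<psi> \<psi>s"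
        and unique: "\<forall>\<psi>' \<psi>s'. gradient_scheme h K \<tau> \<psi>0 \<psi>' \<psi>s' \<longrightarrow> \<psi>' = \<psi> \<and> \<psi>s' = \<psi>s"
        and conv: "\<forall>n. \<psi> n \<in> discrete_space K \<and> (\<lambda>x. interpolant h (\<psi> n) x - ground_state x) \<in> H1 \<and>
            H1_norm (\<lambda>x. interpolant h (\<psi> n) x - ground_state x) \<le> 20000 * (exp (- (1 / (2 * 10^8)) * real n * \<tau>) + h)"
        by (elim exE conjE)
      show "\<exists>\<psi> \<psi>s. gradient_scheme h K \<tau> \<psi>0 \<psi> \<psi>s \<and>
              (\<forall>\<psi>' \<psi>s'. gradient_scheme h K \<tau> \<psi>0 \<psi>' \<psi>s' \<longrightarrow> \<psi>' = \<psi> \<and> \<psi>s' = \<psi>s) \<and>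
              (\<forall>n. \<psi> n \<in> discrete_space K \<and>
                (\<lambda>x. interpolant h (\<psi> n) x - ground_state x) \<in> H1 \<and>
                H1_norm (\<lambda>x. interpolant h (\<psi> n) x - ground_state x)
                  \<le> 20000 * (exp (- (1 / (2 * 10^8)) * real n * \<tau>) + h
                         + 1 / h\<^sup>2 * exp (- 1 * h * real K)))"
      proof (rule exI[of _ \<psi>], rule exI[of _ \<psi>s], intro conjI)
        show "\<forall>n. \<psi> n \<in> discrete_space K \<and> (\<lambda>x. interpolant h (\<psi> n) x - ground_state x) \<in> H1 \<and>
            H1_norm (\<lambda>x. interpolant h (\<psi> n) x - ground_state x)
              \<le> 20000 * (exp (- (1 / (2 * 10^8)) * real n * \<tau>) + h + 1 / h\<^sup>2 * exp (- 1 * h * real K))"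
          using conv weaken by blast
      qed (fact scheme unique)+
    qed
  qed
qed simp_all

end
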